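(* Let $\mathbf a\in\mathbb E^3$ be a nonzero vector, $a:=\|\mathbf a\|$, $\mathbf k:=-\mathbf a/a$, let $\mathbf E:\mathbb T^k\to\mathbb E^3$ be smooth, and consider on the unit sphere $\mathbb S^2\subset\mathbb E^3$ the system of a charged particle without magnetic field and damping, $$\nabla_{\dot{\mathbf x}}\dot{\mathbf x}=\mathbf f(t\omega,\mathbf x),\qquad \mathbf f(\varphi,\mathbf x)=-\frac{\mathbf x+a\mathbf k}{\|\mathbf x+a\mathbf k\|^3}+\mathbf E(\varphi)+\left\langle\frac{\mathbf x+a\mathbf k}{\|\mathbf x+a\mathbf k\|^3}-\mathbf E(\varphi),\mathbf x\right\rangle\mathbf x .$$ If $$\frac{a}{(1+a)^3}-\langle\mathbf E(\varphi),\mathbf k\rangle>0\quad\forall\varphi\in\mathbb T^k$$ and there exists a point $\varphi_0\in\mathbb T^k$ such that $\mathbf E(\varphi_0)\not\parallel\mathbf k$, then this system has a unique $\omega$-quasiperiodic solution located in the hemisphere $\{\mathbf x\in\mathbb S^2:0<\langle\mathbf x,\mathbf k\rangle\le1\}$. This solution is hyperbolic.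
   Context: $\mathbb E^3=(\mathbb R^3,\langle\cdot,\cdot\rangle)$ is 3-dimensional Euclidean space; $\mathbb S^2=\{\mathbf x\in\mathbb E^3:\|\mathbf x\|=1\}$ carries the induced Riemannian metric, with Levi-Civita connection $\nabla$; $\nabla_{\dot{\mathbf x}}\dot{\mathbf x}$ is the covariant derivative of $\dot{\mathbf x}$ along the curve $\mathbf x(t)\in\mathbb S^2$. $\mathbb T^k=\mathbb R^k/2\pi\mathbb Z^k$ (the integer $k$ is unrelated to the vector $\mathbf k$); $\omega\in\mathbb R^k$ has rationally independent components. A solution is $\omega$-quasiperiodic if $\mathbf x(t)\equiv u(t\omega)$ for some continuous mapping $u:\mathbb T^k\to\mathbb S^2$. A solution $\mathbf x(t)$ on $\mathbb R$, with $\tau(t)=\dot{\mathbf x}(t)$, is hyperbolic if its variational system for tangent vector fields $\eta,\zeta$ along $\mathbf x(\cdot)$, $$\nabla_\tau\eta=\zeta,\qquad\nabla_\tau\zeta=\nabla_\eta\mathbf f(t\omega,\mathbf x(t))-R(\eta,\tau(t))\tau(t),$$ is exponentially dichotomic on $\mathbb R$ (i.e., written in a parallel orthonormal frame along $\mathbf x(\cdot)$, this linear ODE system on $\mathbb R^4$ has an exponential dichotomy on $\mathbb R$); here $R$ is the curvature tensor with the convention that $\langle R(\xi,\eta)\eta,\xi\rangle/(\|\xi\|^2\|\eta\|^2-\langle\xi,\eta\rangle^2)$ is the sectional curvature. *)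

theory Defs
  imports "HOL-Analysis.Analysis"
begin

text \<open>
  The Euclidean space is \<open>real^3\<close>, the unit sphere is \<open>sphere 0 1\<close>.  A function on the torus
  \<open>\<real>\<^sup>k / 2\<pi>\<int>\<^sup>k\<close> is a function on \<open>real^'k\<close> that is \<open>2\<pi>\<close>-periodic in each coordinate; continuity and
  smoothness on the torus are those of this lift.
\<close>

definition torus_periodic :: "(real^'k \<Rightarrow> 'b) \<Rightarrow> bool" where
  "torus_periodic g \<longleftrightarrow> (\<forall>\<phi> i. g (\<phi> + axis i (2 * pi)) = g \<phi>)"

definition rationally_independent :: "real^'k \<Rightarrow> bool" where
  "rationally_independent \<omega> \<longleftrightarrow>
     (\<forall>m :: 'k \<Rightarrow> int. (\<Sum>i\<in>UNIV. of_int (m i) * \<omega> $ i) = 0 \<longrightarrow> (\<forall>i. m i = 0))"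

primrec C_diff :: "nat \<Rightarrow> (real^'k \<Rightarrow> 'b::real_normed_vector) \<Rightarrow> bool" where
  "C_diff 0 g \<longleftrightarrow> continuous_on UNIV g"
| "C_diff (Suc n) g \<longleftrightarrow> (\<forall>\<phi>. g differentiable (at \<phi>)) \<and>
     (\<forall>i. C_diff n (\<lambda>\<phi>. frechet_derivative g (at \<phi>) (axis i 1)))"

definition smooth :: "(real^'k \<Rightarrow> 'b::real_normed_vector) \<Rightarrow> bool" where
  "smooth g \<longleftrightarrow> (\<forall>n. C_diff n g)"


text \<open>
  The Levi-Civita connection of the metric induced on the sphere is the tangential part of the
  derivative in the ambient space.  A tangent vector field on (a part of) the sphere is given by an
  extension to a neighbourhood in \<open>real^3\<close>; for tangent \<open>\<eta>\<close> the value of \<open>cov_deriv V x \<eta>\<close> does not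
  depend on the choice of the differentiable extension.
\<close>

definition tan_proj :: "real^3 \<Rightarrow> real^3 \<Rightarrow> real^3" where
  "tan_proj x w = w - (w \<bullet> x) *\<^sub>R x"

definition cov_deriv :: "(real^3 \<Rightarrow> real^3) \<Rightarrow> real^3 \<Rightarrow> real^3 \<Rightarrow> real^3" where
  "cov_deriv V x \<eta> = tan_proj x (frechet_derivative V (at x) \<eta>)"

definition has_cov_deriv_along ::
    "(real \<Rightarrow> real^3) \<Rightarrow> (real \<Rightarrow> real^3) \<Rightarrow> real^3 \<Rightarrow> real \<Rightarrow> bool" where
  "has_cov_deriv_along x V D t \<longleftrightarrow>
     (\<exists>W. (V has_vector_derivative W) (at t) \<and> D = tan_proj (x t) W)"

definition lie_bracket :: "(real^3 \<Rightarrow> real^3) \<Rightarrow> (real^3 \<Rightarrow> real^3) \<Rightarrow> real^3 \<Rightarrow> real^3" where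
  "lie_bracket X Y x = frechet_derivative Y (at x) (X x) - frechet_derivative X (at x) (Y x)"

text \<open>
  The curvature tensor \<open>R(\<xi>, \<eta>)\<zeta> = \<nabla>\<^sub>X \<nabla>\<^sub>Y Z - \<nabla>\<^sub>Y \<nabla>\<^sub>X Z - \<nabla>\<^bsub>[X,Y]\<^esub> Z\<close> at \<open>x\<close>, evaluated on the tangent
  vector fields obtained by projecting the constant fields \<open>\<xi>\<close>, \<open>\<eta>\<close>, \<open>\<zeta>\<close>.
\<close>

definition curvature :: "real^3 \<Rightarrow> real^3 \<Rightarrow> real^3 \<Rightarrow> real^3 \<Rightarrow> real^3" where
  "curvature x \<xi> \<eta> \<zeta> =
     (let X = (\<lambda>y. tan_proj y \<xi>); Y = (\<lambda>y. tan_proj y \<eta>); Z = (\<lambda>y. tan_proj y \<zeta>)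
      in cov_deriv (\<lambda>y. cov_deriv Z y (Y y)) x (X x)
         - cov_deriv (\<lambda>y. cov_deriv Z y (X y)) x (Y x)
         - cov_deriv Z x (lie_bracket X Y x))"

lemma frechet_derivative_tan_proj:
  "frechet_derivative (\<lambda>y. tan_proj y \<zeta>) (at y) v = - (\<zeta> \<bullet> v) *\<^sub>R y - (\<zeta> \<bullet> y) *\<^sub>R v"
proof -
  have "((\<lambda>y. tan_proj y \<zeta>) has_derivative (\<lambda>v. - (\<zeta> \<bullet> v) *\<^sub>R y - (\<zeta> \<bullet> y) *\<^sub>R v)) (at y)"
    unfolding tan_proj_def by (auto intro!: derivative_eq_intros simp: algebra_simps)
  from fun_cong[OF frechet_derivative_at[OF this], of v] show ?thesis by (rule sym)
qed

lemma curvature_eq: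
  assumes "norm x = 1" "\<xi> \<bullet> x = 0" "\<eta> \<bullet> x = 0" "\<zeta> \<bullet> x = 0"
  shows "curvature x \<xi> \<eta> \<zeta> = (\<eta> \<bullet> \<zeta>) *\<^sub>R \<xi> - (\<xi> \<bullet> \<zeta>) *\<^sub>R \<eta>"
proof -
  have xx: "x \<bullet> x = 1" using assms(1) by (simp add: dot_square_norm)
  have D: "cov_deriv (\<lambda>y. cov_deriv (\<lambda>y. tan_proj y \<zeta>) y (tan_proj y \<beta>)) x \<alpha> = - ((\<alpha> \<bullet> \<zeta>) *\<^sub>R \<beta>)"
    if a: "\<alpha> \<bullet> x = 0" and b: "\<beta> \<bullet> x = 0" for \<alpha> \<beta>
  proof -
    let ?V = "\<lambda>y. tan_proj y (- (\<zeta> \<bullet> tan_proj y \<beta>) *\<^sub>R y - (\<zeta> \<bullet> y) *\<^sub>R tan_proj y \<beta>)"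
    have e: "(\<lambda>y. cov_deriv (\<lambda>y. tan_proj y \<zeta>) y (tan_proj y \<beta>)) = ?V"
      by (simp add: cov_deriv_def frechet_derivative_tan_proj)
    define T where "T = (\<lambda>y. tan_proj y \<beta>)"
    define w where "w = (\<lambda>y. - (\<zeta> \<bullet> T y) *\<^sub>R y - (\<zeta> \<bullet> y) *\<^sub>R T y)"
    have b': "\<beta> \<bullet> x = 0" "x \<bullet> \<beta> = 0" using b by (simp_all add: inner_commute)
    have Tx: "T x = \<beta>" using b by (simp add: T_def tan_proj_def)
    have "(T has_derivative (\<lambda>v. - (\<beta> \<bullet> v) *\<^sub>R x - (\<beta> \<bullet> x) *\<^sub>R v)) (at x)"
      unfolding T_def tan_proj_def by (auto intro!: derivative_eq_intros simp: algebra_simps)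
    then have T': "(T has_derivative (\<lambda>v. - ((\<beta> \<bullet> v) *\<^sub>R x))) (at x)"
      by (simp only: b' scaleR_zero_left diff_zero scaleR_minus_left)
    have "(w has_derivative (\<lambda>v. - ((\<zeta> \<bullet> T x) *\<^sub>R v + (\<zeta> \<bullet> (- ((\<beta> \<bullet> v) *\<^sub>R x))) *\<^sub>R x)
            - ((\<zeta> \<bullet> x) *\<^sub>R (- ((\<beta> \<bullet> v) *\<^sub>R x)) + (\<zeta> \<bullet> v) *\<^sub>R T x))) (at x)"
      unfolding w_def scaleR_minus_left
      by (intro has_derivative_diff has_derivative_minus has_derivative_scaleR
          has_derivative_inner_right T' has_derivative_ident)
    then have w': "(w has_derivative (\<lambda>v. - ((\<zeta> \<bullet> \<beta>) *\<^sub>R v) - (\<zeta> \<bullet> v) *\<^sub>R \<beta>)) (at x)"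
      using assms by (simp add: Tx)
    have wx: "w x = - (\<zeta> \<bullet> \<beta>) *\<^sub>R x" using assms by (simp add: w_def Tx)
    define F where "F = (\<lambda>v. (- ((\<zeta> \<bullet> \<beta>) *\<^sub>R v) - (\<zeta> \<bullet> v) *\<^sub>R \<beta>) - ((w x \<bullet> x) *\<^sub>R v
            + (w x \<bullet> v + (- ((\<zeta> \<bullet> \<beta>) *\<^sub>R v) - (\<zeta> \<bullet> v) *\<^sub>R \<beta>) \<bullet> x) *\<^sub>R x))"
    have "((\<lambda>y. tan_proj y (w y)) has_derivative F) (at x)"
      unfolding tan_proj_def F_def
      by (intro has_derivative_diff has_derivative_scaleR has_derivative_inner
          w' has_derivative_ident)
    then have F: "(?V has_derivative F) (at x)" by (simp add: w_def T_def)
    have Fa: "F \<alpha> = - ((\<alpha> \<bullet> \<zeta>) *\<^sub>R \<beta>)"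
      using a b xx by (simp add: F_def wx inner_diff_left inner_diff_right inner_commute)
    show ?thesis
      unfolding e using frechet_derivative_at[OF F] Fa b by (simp add: cov_deriv_def tan_proj_def)
  qed
  have T: "tan_proj x \<xi> = \<xi>" "tan_proj x \<eta> = \<eta>"
    using assms by (simp_all add: tan_proj_def)
  have B: "lie_bracket (\<lambda>y. tan_proj y \<xi>) (\<lambda>y. tan_proj y \<eta>) x = 0"
    using assms by (simp add: lie_bracket_def T frechet_derivative_tan_proj inner_commute)
  show ?thesis
    using assms by (simp add: curvature_def Let_def D T B inner_commute frechet_derivative_tan_proj
        cov_deriv_def[of "\<lambda>y. tan_proj y \<zeta>" x 0] tan_proj_def[of x 0])
qed


text \<open>Exponential dichotomy on \<open>\<real>\<close> of the linear system \<open>z' = A(t) z\<close>, with fundamental matrix \<open>X\<close>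
  and projection \<open>P\<close>.\<close>

definition exp_dichotomy :: "(real \<Rightarrow> real^'n^'n) \<Rightarrow> bool" where
  "exp_dichotomy A \<longleftrightarrow>
     (\<exists>(X :: real \<Rightarrow> real^'n^'n) (P :: real^'n^'n) C \<alpha>.
        (\<forall>t. (X has_vector_derivative (A t ** X t)) (at t)) \<and> (\<forall>t. invertible (X t)) \<and>
        P ** P = P \<and> C > 0 \<and> \<alpha> > 0 \<and>
        (\<forall>s t. s \<le> t \<longrightarrow>
           onorm ((*v) (X t ** P ** matrix_inv (X s))) \<le> C * exp (- \<alpha> * (t - s))) \<and>
        (\<forall>s t. t \<le> s \<longrightarrow>
           onorm ((*v) (X t ** (mat 1 - P) ** matrix_inv (X s))) \<le> C * exp (- \<alpha> * (s - t))))"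


text \<open>In the following, \<open>f \<phi> x\<close> is a force field on the sphere that depends on \<open>\<phi>\<close> in the torus.\<close>

definition velocity :: "(real \<Rightarrow> real^3) \<Rightarrow> real \<Rightarrow> real^3" where
  "velocity x t = vector_derivative x (at t)"

definition is_solution ::
    "(real^'k \<Rightarrow> real^3 \<Rightarrow> real^3) \<Rightarrow> real^'k \<Rightarrow> (real \<Rightarrow> real^3) \<Rightarrow> bool" where
  "is_solution f \<omega> x \<longleftrightarrow>
     (\<forall>t. x t \<in> sphere 0 1 \<and> x differentiable (at t) \<and>
          has_cov_deriv_along x (velocity x) (f (t *\<^sub>R \<omega>) (x t)) t)"

definition quasiperiodic :: "real^'k \<Rightarrow> (real \<Rightarrow> real^3) \<Rightarrow> bool" where
  "quasiperiodic \<omega> x \<longleftrightarrow>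
     (\<exists>u :: real^'k \<Rightarrow> real^3. continuous_on UNIV u \<and> torus_periodic u \<and> range u \<subseteq> sphere 0 1 \<and>
        (\<forall>t. x t = u (t *\<^sub>R \<omega>)))"

definition parallel_orthonormal_frame ::
    "(real \<Rightarrow> real^3) \<Rightarrow> (2 \<Rightarrow> real \<Rightarrow> real^3) \<Rightarrow> bool" where
  "parallel_orthonormal_frame x e \<longleftrightarrow>
     (\<forall>t. (\<forall>i. e i t \<bullet> x t = 0) \<and> (\<forall>i j. e i t \<bullet> e j t = (if i = j then 1 else 0)) \<and>
          (\<forall>i. has_cov_deriv_along x (e i) 0 t))"

definition variational_rhs ::
    "(real^'k \<Rightarrow> real^3 \<Rightarrow> real^3) \<Rightarrow> real^'k \<Rightarrow> (real \<Rightarrow> real^3) \<Rightarrow> real \<Rightarrow> real^3 \<Rightarrow> real^3" where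
  "variational_rhs f \<omega> x t \<eta> =
     cov_deriv (f (t *\<^sub>R \<omega>)) (x t) \<eta> - curvature (x t) \<eta> (velocity x t) (velocity x t)"

text \<open>
  For \<open>\<eta> = p\<^sub>1 e\<^sub>1 + p\<^sub>2 e\<^sub>2\<close> and \<open>\<zeta> = q\<^sub>1 e\<^sub>1 + q\<^sub>2 e\<^sub>2\<close> the variational system \<open>\<nabla>\<^sub>\<tau> \<eta> = \<zeta>\<close>,
  \<open>\<nabla>\<^sub>\<tau> \<zeta> = variational_rhs \<eta>\<close> reads \<open>z' = A(t) z\<close> with \<open>z = (p\<^sub>1, p\<^sub>2, q\<^sub>1, q\<^sub>2)\<close> and \<open>A\<close> as follows.
\<close>

definition variational_matrix ::
    "(real^'k \<Rightarrow> real^3 \<Rightarrow> real^3) \<Rightarrow> real^'k \<Rightarrow> (real \<Rightarrow> real^3) \<Rightarrow> (2 \<Rightarrow> real \<Rightarrow> real^3) \<Rightarrow>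
     real \<Rightarrow> real^4^4" where
  "variational_matrix f \<omega> x e t =
     (let b = (\<lambda>i j. variational_rhs f \<omega> x t (e j t) \<bullet> e i t)
      in vector [vector [0, 0, 1, 0],
                 vector [0, 0, 0, 1],
                 vector [b 1 1, b 1 2, 0, 0],
                 vector [b 2 1, b 2 2, 0, 0]])"

text \<open>Parallel orthonormal frames along \<open>x\<close> differ by a constant orthogonal matrix, so the choice of
  the frame is immaterial.\<close>

definition hyperbolic ::
    "(real^'k \<Rightarrow> real^3 \<Rightarrow> real^3) \<Rightarrow> real^'k \<Rightarrow> (real \<Rightarrow> real^3) \<Rightarrow> bool" where
  "hyperbolic f \<omega> x \<longleftrightarrow>
     (\<exists>e. parallel_orthonormal_frame x e \<and> exp_dichotomy (variational_matrix f \<omega> x e))"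


definition force :: "real \<Rightarrow> real^3 \<Rightarrow> (real^'k \<Rightarrow> real^3) \<Rightarrow> real^'k \<Rightarrow> real^3 \<Rightarrow> real^3" where
  "force a k E \<phi> x =
     - ((x + a *\<^sub>R k) /\<^sub>R norm (x + a *\<^sub>R k) ^ 3) + E \<phi>
     + (((x + a *\<^sub>R k) /\<^sub>R norm (x + a *\<^sub>R k) ^ 3 - E \<phi>) \<bullet> x) *\<^sub>R x"

definition hemisphere :: "real^3 \<Rightarrow> (real^3) set" where
  "hemisphere k = {x \<in> sphere 0 1. 0 < x \<bullet> k \<and> x \<bullet> k \<le> 1}"

end

theory Submission
  imports Defs
begin

text \<open>
  Let \<open>h = x \<bullet> k\<close> be the height of the particle and \<open>G = E - (a / \<rho>\<^sup>3) k\<close>, with \<open>\<rho> = \<parallel>x + a k\<parallel>\<close>,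
  the ambient force up to a multiple of \<open>x\<close>. On the sphere \<open>\<rho> \<le> 1 + a\<close>, so by compactness of the
  torus the hypothesis says \<open>- G \<bullet> k \<ge> \<delta>\<close> on the hemisphere for some \<open>\<delta> > 0\<close>: the force pushes
  the particle away from the pole \<open>k\<close>, and the particle is an inverted pendulum. Dividing by \<open>h\<close>
  removes the curvature of the sphere: the height satisfies
  \<open>h'' = - (\<parallel>x'\<parallel>\<^sup>2 + G \<bullet> x) h + G \<bullet> k\<close>, and the terms with \<open>\<parallel>x'\<parallel>\<^sup>2\<close> and \<open>G \<bullet> x\<close> are the same in
  the equations for a motion and for a variation.

  \<^bold>\<open>Uniqueness.\<close> Close to the equator \<open>h'' < 0\<close> holds uniformly, so a motion that stays in the
  hemisphere for all times has \<open>h \<ge> h\<^sub>0 > 0\<close> (\<open>motion_stays_high\<close>). For two such motions let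
  \<open>r = \<parallel>x1 - x2\<parallel>\<^sup>2 / (2 h1 h2)\<close>. Then \<open>(h1 h2 r')' \<ge> \<delta> \<parallel>x1 - x2\<parallel>\<^sup>2\<close>, and a bounded \<open>r\<close>
  with this property vanishes (\<open>motion_unique\<close>).

  \<^bold>\<open>Existence.\<close> The gnomonic coordinates \<open>y = x / h - k\<close> and \<open>p = h\<^sup>2 y'\<close> turn the equation into
  the first-order system \<open>y' = (1 + \<parallel>y\<parallel>\<^sup>2) p\<close>, \<open>p' = h (E\<^sub>\<bottom> - (G \<bullet> k) y)\<close>, with
  \<open>h = (1 + \<parallel>y\<parallel>\<^sup>2)\<^sup>-\<^sup>1\<^sup>/\<^sup>2\<close> and \<open>E\<^sub>\<bottom>\<close> the part of \<open>E\<close> orthogonal to \<open>k\<close>, whose force \<open>p'\<close> is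
  bounded as long as \<open>y\<close> is. Shooting with Brouwer's theorem gives a solution with \<open>y = 0\<close> at
  both ends of any time interval. It satisfies \<open>\<parallel>y\<parallel> \<le> R\<close> because \<open>y \<bullet> p\<close> increases wherever
  \<open>\<parallel>y\<parallel> > R\<close>, and a limit over longer and longer intervals gives a motion confined to \<open>\<parallel>y\<parallel> \<le> R\<close>
  for all times (\<open>confined_exists\<close>). This applies to every initial phase \<open>\<phi>\<close>. The confined
  motion is unique, so its initial state is a periodic function of \<open>\<phi>\<close>, which is continuous
  since its graph is closed; evaluated along \<open>t \<omega>\<close> it is the quasiperiodic solution
  (\<open>quasiperiodic_motion_exists\<close>).

  \<^bold>\<open>Hyperbolicity.\<close> A variation \<open>\<eta>\<close> in a parallel frame obeys
  \<open>\<eta>'' \<bullet> \<eta> \<ge> - (\<parallel>x'\<parallel>\<^sup>2 + G \<bullet> x) \<parallel>\<eta>\<parallel>\<^sup>2 = (h'' - G \<bullet> k) / h \<parallel>\<eta>\<parallel>\<^sup>2\<close>. Hence the quadratic form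
  \<open>V = \<eta> \<bullet> \<eta>' - (h' / h) \<parallel>\<eta>\<parallel>\<^sup>2\<close>, which is \<open>h\<^sup>2 w \<bullet> w'\<close> for \<open>w = \<eta> / h\<close>, grows along every
  variation at a rate at least \<open>c (\<parallel>\<eta>\<parallel>\<^sup>2 + \<parallel>\<eta>'\<parallel>\<^sup>2)\<close> (\<open>motion_hyperbolic\<close>). A bounded quadratic
  form with this growth forces an exponential dichotomy: the stable solutions are those on which
  \<open>V\<close> stays nonpositive, the unstable ones those on which it stays nonnegative
  (\<open>exp_dichotomy_if_quadratic_form_grows\<close>).
\<close>

section \<open>Global solutions of ordinary differential equations\<close>

lemma antiderivative_real_line:
  fixes f :: "real \<Rightarrow> 'a::banach"
  assumes f: "continuous_on UNIV f"
  obtains F where "F 0 = 0" "\<And>t. (F has_vector_derivative f t) (at t)"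
proof (rule that[of "\<lambda>t. integral {0..t} f - integral {t..0} f"])
  let ?F = "\<lambda>t. integral {0..t} f - integral {t..0} f"
  show "?F 0 = 0" by simp
  fix t :: real
  define N where "N = \<bar>t\<bar> + 1"
  have c: "continuous_on {- N..N} f" using f continuous_on_subset by blast
  have "((\<lambda>u. integral {- N..u} f) has_vector_derivative f t) (at t within {- N..N})"
    by (rule integral_has_vector_derivative[OF c]) (auto simp: N_def)
  then have "((\<lambda>u. integral {- N..u} f) has_vector_derivative f t) (at t within {- N<..<N})"
    by (rule has_vector_derivative_within_subset) auto
  then have "((\<lambda>u. integral {- N..u} f - integral {- N..0} f) has_vector_derivative f t) (at t within {- N<..<N})"
    by (auto intro!: derivative_eq_intros)
  then have "(?F has_vector_derivative f t) (at t within {- N<..<N})"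
  proof (rule has_vector_derivative_transform[rotated -1])
    show "t \<in> {- N<..<N}" by (auto simp: N_def)
    fix u assume u: "u \<in> {- N<..<N}"
    have int: "f integrable_on {p..q}" if "- N \<le> p" "q \<le> N" for p q
      by (rule integrable_continuous_real, rule continuous_on_subset[OF c]) (use that in auto)
    show "?F u = integral {- N..u} f - integral {- N..0} f"
    proof (cases "0 \<le> u")
      case True
      then have "integral {- N..0} f + integral {0..u} f = integral {- N..u} f"
        using u by (intro Henstock_Kurzweil_Integration.integral_combine int) (auto simp: N_def)
      moreover have "integral {u..0} f = 0" using True by (cases "u = 0") auto
      ultimately show ?thesis by (simp add: algebra_simps)
    next
      case False
      then have "integral {- N..u} f + integral {u..0} f = integral {- N..0} f"
        using u by (intro Henstock_Kurzweil_Integration.integral_combine int) (auto simp: N_def)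
      moreover have "integral {0..u} f = 0" using False by auto
      ultimately show ?thesis by (simp add: algebra_simps)
    qed
  qed
  then show "(?F has_vector_derivative f t) (at t)"
  proof -
    have "at t within {- N<..<N} = at t" by (rule at_within_open) (auto simp: N_def)
    with \<open>(?F has_vector_derivative f t) (at t within {- N<..<N})\<close> show ?thesis by metis
  qed
qed

lemma antiderivative_exponential_bound:
  fixes F :: "real \<Rightarrow> 'a::real_normed_vector"
  assumes F: "\<And>t. (F has_vector_derivative f t) (at t)" and F0: "F 0 = 0" and M: "M > 0"
    and f: "\<And>t. norm (f t) \<le> K * exp (M * \<bar>t\<bar>)"
  shows "norm (F t) \<le> K / M * exp (M * \<bar>t\<bar>)"
proof -
  have K: "K \<ge> 0" using f[of 0] norm_ge_zero[of "f 0"] by (simp del: norm_ge_zero)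
  have *: "norm (G t) \<le> K / M * exp (M * t)"
    if t: "t > 0" and G: "\<And>t. (G has_vector_derivative g t) (at t)" and "G 0 = 0"
      and g: "\<And>t. norm (g t) \<le> K * exp (M * \<bar>t\<bar>)" for t and G :: "real \<Rightarrow> 'a" and g
  proof -
    have "norm (G t - G 0) \<le> K / M * exp (M * t) - K / M * exp (M * 0)"
    proof (rule differentiable_bound_general[OF t])
      show "continuous_on {0..t} G"
        by (meson G continuous_at_imp_continuous_on has_vector_derivative_continuous)
      fix x assume "0 < x" "x < t"
      show "(G has_vector_derivative g x) (at x)" by (rule G)
      show "((\<lambda>t. K / M * exp (M * t)) has_vector_derivative K * exp (M * x)) (at x)"
        unfolding has_real_derivative_iff_has_vector_derivative[symmetric]
        using M by (auto intro!: derivative_eq_intros)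
      show "norm (g x) \<le> K * exp (M * x)" using g[of x] \<open>0 < x\<close> by simp
    qed (use M in \<open>auto intro!: continuous_intros\<close>)
    then show ?thesis using K M \<open>G 0 = 0\<close> by simp (smt (verit) divide_nonneg_pos)
  qed
  show ?thesis
  proof (cases t "0::real" rule: linorder_cases)
    case less
    have "((\<lambda>s. F (- s)) has_vector_derivative - f (- s)) (at s)" for s
    proof -
      have "(uminus has_vector_derivative - 1) (at s)" by (auto intro!: derivative_eq_intros)
      from vector_diff_chain_at[OF this F] show ?thesis by (simp add: o_def)
    qed
    from *[OF _ this, of "- t"] less f F0 show ?thesis
      by (metis abs_minus_cancel add.inverse_inverse abs_of_neg neg_0_less_iff_less norm_minus_cancel minus_zero)
  next
    case equal then show ?thesis using F0 K M by simp
  next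
    case greater
    from *[OF this F F0 f] greater show ?thesis by simp
  qed
qed

text \<open>In the variable \<open>w t = exp (- 2 L \<bar>t\<bar>) (z t - z\<^sub>0)\<close> the Picard operator is a contraction of the
  bounded continuous functions on the whole line: the weight turns the integral of the Lipschitz
  bound into the factor \<open>1/2\<close>.  So one fixed point gives the solution for all times at once.\<close>

theorem global_solution_of_Lipschitz_equation:
  fixes F :: "real \<Rightarrow> 'a::banach \<Rightarrow> 'a"
  assumes cont: "\<And>z. continuous_on UNIV z \<Longrightarrow> continuous_on UNIV (\<lambda>t. F t (z t))"
    and L: "L > 0" and lip: "\<And>t x y. norm (F t x - F t y) \<le> L * norm (x - y)"
    and B: "\<And>t. norm (F t 0) \<le> B"
  obtains z where "z 0 = z0" "\<And>t. (z has_vector_derivative F t (z t)) (at t)"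
proof -
  define M where "M = 2 * L"
  have M: "M > 0" using L by (simp add: M_def)
  define Z where "Z = (\<lambda>(w :: real \<Rightarrow>\<^sub>C 'a) t. z0 + exp (M * \<bar>t\<bar>) *\<^sub>R w t)"
  have Zcont: "continuous_on UNIV (Z w)" for w
    unfolding Z_def by (auto intro!: continuous_intros)
  have "\<exists>G. G 0 = 0 \<and> (\<forall>t. (G has_vector_derivative F t (Z w t)) (at t))" for w
    using antiderivative_real_line[OF cont[OF Zcont[of w]]] by metis
  then obtain A where A0: "\<And>w. A w 0 = 0"
    and A: "\<And>w t. (A w has_vector_derivative F t (Z w t)) (at t)"
    by metis
  have Acont: "continuous_on UNIV (A w)" for w
    by (meson A continuous_at_imp_continuous_on has_vector_derivative_continuous)
  have B0: "B \<ge> 0" using B[of 0] norm_ge_zero[of "F 0 0"] by linarith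
  define T where "T = (\<lambda>w. Bcontfun (\<lambda>t. exp (- (M * \<bar>t\<bar>)) *\<^sub>R A w t))"
  have bnd: "norm (F t (Z w t)) \<le> (B + L * norm z0 + L * norm w) * exp (M * \<bar>t\<bar>)" for t w
  proof -
    have "norm (F t (Z w t)) \<le> norm (F t 0) + L * norm (Z w t)"
      using lip[of t "Z w t" 0] norm_triangle_ineq2[of "F t (Z w t)" "F t 0"] by simp
    also have "\<dots> \<le> B + L * (norm z0 + exp (M * \<bar>t\<bar>) * norm w)"
      unfolding Z_def using L
      by (intro add_mono B mult_left_mono order_trans[OF norm_triangle_ineq]) (auto intro: norm_bounded)
    also have "\<dots> \<le> (B + L * norm z0) * exp (M * \<bar>t\<bar>) + L * (exp (M * \<bar>t\<bar>) * norm w)"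
    proof -
      have "(B + L * norm z0) * 1 \<le> (B + L * norm z0) * exp (M * \<bar>t\<bar>)"
        using B0 L M by (intro mult_left_mono) auto
      then show ?thesis by (simp add: algebra_simps)
    qed
    finally show ?thesis by (simp add: algebra_simps)
  qed
  have T: "T w t = exp (- (M * \<bar>t\<bar>)) *\<^sub>R A w t" for w t
  proof -
    have "(\<lambda>t. exp (- (M * \<bar>t\<bar>)) *\<^sub>R A w t) \<in> bcontfun"
    proof (rule bcontfun_normI)
      show "continuous_on UNIV (\<lambda>t. exp (- (M * \<bar>t\<bar>)) *\<^sub>R A w t)"
        by (intro continuous_intros Acont)
      fix t
      have "norm (A w t) \<le> (B + L * norm z0 + L * norm w) / M * exp (M * \<bar>t\<bar>)"
        by (rule antiderivative_exponential_bound[OF A A0 M bnd])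
      then show "norm (exp (- (M * \<bar>t\<bar>)) *\<^sub>R A w t) \<le> (B + L * norm z0 + L * norm w) / M"
        by (simp add: exp_minus field_simps)
    qed
    then show ?thesis by (simp add: T_def Bcontfun_inverse)
  qed
  have "dist (T v) (T w) \<le> (1/2) * dist v w" for v w
  proof (rule dist_bound)
    fix t
    have "((\<lambda>t. A v t - A w t) has_vector_derivative F t (Z v t) - F t (Z w t)) (at t)" for t
      by (intro has_vector_derivative_diff A)
    then have "norm (A v t - A w t) \<le> L * dist v w / M * exp (M * \<bar>t\<bar>)"
    proof (rule antiderivative_exponential_bound)
      fix t
      have "norm (F t (Z v t) - F t (Z w t)) \<le> L * norm (Z v t - Z w t)" by (rule lip)
      also have "Z v t - Z w t = exp (M * \<bar>t\<bar>) *\<^sub>R (v t - w t)"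
        by (simp add: Z_def algebra_simps)
      also have "L * norm \<dots> \<le> L * (exp (M * \<bar>t\<bar>) * dist v w)"
        using L dist_bounded[of v t w] by (intro mult_left_mono) (auto simp: dist_norm)
      finally show "norm (F t (Z v t) - F t (Z w t)) \<le> L * dist v w * exp (M * \<bar>t\<bar>)"
        by (simp add: algebra_simps)
    qed (simp_all add: A0 M)
    moreover have "dist (T v t) (T w t) = exp (- (M * \<bar>t\<bar>)) * norm (A v t - A w t)"
      by (simp add: T dist_norm flip: scaleR_diff_right)
    moreover have "L * dist v w / M * exp (M * \<bar>t\<bar>) = exp (M * \<bar>t\<bar>) * (dist v w / 2)"
      using L by (simp add: M_def)
    ultimately have "dist (T v t) (T w t) \<le> exp (- (M * \<bar>t\<bar>)) * (exp (M * \<bar>t\<bar>) * (dist v w / 2))"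
      by (metis exp_ge_zero mult_left_mono)
    also have "\<dots> = dist v w / 2"
      by (simp flip: mult.assoc exp_add)
    finally show "dist (T v t) (T w t) \<le> (1/2) * dist v w" by simp
  qed
  then obtain w where w: "T w = w"
    using banach_fix_type[of "1/2" T] by auto
  have Zw: "Z w = (\<lambda>t. z0 + A w t)"
  proof
    fix t
    have "w t = exp (- (M * \<bar>t\<bar>)) *\<^sub>R A w t" using T[of w t] w by simp
    then show "Z w t = z0 + A w t" by (simp add: Z_def exp_minus)
  qed
  show thesis
  proof
    show "Z w 0 = z0" by (simp add: Zw A0)
    fix t
    have "((\<lambda>t. z0 + A w t) has_vector_derivative F t (Z w t)) (at t)"
      using A by (auto intro!: derivative_eq_intros)
    then show "(Z w has_vector_derivative F t (Z w t)) (at t)" by (simp only: Zw[symmetric])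
  qed
qed

lemma solutions_diverge_at_most_exponentially:
  fixes F :: "real \<Rightarrow> 'a::real_inner \<Rightarrow> 'a"
  assumes lip: "\<And>t x y. norm (F t x - F t y) \<le> L * norm (x - y)"
    and z: "\<And>t. (z has_vector_derivative F t (z t)) (at t)"
    and w: "\<And>t. (w has_vector_derivative F t (w t)) (at t)"
  shows "norm (z t - w t) \<le> exp (L * \<bar>t\<bar>) * norm (z 0 - w 0)"
proof -
  define D where "D = (\<lambda>t. (norm (z t - w t))\<^sup>2)"
  define D' where "D' = (\<lambda>t. 2 * ((z t - w t) \<bullet> (F t (z t) - F t (w t))))"
  have D: "(D has_real_derivative D' t) (at t)" for t
    unfolding D_def D'_def power2_norm_eq_inner has_real_derivative_iff_has_vector_derivative
    has_vector_derivative_def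
    using z[of t] w[of t] unfolding has_vector_derivative_def
    by (auto intro!: derivative_eq_intros simp: fun_eq_iff inner_commute algebra_simps)
  have D': "\<bar>D' t\<bar> \<le> 2 * L * D t" for t
  proof -
    have "\<bar>(z t - w t) \<bullet> (F t (z t) - F t (w t))\<bar> \<le> norm (z t - w t) * (L * norm (z t - w t))"
      by (rule order_trans[OF Cauchy_Schwarz_ineq2 mult_left_mono[OF lip]]) simp
    then show ?thesis by (simp add: D'_def D_def power2_eq_square algebra_simps)
  qed
  have "D t \<le> exp (2 * L * \<bar>t\<bar>) * D 0"
  proof (cases "t \<ge> 0")
    case True
    have "exp (- (2 * L * t)) * D t \<le> exp (- (2 * L * 0)) * D 0"
    proof (rule DERIV_nonpos_imp_nonincreasing[OF True, where f = "\<lambda>t. exp (- (2 * L * t)) * D t"])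
      fix s
      have "((\<lambda>t. exp (- (2 * L * t)) * D t) has_real_derivative
          exp (- (2 * L * s)) * (D' s - 2 * L * D s)) (at s)"
        by (auto intro!: derivative_eq_intros D simp: algebra_simps)
      then show "\<exists>y. ((\<lambda>t. exp (- (2 * L * t)) * D t) has_real_derivative y) (at s) \<and> y \<le> 0"
        using D'[of s] by (auto intro!: exI mult_nonneg_nonpos)
    qed
    then show ?thesis using True by (simp add: exp_minus field_simps)
  next
    case False
    have "exp (2 * L * t) * D t \<le> exp (2 * L * 0) * D 0"
    proof (rule DERIV_nonneg_imp_nondecreasing[where f = "\<lambda>t. exp (2 * L * t) * D t"])
      fix s
      have "((\<lambda>t. exp (2 * L * t) * D t) has_real_derivative
          exp (2 * L * s) * (D' s + 2 * L * D s)) (at s)"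
        by (auto intro!: derivative_eq_intros D simp: algebra_simps)
      then show "\<exists>y. ((\<lambda>t. exp (2 * L * t) * D t) has_real_derivative y) (at s) \<and> 0 \<le> y"
        using D'[of s] by (auto intro!: exI mult_nonneg_nonneg)
    qed (use False in auto)
    then show ?thesis using False by (simp add: exp_minus field_simps)
  qed
  also have "\<dots> = (exp (L * \<bar>t\<bar>) * norm (z 0 - w 0))\<^sup>2"
    by (simp add: D_def power_mult_distrib flip: exp_double)
  finally show ?thesis
    unfolding D_def by (rule power2_le_imp_le) simp
qed

section \<open>Exponential dichotomy from a quadratic form that grows along solutions\<close>

text \<open>\<open>X t\<close> is the solution operator of a linear system from time \<open>0\<close> to time \<open>t\<close>, and \<open>b t\<close> is a
  bounded quadratic form whose value grows along every solution at a rate of at least \<open>c\<close> times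
  the square of the norm.\<close>

locale growing_quadratic_form =
  fixes X :: "real \<Rightarrow> 'a::euclidean_space \<Rightarrow> 'a" and b :: "real \<Rightarrow> 'a \<Rightarrow> 'a \<Rightarrow> real"
    and c C L :: real
  assumes lin: "linear (X t)" and X0: "X 0 z = z"
    and lipschitz_growth: "norm (X t z) \<le> exp (L * \<bar>t - s\<bar>) * norm (X s z)"
    and bil: "bilinear (b t)" and sym: "b t v w = b t w v"
    and bnd: "\<bar>b t v w\<bar> \<le> C * norm v * norm w"
    and c_pos: "c > 0" and C_pos: "C > 0" and L_nonneg: "L \<ge> 0"
    and deriv: "\<exists>D \<ge> c * (norm (X t z))\<^sup>2. ((\<lambda>t. b t (X t z) (X t z)) has_real_derivative D) (at t)"
begin

definition V :: "real \<Rightarrow> 'a \<Rightarrow> real" where "V t z = b t (X t z) (X t z)"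

definition stable :: "'a set" where "stable = {z. \<forall>t. V t z \<le> 0}"

definition unstable :: "'a set" where "unstable = {z. \<forall>t. V t z \<ge> 0}"

text \<open>During one unit of time the form gains at least \<open>\<kappa> \<parallel>X s z\<parallel>\<^sup>2\<close> for each \<open>s\<close> of that unit, as
  the norm changes by a factor of at most \<open>exp L\<close> in the meantime.\<close>

definition \<kappa> :: real where "\<kappa> = c * exp (- 2 * L)"

lemma \<kappa>_pos: "\<kappa> > 0" using c_pos by (simp add: \<kappa>_def)

lemma V_deriv: "\<exists>D \<ge> c * (norm (X t z))\<^sup>2. ((\<lambda>t. V t z) has_real_derivative D) (at t)"
  using deriv unfolding V_def .

lemma V_mono: "s \<le> t \<Longrightarrow> V s z \<le> V t z"
proof (rule DERIV_nonneg_imp_nondecreasing[where f = "\<lambda>t. V t z"])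
  fix t show "\<exists>y. ((\<lambda>t. V t z) has_real_derivative y) (at t) \<and> 0 \<le> y"
  proof -
    obtain D where D: "D \<ge> c * (norm (X t z))\<^sup>2" "((\<lambda>t. V t z) has_real_derivative D) (at t)"
      using V_deriv by metis
    moreover have "c * (norm (X t z))\<^sup>2 \<ge> 0" using c_pos by simp
    ultimately show ?thesis by (meson order_trans)
  qed
qed

lemma V_bound: "\<bar>V t z\<bar> \<le> C * (norm (X t z))\<^sup>2"
  using bnd[of t "X t z" "X t z"] by (simp add: V_def power2_eq_square algebra_simps)

lemma V_unit_increase:
  assumes "t \<le> s" "s \<le> t + 1"
  shows "V t z + \<kappa> * (norm (X s z))\<^sup>2 \<le> V (t + 1) z"
proof -
  have "\<forall>t. \<exists>D. D \<ge> c * (norm (X t z))\<^sup>2 \<and> ((\<lambda>t. V t z) has_real_derivative D) (at t)"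
    using V_deriv by metis
  then obtain D where D: "\<And>t. D t \<ge> c * (norm (X t z))\<^sup>2"
    and V': "\<And>t. ((\<lambda>t. V t z) has_real_derivative D t) (at t)" by metis
  obtain \<xi> where \<xi>: "t < \<xi>" "\<xi> < t + 1" "V (t + 1) z - V t z = (t + 1 - t) * D \<xi>"
    using MVT2[of t "t + 1" "\<lambda>t. V t z" D] V' by auto
  have "norm (X s z) \<le> exp (L * \<bar>s - \<xi>\<bar>) * norm (X \<xi> z)" by (rule lipschitz_growth)
  also have "\<dots> \<le> exp L * norm (X \<xi> z)"
  proof -
    have "\<bar>s - \<xi>\<bar> \<le> 1" using assms \<xi> by auto
    then have "L * \<bar>s - \<xi>\<bar> \<le> L" using L_nonneg mult_left_le by blast
    then show ?thesis by (intro mult_right_mono) auto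
  qed
  finally have "(norm (X s z))\<^sup>2 \<le> (exp L * norm (X \<xi> z))\<^sup>2" by (rule power_mono) simp
  then have "\<kappa> * (norm (X s z))\<^sup>2 \<le> \<kappa> * (exp L * norm (X \<xi> z))\<^sup>2"
    using \<kappa>_pos by (intro mult_left_mono) auto
  also have "\<dots> = c * (norm (X \<xi> z))\<^sup>2"
    by (simp add: \<kappa>_def power_mult_distrib exp_minus field_simps flip: exp_double)
  finally show ?thesis using D[of \<xi>] \<xi>(3) by simp
qed

lemma stable_V_bound: "V (t + 1) z \<le> 0 \<Longrightarrow> \<kappa> * (norm (X t z))\<^sup>2 \<le> - V t z"
  using V_unit_increase[of t t z] by simp

text \<open>On a stable solution the form is comparable to minus the square of the norm: the upper bound
  is boundedness of \<open>b\<close>, the lower bound is the gain of the next unit of time, after which the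
  form is still nonpositive. So the growth condition becomes a linear differential inequality
  for the form itself.\<close>

lemma stable_decay:
  assumes z: "z \<in> stable" and st: "s \<le> t"
  shows "norm (X t z) \<le> sqrt (C / \<kappa>) * exp (- (c / (2 * C)) * (t - s)) * norm (X s z)"
proof -
  let ?a = "c / C"
  have "exp (?a * s) * V s z \<le> exp (?a * t) * V t z"
  proof (rule DERIV_nonneg_imp_nondecreasing[OF st, where f = "\<lambda>t. exp (?a * t) * V t z"])
    fix r
    obtain D where D: "D \<ge> c * (norm (X r z))\<^sup>2" "((\<lambda>t. V t z) has_real_derivative D) (at r)"
      using V_deriv by metis
    have "- V r z \<le> C * (norm (X r z))\<^sup>2" using V_bound[of r z] by linarith
    then have "?a * (- V r z) \<le> ?a * (C * (norm (X r z))\<^sup>2)"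
      using c_pos C_pos by (intro mult_left_mono) auto
    moreover have "?a * (C * (norm (X r z))\<^sup>2) = c * (norm (X r z))\<^sup>2"
      using C_pos by simp
    ultimately have "0 \<le> ?a * V r z + D" using D(1) by linarith
    moreover have "((\<lambda>t. exp (?a * t) * V t z) has_real_derivative exp (?a * r) * (?a * V r z + D)) (at r)"
      using C_pos by (auto intro!: derivative_eq_intros D simp: algebra_simps)
    ultimately show "\<exists>y. ((\<lambda>t. exp (?a * t) * V t z) has_real_derivative y) (at r) \<and> 0 \<le> y"
      by (auto intro!: exI mult_nonneg_nonneg)
  qed
  then have "exp (?a * t) * (- V t z) \<le> exp (?a * s) * (- V s z)" by simp
  then have "exp (- (?a * t)) * (exp (?a * t) * (- V t z)) \<le> exp (- (?a * t)) * (exp (?a * s) * (- V s z))"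
    by (intro mult_left_mono) auto
  moreover have "exp (- (?a * t)) * (exp (?a * t) * (- V t z)) = - V t z"
    by (simp add: exp_minus)
  moreover have "exp (- (?a * t)) * (exp (?a * s) * (- V s z)) = exp (- ?a * (t - s)) * (- V s z)"
    by (simp only: mult.assoc[symmetric] exp_add[symmetric]) (simp add: right_diff_distrib)
  ultimately have "- V t z \<le> exp (- ?a * (t - s)) * (- V s z)"
    by metis
  also have "\<dots> \<le> exp (- ?a * (t - s)) * (C * (norm (X s z))\<^sup>2)"
    using V_bound[of s z] by (intro mult_left_mono) auto
  finally have "\<kappa> * (norm (X t z))\<^sup>2 \<le> exp (- ?a * (t - s)) * (C * (norm (X s z))\<^sup>2)"
    using stable_V_bound[of t z] z by (simp add: stable_def)
  then have "(norm (X t z))\<^sup>2 \<le> (C / \<kappa>) * exp (- ?a * (t - s)) * (norm (X s z))\<^sup>2"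
    using \<kappa>_pos by (simp add: field_simps)
  also have "exp (- ?a * (t - s)) = (exp (- (c / (2 * C)) * (t - s)))\<^sup>2"
    by (simp flip: exp_double)
  also have "C / \<kappa> = (sqrt (C / \<kappa>))\<^sup>2" using C_pos \<kappa>_pos by simp
  finally show ?thesis
    by (simp only: flip: power_mult_distrib) (rule power2_le_imp_le, auto simp: C_pos \<kappa>_pos less_imp_le)
qed

text \<open>A form that is positive at one time grows at least linearly from then on, which a bounded
  solution does not allow. Boundedness is the description of \<open>stable\<close> that shows it to be a
  subspace.\<close>

lemma stable_iff_bounded_forward: "z \<in> stable \<longleftrightarrow> (\<exists>B. \<forall>t\<ge>0. norm (X t z) \<le> B)"
proof
  assume z: "z \<in> stable"
  show "\<exists>B. \<forall>t\<ge>0. norm (X t z) \<le> B"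
  proof (intro exI allI impI)
    fix t :: real assume t: "t \<ge> 0"
    have "exp (- (c / (2 * C)) * (t - 0)) \<le> 1" using t c_pos C_pos by simp
    then have "sqrt (C / \<kappa>) * exp (- (c / (2 * C)) * (t - 0)) * norm (X 0 z) \<le> sqrt (C / \<kappa>) * 1 * norm (X 0 z)"
      using C_pos \<kappa>_pos by (intro mult_right_mono mult_left_mono) auto
    then show "norm (X t z) \<le> sqrt (C / \<kappa>) * norm (X 0 z)"
      using stable_decay[OF z t] by simp
  qed
next
  assume "\<exists>B. \<forall>t\<ge>0. norm (X t z) \<le> B"
  then obtain B where B: "\<And>t. t \<ge> 0 \<Longrightarrow> norm (X t z) \<le> B" by auto
  have "V s z \<le> 0" for s
  proof (rule ccontr)
    assume "\<not> V s z \<le> 0"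
    then have pos: "V s z > 0" by simp
    define s' where "s' = max s 0"
    have pos': "V s' z > 0" using V_mono[of s s' z] pos by (simp add: s'_def)
    define T where "T = s' + (C * B\<^sup>2 + 1) / (c / C * V s' z)"
    have "s' \<le> T" using c_pos C_pos pos' unfolding T_def by simp
    moreover have "V s' z - c / C * V s' z * s' \<le> V T z - c / C * V s' z * T"
    proof (rule DERIV_nonneg_imp_nondecreasing[OF \<open>s' \<le> T\<close>, where f = "\<lambda>t. V t z - c / C * V s' z * t"])
      fix r assume "s' \<le> r"
      obtain D where D: "D \<ge> c * (norm (X r z))\<^sup>2" "((\<lambda>t. V t z) has_real_derivative D) (at r)"
        using V_deriv by metis
      have "V s' z \<le> V r z" using \<open>s' \<le> r\<close> by (rule V_mono)
      also have "\<dots> \<le> C * (norm (X r z))\<^sup>2" using V_bound[of r z] by linarith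
      finally have "c / C * V s' z \<le> c / C * (C * (norm (X r z))\<^sup>2)"
        using c_pos C_pos by (intro mult_left_mono) auto
      moreover have "c / C * (C * (norm (X r z))\<^sup>2) = c * (norm (X r z))\<^sup>2"
        using C_pos by simp
      ultimately have "0 \<le> D - c / C * V s' z" using D(1) by linarith
      moreover have "((\<lambda>t. V t z - c / C * V s' z * t) has_real_derivative D - c / C * V s' z) (at r)"
        using C_pos by (auto intro!: derivative_eq_intros D)
      ultimately show "\<exists>y. ((\<lambda>t. V t z - c / C * V s' z * t) has_real_derivative y) (at r) \<and> 0 \<le> y"
        by blast
    qed
    moreover have "c / C * V s' z * (T - s') = C * B\<^sup>2 + 1"
      using c_pos C_pos pos' by (simp add: T_def)
    ultimately have "V T z > C * B\<^sup>2" using pos' unfolding right_diff_distrib by linarith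
    moreover have "V T z \<le> C * (norm (X T z))\<^sup>2" using V_bound[of T z] by linarith
    moreover have "\<dots> \<le> C * B\<^sup>2"
      using B[of T] \<open>s' \<le> T\<close> C_pos by (intro mult_left_mono power_mono) (auto simp: s'_def)
    ultimately show False by simp
  qed
  then show "z \<in> stable" by (simp add: stable_def)
qed

lemma subspace_stable: "subspace stable"
proof (rule subspaceI)
  show "0 \<in> stable"
    unfolding stable_iff_bounded_forward using linear_0[OF lin] by (auto intro!: exI[of _ 0])
next
  fix x y assume "x \<in> stable" "y \<in> stable"
  then obtain B B' where "\<And>t. t \<ge> 0 \<Longrightarrow> norm (X t x) \<le> B" "\<And>t. t \<ge> 0 \<Longrightarrow> norm (X t y) \<le> B'"
    unfolding stable_iff_bounded_forward by metis
  then show "x + y \<in> stable"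
    unfolding stable_iff_bounded_forward
    by (intro exI[of _ "B + B'"]) (auto simp: linear_add[OF lin] intro!: norm_triangle_mono)
next
  fix r x assume "x \<in> stable"
  then obtain B where "\<And>t. t \<ge> 0 \<Longrightarrow> norm (X t x) \<le> B"
    unfolding stable_iff_bounded_forward by metis
  then show "r *\<^sub>R x \<in> stable"
    unfolding stable_iff_bounded_forward
    by (intro exI[of _ "\<bar>r\<bar> * B"]) (auto simp: linear_scale[OF lin] intro!: mult_left_mono)
qed

text \<open>A vector on which the form is very negative and one on which it is nonnegative cannot nearly
  cancel: with \<open>\<sigma> = X t s\<close> and \<open>\<zeta> = X t (s + u)\<close>, expanding \<open>b (\<zeta> - \<sigma>) (\<zeta> - \<sigma>) \<ge> 0\<close> bounds
  \<open>\<kappa> \<parallel>\<sigma>\<parallel>\<^sup>2\<close> by terms that contain \<open>\<zeta>\<close>. The constant does not depend on \<open>t\<close>, so this gives both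
  the compactness needed to construct the splitting and the uniform bound on its projections.\<close>

lemma component_bound:
  assumes s: "\<kappa> * (norm (X t s))\<^sup>2 \<le> - V t s" and u: "0 \<le> V t u"
  shows "norm (X t s) \<le> (1 + 3 * C / \<kappa>) * norm (X t (s + u))"
proof -
  define \<sigma> \<zeta> where "\<sigma> = X t s" and "\<zeta> = X t (s + u)"
  have "X t u = \<zeta> - \<sigma>" by (simp add: \<sigma>_def \<zeta>_def linear_add[OF lin])
  then have "V t u = b t \<zeta> \<zeta> - 2 * b t \<zeta> \<sigma> + b t \<sigma> \<sigma>"
    using sym[of t \<sigma> \<zeta>] by (simp add: V_def bilinear_lsub[OF bil] bilinear_rsub[OF bil])
  then have "\<kappa> * (norm \<sigma>)\<^sup>2 \<le> b t \<zeta> \<zeta> - 2 * b t \<zeta> \<sigma>"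
    using s u by (simp add: V_def \<sigma>_def)
  also have "\<dots> \<le> C * norm \<zeta> * norm \<zeta> + 2 * (C * norm \<zeta> * norm \<sigma>)"
    using bnd[of t \<zeta> \<zeta>] bnd[of t \<zeta> \<sigma>] by linarith
  finally have *: "\<kappa> * (norm \<sigma>)\<^sup>2 \<le> C * norm \<zeta> * norm \<zeta> + 2 * (C * norm \<zeta> * norm \<sigma>)" .
  have "norm \<sigma> \<le> (1 + 3 * C / \<kappa>) * norm \<zeta>"
  proof (cases "norm \<sigma> \<le> norm \<zeta>")
    case True
    also have "norm \<zeta> \<le> (1 + 3 * C / \<kappa>) * norm \<zeta>"
      using C_pos \<kappa>_pos by (simp add: distrib_right)
    finally show ?thesis .
  next
    case False
    then have "C * norm \<zeta> * norm \<zeta> \<le> C * norm \<zeta> * norm \<sigma>"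
      using C_pos by (intro mult_left_mono) auto
    then have "\<kappa> * norm \<sigma> * norm \<sigma> \<le> 3 * C * norm \<zeta> * norm \<sigma>"
      using * by (simp add: power2_eq_square)
    moreover have "norm \<sigma> > 0" using False norm_ge_zero[of \<zeta>] by linarith
    ultimately have "\<kappa> * norm \<sigma> \<le> 3 * C * norm \<zeta>" by simp
    then have "norm \<sigma> \<le> 3 * C / \<kappa> * norm \<zeta>" using \<kappa>_pos by (simp add: field_simps)
    also have "\<dots> \<le> (1 + 3 * C / \<kappa>) * norm \<zeta>" by (intro mult_right_mono) auto
    finally show ?thesis .
  qed
  then show ?thesis by (simp add: \<sigma>_def \<zeta>_def)
qed

lemma stable_component_bound:
  assumes "s \<in> stable" "u \<in> unstable"
  shows "norm (X t s) \<le> (1 + 3 * C / \<kappa>) * norm (X t (s + u))"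
  using assms by (intro component_bound stable_V_bound) (auto simp: stable_def unstable_def)

lemma continuous_V: "continuous_on UNIV (V t)"
proof -
  have "bounded_bilinear (b t)" using bil by (simp add: bilinear_conv_bounded_bilinear)
  moreover have X: "continuous_on UNIV (X t)"
    by (rule linear_continuous_on[OF linear_conv_bounded_linear[THEN iffD1, OF lin]])
  ultimately show ?thesis
    unfolding V_def using X by (rule bounded_bilinear.continuous_on)
qed

text \<open>The splitting is a limit of splittings whose sign conditions hold only at the times \<open>n\<close> and
  \<open>- n\<close>: by monotonicity of the form they then hold between these times, and \<open>component_bound\<close>
  keeps the components in a compact set.\<close>

lemma stable_unstable_decomposition:
  assumes split: "\<And>n z. n > 0 \<Longrightarrow> \<exists>s u. z = s + u \<and> V (real n) s \<le> 0 \<and> 0 \<le> V (- real n) u"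
  obtains s u where "s \<in> stable" "u \<in> unstable" "z = s + u"
proof -
  have "\<exists>s u. z = s + u \<and> V (real (Suc n)) s \<le> 0 \<and> 0 \<le> V (- real (Suc n)) u" for n
    by (rule split) simp
  then obtain s u where z: "\<And>n. z = s n + u n" and s: "\<And>n. V (real (Suc n)) (s n) \<le> 0"
    and u: "\<And>n. 0 \<le> V (- real (Suc n)) (u n)"
    by metis
  have "norm (s n) \<le> (1 + 3 * C / \<kappa>) * norm z" for n
  proof -
    have "V 1 (s n) \<le> 0" using V_mono[of 1 "real (Suc n)" "s n"] s[of n] by simp
    then have "\<kappa> * (norm (X 0 (s n)))\<^sup>2 \<le> - V 0 (s n)" by (intro stable_V_bound) simp
    moreover have "0 \<le> V 0 (u n)"
      using V_mono[of "- real (Suc n)" 0 "u n"] u[of n] by simp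
    ultimately show ?thesis using component_bound[of 0 "s n" "u n"] z[of n]
      by (simp add: X0)
  qed
  then have "s n \<in> cball 0 ((1 + 3 * C / \<kappa>) * norm z)" for n
    by simp
  then obtain l r where r: "strict_mono (r :: nat \<Rightarrow> nat)" and l: "(\<lambda>n. s (r n)) \<longlonglongrightarrow> l"
    using seq_compactE[of "cball 0 ((1 + 3 * C / \<kappa>) * norm z)" s]
      compact_imp_seq_compact[OF compact_cball]
    unfolding o_def by metis
  have V_lim: "(\<lambda>n. V t (f n)) \<longlonglongrightarrow> V t m" if "f \<longlonglongrightarrow> m" for t f m
    using continuous_on_tendsto_compose[OF continuous_V that] by simp
  have big: "\<forall>\<^sub>F n in sequentially. \<bar>t\<bar> \<le> real (Suc (r n))" for t
  proof -
    obtain N where N: "\<bar>t\<bar> \<le> real N" using real_arch_simple by blast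
    have "\<bar>t\<bar> \<le> real (Suc (r n))" if "n \<ge> N" for n
      using N seq_suble[OF r, of n] that by linarith
    then show ?thesis by (auto simp: eventually_sequentially)
  qed
  have "V t l \<le> 0" for t
  proof (rule tendsto_upperbound[OF V_lim[OF l]])
    show "\<forall>\<^sub>F n in sequentially. V t (s (r n)) \<le> 0"
      using big[of t]
    proof eventually_elim
      case (elim n)
      then have "V t (s (r n)) \<le> V (real (Suc (r n))) (s (r n))" by (intro V_mono) auto
      also note s
      finally show ?case .
    qed
  qed simp
  moreover have "0 \<le> V t (z - l)" for t
  proof (rule tendsto_lowerbound[OF V_lim])
    show "(\<lambda>n. u (r n)) \<longlonglongrightarrow> z - l"
    proof -
      have "u n = z - s n" for n using z[of n] by simp
      then show ?thesis using tendsto_diff[OF tendsto_const[of z] l] by simp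
    qed
    show "\<forall>\<^sub>F n in sequentially. 0 \<le> V t (u (r n))"
      using big[of t]
    proof eventually_elim
      case (elim n)
      note u[of "r n"]
      also have "V (- real (Suc (r n))) (u (r n)) \<le> V t (u (r n))"
        using elim by (intro V_mono) auto
      finally show ?case .
    qed
  qed simp
  ultimately show thesis using that[of l "z - l"] by (simp add: stable_def unstable_def)
qed

text \<open>Reversing time and the sign of the form exchanges stable and unstable vectors.\<close>

lemma reversed: "growing_quadratic_form (\<lambda>t. X (- t)) (\<lambda>t v w. - b (- t) v w) c C L"
proof (rule growing_quadratic_form.intro)
  fix t s z v w
  show "linear (X (- t))" by (rule lin)
  show "X (- 0) z = z" by (simp add: X0)
  show "norm (X (- t) z) \<le> exp (L * \<bar>t - s\<bar>) * norm (X (- s) z)"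
    using lipschitz_growth[of "- t" z "- s"] by (simp add: abs_minus_commute)
  show "bilinear (\<lambda>v w. - b (- t) v w)"
    using bil[of "- t"] unfolding bilinear_def by (auto intro: linear_compose_neg)
  show "- b (- t) v w = - b (- t) w v" by (simp add: sym)
  show "\<bar>- b (- t) v w\<bar> \<le> C * norm v * norm w" using bnd by simp
  obtain D where D: "D \<ge> c * (norm (X (- t) z))\<^sup>2"
    "((\<lambda>t. b t (X t z) (X t z)) has_real_derivative D) (at (- t))"
    using deriv by metis
  have "((\<lambda>t. b (- t) (X (- t) z) (X (- t) z)) has_real_derivative D * - 1) (at t)"
    by (rule DERIV_chain2[where f = "\<lambda>t. b t (X t z) (X t z)" and g = uminus, OF D(2)]) (auto intro!: derivative_eq_intros)
  from DERIV_minus[OF this] D(1)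
  show "\<exists>D \<ge> c * (norm (X (- t) z))\<^sup>2.
      ((\<lambda>t. - b (- t) (X (- t) z) (X (- t) z)) has_real_derivative D) (at t)" by auto
qed (use c_pos C_pos L_nonneg in auto)

end

lemma norm_matrix_vector_product_bound:
  obtains K where "K > 0" "\<And>(A :: real^'n^'m) x. norm (A *v x) \<le> K * norm A * norm x"
proof -
  have "bilinear (\<lambda>(A :: real^'n^'m) x. A *v x)"
    by (auto simp: bilinear_def vec_eq_iff matrix_vector_mult_def sum.distrib sum_distrib_left
        algebra_simps intro!: linearI)
  then have "bounded_bilinear (\<lambda>(A :: real^'n^'m) x. A *v x)"
    by (simp add: bilinear_conv_bounded_bilinear)
  from bounded_bilinear.pos_bounded[OF this] that show thesis by (metis mult.commute mult.assoc)
qed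

lemma bounded_bilinear_matrix_product:
  "bounded_bilinear (\<lambda>(A :: real^'n^'m) (B :: real^'p^'n). A ** B)"
proof -
  have "bilinear (\<lambda>(A :: real^'n^'m) (B :: real^'p^'n). A ** B)"
    by (auto simp: bilinear_def vec_eq_iff matrix_matrix_mult_def sum.distrib sum_distrib_left
        algebra_simps intro!: linearI)
  then show ?thesis by (simp add: bilinear_conv_bounded_bilinear)
qed

lemma has_vector_derivative_matrix_vector_product:
  assumes "(X has_vector_derivative X') (at t)"
  shows "((\<lambda>t. (X t :: real^'n^'m) *v z) has_vector_derivative X' *v z) (at t)"
proof -
  have "linear (\<lambda>A :: real^'n^'m. A *v z)"
    by (auto simp: vec_eq_iff matrix_vector_mult_def sum.distrib sum_distrib_left
        algebra_simps intro!: linearI)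
  then show ?thesis
    using bounded_linear.has_vector_derivative[OF _ assms] linear_conv_bounded_linear by blast
qed

lemma fundamental_matrix_exists:
  fixes A :: "real \<Rightarrow> real^'n^'n"
  assumes contA: "continuous_on UNIV A" and bA: "\<And>t. norm (A t) \<le> B"
  obtains X where "X 0 = mat 1" "\<And>t. (X has_vector_derivative A t ** X t) (at t)" "\<And>t. invertible (X t)"
proof -
  note bb = bounded_bilinear_matrix_product[where 'n = 'n and 'm = 'n and 'p = 'n]
  obtain K where K: "K > 0" "\<And>(A :: real^'n^'n) (C :: real^'n^'n). norm (A ** C) \<le> norm A * norm C * K"
    using bounded_bilinear.pos_bounded[OF bb] by blast
  have B: "B \<ge> 0" using bA[of 0] norm_ge_zero order_trans by blast
  have lip: "norm (A t ** (X - Y)) \<le> (B * K + 1) * norm (X - Y)" "norm ((X - Y) ** A t) \<le> (B * K + 1) * norm (X - Y)"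
    for t and X Y :: "real^'n^'n"
  proof -
    have "norm (A t) * norm (X - Y) * K \<le> B * norm (X - Y) * K"
      using bA[of t] K by (intro mult_right_mono) auto
    also have "\<dots> \<le> (B * K + 1) * norm (X - Y)" by (simp add: algebra_simps)
    finally show "norm (A t ** (X - Y)) \<le> (B * K + 1) * norm (X - Y)"
      "norm ((X - Y) ** A t) \<le> (B * K + 1) * norm (X - Y)"
      using K(2)[of "A t" "X - Y"] K(2)[of "X - Y" "A t"] by (auto simp: mult.commute)
  qed
  have pos: "B * K + 1 > 0" using B K by (simp add: add_nonneg_pos)
  obtain X where X: "X 0 = mat 1" "\<And>t. (X has_vector_derivative A t ** X t) (at t)"
  proof (rule global_solution_of_Lipschitz_equation[where F = "\<lambda>t X. A t ** X" and L = "B * K + 1" and B = 0])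
    show "continuous_on UNIV (\<lambda>t. A t ** z t)" if "continuous_on UNIV z" for z :: "real \<Rightarrow> real^'n^'n"
      by (rule bounded_bilinear.continuous_on[OF bb contA that])
    show "norm (A t ** X - A t ** Y) \<le> (B * K + 1) * norm (X - Y)" for t and X Y :: "real^'n^'n"
      using lip(1) by (simp add: bounded_bilinear.diff_right[OF bb, symmetric])
    show "norm (A t ** 0) \<le> 0" for t by (simp add: bounded_bilinear.zero_right[OF bb])
  qed (use pos in auto)
  obtain Y where Y: "Y 0 = mat 1" "\<And>t. (Y has_vector_derivative - (Y t ** A t)) (at t)"
  proof (rule global_solution_of_Lipschitz_equation[where F = "\<lambda>t Y. - (Y ** A t)" and L = "B * K + 1" and B = 0])
    show "continuous_on UNIV (\<lambda>t. - (z t ** A t))" if "continuous_on UNIV z" for z :: "real \<Rightarrow> real^'n^'n"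
      by (intro continuous_on_minus bounded_bilinear.continuous_on[OF bb that contA])
    show "norm (- (X ** A t) - - (Y ** A t)) \<le> (B * K + 1) * norm (X - Y)" for t and X Y :: "real^'n^'n"
    proof -
      have "- (X ** A t) - - (Y ** A t) = - ((X - Y) ** A t)"
        by (simp add: bounded_bilinear.diff_left[OF bb])
      then show ?thesis using lip(2)[of X Y t] by (simp only: norm_minus_cancel)
    qed
    show "norm (- (0 ** A t)) \<le> 0" for t by (simp add: bounded_bilinear.zero_left[OF bb])
  qed (use pos in auto)
  have "((\<lambda>t. Y t ** X t) has_vector_derivative Y t ** (A t ** X t) + - (Y t ** A t) ** X t) (at t)" for t
    by (rule bounded_bilinear.has_vector_derivative[OF bb Y(2) X(2)])
  then have "((\<lambda>t. Y t ** X t) has_vector_derivative 0) (at t)" for t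
    by (simp add: bounded_bilinear.minus_left[OF bb] matrix_mul_assoc)
  then have "\<exists>c. \<forall>t. Y t ** X t = c"
    using has_vector_derivative_zero_constant[of UNIV "\<lambda>t. Y t ** X t"] by (metis UNIV_I convex_UNIV)
  then have "Y t ** X t = mat 1" for t
    by (metis X(1) Y(1) matrix_mul_lid)
  then have "invertible (X t)" for t
    unfolding invertible_def using matrix_left_right_inverse by blast
  then show thesis using that X by blast
qed

text \<open>The matrices \<open>Q\<close> and \<open>Q'\<close> have independent ranges, and their kernels are subspaces on which
  the form is nonpositive and nonnegative. For the variational system both kernels consist of
  the vectors with vanishing position part, on which the form is zero. Solutions in the kernel
  of \<open>Q\<close> at time \<open>n\<close> are the approximately stable ones, solutions in the kernel of \<open>Q'\<close> at time
  \<open>- n\<close> the approximately unstable ones.\<close>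

theorem exp_dichotomy_if_quadratic_form_grows:
  fixes A :: "real \<Rightarrow> real^'n^'n" and Q Q' :: "real^'n^'n" and b :: "real \<Rightarrow> real^'n \<Rightarrow> real^'n \<Rightarrow> real"
  assumes contA: "continuous_on UNIV A" and bA: "\<And>t. norm (A t) \<le> B"
    and bil: "\<And>t. bilinear (b t)" and sym: "\<And>t v w. b t v w = b t w v"
    and bnd: "\<And>t v w. \<bar>b t v w\<bar> \<le> C * norm v * norm w" and C: "C > 0" and c: "c > 0"
    and deriv: "\<And>z t. (\<And>t. (z has_vector_derivative A t *v z t) (at t)) \<Longrightarrow>
      \<exists>D \<ge> c * (norm (z t))\<^sup>2. ((\<lambda>t. b t (z t) (z t)) has_real_derivative D) (at t)"
    and QQ: "\<And>x y. Q *v x + Q' *v y = 0 \<Longrightarrow> Q *v x = 0 \<and> Q' *v y = 0"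
    and Q: "\<And>t x. Q *v x = 0 \<Longrightarrow> b t x x \<le> 0" and Q': "\<And>t x. Q' *v x = 0 \<Longrightarrow> 0 \<le> b t x x"
  shows "exp_dichotomy A"
proof -
  obtain X where X0: "X 0 = mat 1" and X: "\<And>t. (X has_vector_derivative A t ** X t) (at t)"
    and inv: "\<And>t. invertible (X t)"
    using fundamental_matrix_exists[OF contA bA] by metis
  have sol: "((\<lambda>t. X t *v z) has_vector_derivative A t *v (X t *v z)) (at t)" for z t
    using has_vector_derivative_matrix_vector_product[OF X] by (simp add: matrix_vector_mul_assoc)
  obtain K where K: "K > 0" "\<And>(A :: real^'n^'n) x. norm (A *v x) \<le> K * norm A * norm x"
    using norm_matrix_vector_product_bound by blast
  define L where "L = K * B"
  have B: "B \<ge> 0" using bA[of 0] norm_ge_zero order_trans by blast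
  have L: "L \<ge> 0" using K B by (simp add: L_def)
  have lip: "norm (A t *v x) \<le> L * norm x" for t x
  proof -
    have "norm (A t *v x) \<le> K * norm (A t) * norm x" by (rule K)
    also have "\<dots> \<le> K * B * norm x" using K bA by (intro mult_right_mono mult_left_mono) auto
    finally show ?thesis by (simp add: L_def)
  qed
  interpret fwd: growing_quadratic_form "\<lambda>t z. X t *v z" b c C L
  proof (rule growing_quadratic_form.intro)
    fix t s z
    show "norm (X t *v z) \<le> exp (L * \<bar>t - s\<bar>) * norm (X s *v z)"
    proof -
      have d: "((\<lambda>r. X (s + r) *v z) has_vector_derivative A (s + r) *v (X (s + r) *v z)) (at r)" for r
      proof -
        have "((\<lambda>r. s + r) has_vector_derivative 1) (at r)" by (auto intro!: derivative_eq_intros)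
        from vector_diff_chain_at[OF this sol] show ?thesis by (simp add: o_def)
      qed
      have "norm (X (s + (t - s)) *v z - 0) \<le> exp (L * \<bar>t - s\<bar>) * norm (X (s + 0) *v z - 0)"
      proof (rule solutions_diverge_at_most_exponentially[where F = "\<lambda>r z. A (s + r) *v z"
            and z = "\<lambda>r. X (s + r) *v z" and w = "\<lambda>_. 0"])
        show "norm (A (s + t) *v x - A (s + t) *v y) \<le> L * norm (x - y)" for t x y
          using lip by (metis matrix_vector_mult_diff_distrib)
      qed (auto simp: d)
      then show ?thesis by simp
    qed
    show "\<exists>D\<ge>c * (norm (X t *v z))\<^sup>2. ((\<lambda>t. b t (X t *v z) (X t *v z)) has_real_derivative D) (at t)"
      by (rule deriv) (rule sol)
  qed (use X0 bil sym bnd c C L in \<open>auto simp: matrix_vector_mul_linear\<close>)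
  interpret bwd: growing_quadratic_form "\<lambda>t z. X (- t) *v z" "\<lambda>t v w. - b (- t) v w" c C L
    by (rule fwd.reversed)
  have bwd_V: "bwd.V t z = - fwd.V (- t) z" for t z by (simp add: bwd.V_def fwd.V_def)
  have all_neg: "(\<forall>t. R (- t)) \<longleftrightarrow> (\<forall>t. R t)" for R :: "real \<Rightarrow> bool"
    by (metis minus_minus)
  have bwd_stable: "bwd.stable = fwd.unstable"
  proof -
    have "(\<forall>t. - fwd.V (- t) z \<le> 0) \<longleftrightarrow> (\<forall>t. 0 \<le> fwd.V t z)" for z
      using all_neg[of "\<lambda>t. 0 \<le> fwd.V t z"] by simp
    then show ?thesis by (simp add: bwd.stable_def fwd.unstable_def bwd_V)
  qed
  have bwd_unstable: "bwd.unstable = fwd.stable"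
  proof -
    have "(\<forall>t. 0 \<le> - fwd.V (- t) z) \<longleftrightarrow> (\<forall>t. fwd.V t z \<le> 0)" for z
      using all_neg[of "\<lambda>t. fwd.V t z \<le> 0"] by simp
    then show ?thesis by (simp add: bwd.unstable_def fwd.stable_def bwd_V)
  qed
  have split: "\<exists>s u. z = s + u \<and> fwd.V (real n) s \<le> 0 \<and> 0 \<le> fwd.V (- real n) u" if "n > 0" for n z
  proof -
    \<comment> \<open>A solution killed by both conditions has a form that does not increase from \<open>- n\<close> to \<open>n\<close>,
      hence is zero; so the two conditions can be prescribed independently.\<close>
    let ?J = "\<lambda>z. Q *v (X (real n) *v z) + Q' *v (X (- real n) *v z)"
    have linJ: "linear ?J"
      by (rule linearI) (auto simp: matrix_vector_right_distrib vector_scalar_commute scaleR_right_distrib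
          simp flip: scalar_mult_eq_scaleR)
    have "inj ?J"
    proof (rule linear_injective_0[OF linJ, THEN iffD2], intro allI impI)
      fix z assume "?J z = 0"
      then have "Q *v (X (real n) *v z) = 0" "Q' *v (X (- real n) *v z) = 0" using QQ by auto
      then have V: "fwd.V (real n) z \<le> 0" "0 \<le> fwd.V (- real n) z" using Q Q' by (auto simp: fwd.V_def)
      moreover have "fwd.V (- real n) z + fwd.\<kappa> * (norm (X (- real n) *v z))\<^sup>2 \<le> fwd.V (- real n + 1) z"
        by (rule fwd.V_unit_increase) auto
      moreover have "fwd.V (- real n + 1) z \<le> fwd.V (real n) z"
        using \<open>n > 0\<close> by (intro fwd.V_mono) linarith
      ultimately have "fwd.\<kappa> * (norm (X (- real n) *v z))\<^sup>2 \<le> 0" by linarith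
      then have "X (- real n) *v z = 0"
        using fwd.\<kappa>_pos by (auto simp: mult_le_0_iff)
      then show "z = 0"
        using inv[of "- real n"] matrix_left_invertible_ker[of "X (- real n)"]
        unfolding invertible_def by blast
    qed
    then have "surj ?J" using linear_injective_imp_surjective[OF linJ] by blast
    then obtain s where s: "?J s = Q' *v (X (- real n) *v z)" unfolding surj_def by metis
    have "Q *v (X (real n) *v s) + Q' *v (X (- real n) *v (s - z)) = 0"
      using s by (simp only: matrix_vector_mult_diff_distrib add_diff_eq) simp
    from QQ[OF this] have "Q *v (X (real n) *v s) = 0" "Q' *v (X (- real n) *v (z - s)) = 0"
      unfolding matrix_vector_mult_diff_distrib by simp_all
    then show ?thesis using Q Q' by (intro exI[of _ s] exI[of _ "z - s"]) (auto simp: fwd.V_def)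
  qed
  define P where "P = (\<lambda>z. SOME s. s \<in> fwd.stable \<and> z - s \<in> fwd.unstable)"
  have P: "P z \<in> fwd.stable" "z - P z \<in> fwd.unstable" for z
  proof -
    obtain s u where "s \<in> fwd.stable" "u \<in> fwd.unstable" "z = s + u"
      using fwd.stable_unstable_decomposition[OF split] by metis
    then have "s \<in> fwd.stable \<and> z - s \<in> fwd.unstable" by simp
    from someI[of "\<lambda>s. s \<in> fwd.stable \<and> z - s \<in> fwd.unstable", OF this]
    show "P z \<in> fwd.stable" "z - P z \<in> fwd.unstable" by (auto simp: P_def)
  qed
  note sub = fwd.subspace_stable bwd.subspace_stable[unfolded bwd_stable]
  have P_unique: "P z = s" if "s \<in> fwd.stable" "z - s \<in> fwd.unstable" for z s
  proof -
    have "P z - s \<in> fwd.stable" using P that sub by (intro subspace_diff) auto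
    moreover have "(z - s) - (z - P z) \<in> fwd.unstable"
      by (rule subspace_diff[OF sub(2) that(2) P(2)])
    then have "s - P z \<in> fwd.unstable"  using subspace_neg[OF sub(2)] by fastforce
    ultimately have "norm (X 0 *v (P z - s)) \<le> (1 + 3 * C / fwd.\<kappa>) * norm (X 0 *v ((P z - s) + (s - P z)))"
      by (rule fwd.stable_component_bound)
    then show ?thesis by (simp add: X0)
  qed
  have linP: "linear P"
  proof (rule linearI)
    fix x y r
    have "x + y - (P x + P y) \<in> fwd.unstable"
      unfolding add_diff_add by (rule subspace_add[OF sub(2) P(2) P(2)])
    then show "P (x + y) = P x + P y"
      by (rule P_unique[OF subspace_add[OF sub(1) P(1) P(1)]])
    have "r *\<^sub>R x - r *\<^sub>R P x \<in> fwd.unstable"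
      unfolding scaleR_diff_right[symmetric] by (rule subspace_scale[OF sub(2) P(2)])
    then show "P (r *\<^sub>R x) = r *\<^sub>R P x"
      by (rule P_unique[OF subspace_scale[OF sub(1) P(1)]])
  qed
  define M where "M = matrix P"
  have M: "M *v z = P z" for z using linP by (simp add: M_def matrix_works)
  have MM: "M ** M = M"
  proof -
    have "P (P z) = P z" for z
      using P[of z] subspace_0[OF sub(2)] by (intro P_unique) auto
    then show ?thesis by (simp add: matrix_eq M flip: matrix_vector_mul_assoc)
  qed
  define \<alpha> where "\<alpha> = c / (2 * C)"
  define D where "D = sqrt (C / fwd.\<kappa>) * (1 + 3 * C / fwd.\<kappa>)"
  have \<alpha>: "\<alpha> > 0" using c C by (simp add: \<alpha>_def)
  have D: "D > 0" unfolding D_def using C fwd.\<kappa>_pos by (intro mult_pos_pos add_pos_pos) auto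
  have inverse: "X s *v (matrix_inv (X s) *v w) = w" for s w
  proof -
    have "X s ** matrix_inv (X s) = mat 1"
      using someI_ex[OF inv[of s, unfolded invertible_def]] unfolding matrix_inv_def by blast
    then show ?thesis by (simp add: matrix_vector_mul_assoc)
  qed
  have stable: "onorm ((*v) (X t ** M ** matrix_inv (X s))) \<le> D * exp (- \<alpha> * (t - s))" if "s \<le> t" for s t
  proof (rule onorm_bound)
    fix w
    define z where "z = matrix_inv (X s) *v w"
    have "norm (X t *v P z) \<le> sqrt (C / fwd.\<kappa>) * exp (- \<alpha> * (t - s)) * norm (X s *v P z)"
      using fwd.stable_decay[OF P(1) that] by (simp add: \<alpha>_def)
    also have "\<dots> \<le> sqrt (C / fwd.\<kappa>) * exp (- \<alpha> * (t - s)) * ((1 + 3 * C / fwd.\<kappa>) * norm (X s *v (P z + (z - P z))))"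
      using C fwd.\<kappa>_pos by (intro mult_left_mono fwd.stable_component_bound P) auto
    also have "\<dots> = D * exp (- \<alpha> * (t - s)) * norm w"
      by (simp add: z_def inverse D_def)
    finally show "norm ((X t ** M ** matrix_inv (X s)) *v w) \<le> D * exp (- \<alpha> * (t - s)) * norm w"
      by (simp add: z_def M flip: matrix_vector_mul_assoc)
  qed (use D in simp)
  have unstable: "onorm ((*v) (X t ** (mat 1 - M) ** matrix_inv (X s))) \<le> D * exp (- \<alpha> * (s - t))" if "t \<le> s" for s t
  proof (rule onorm_bound)
    fix w
    define z where "z = matrix_inv (X s) *v w"
    have P': "z - P z \<in> bwd.stable" "P z \<in> bwd.unstable" using P by (auto simp: bwd_stable bwd_unstable)
    have "norm (X t *v (z - P z)) \<le> sqrt (C / fwd.\<kappa>) * exp (- \<alpha> * (s - t)) * norm (X s *v (z - P z))"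
    proof -
      have "- t - - s = s - t" by simp
      with bwd.stable_decay[OF P'(1), of "- s" "- t"] that show ?thesis
        by (simp only: \<alpha>_def minus_minus neg_le_iff_le)
    qed
    also have "\<dots> \<le> sqrt (C / fwd.\<kappa>) * exp (- \<alpha> * (s - t)) * ((1 + 3 * C / fwd.\<kappa>) * norm (X s *v ((z - P z) + P z)))"
    proof (rule mult_left_mono)
      show "norm (X s *v (z - P z)) \<le> (1 + 3 * C / fwd.\<kappa>) * norm (X s *v ((z - P z) + P z))"
        using bwd.stable_component_bound[OF P', of "- s"] by (simp only: minus_minus)
    qed (use C fwd.\<kappa>_pos in simp)
    also have "\<dots> = D * exp (- \<alpha> * (s - t)) * norm w"
      by (simp add: z_def inverse D_def)
    finally show "norm ((X t ** (mat 1 - M) ** matrix_inv (X s)) *v w) \<le> D * exp (- \<alpha> * (s - t)) * norm w"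
      by (simp add: z_def M matrix_vector_mult_diff_rdistrib flip: matrix_vector_mul_assoc)
  qed (use D in simp)
  show ?thesis
    unfolding exp_dichotomy_def
    using X inv MM D \<alpha> stable unstable by blast
qed

section \<open>The charged particle on the sphere\<close>

text \<open>On the unit sphere the distance from \<open>x\<close> to the attracting charge at \<open>- a k\<close> depends only on
  the height \<open>h = x \<bullet> k\<close>. So the attraction equals, up to a multiple of \<open>x\<close>, a force of this
  size in the direction \<open>- k\<close>.\<close>

definition coulomb :: "real \<Rightarrow> real \<Rightarrow> real" where
  "coulomb a h = a / sqrt (1 + a\<^sup>2 + 2 * a * h) ^ 3"

definition ambient_force :: "real \<Rightarrow> real^3 \<Rightarrow> real^3 \<Rightarrow> real^3 \<Rightarrow> real^3" where
  "ambient_force a k e x = e - coulomb a (x \<bullet> k) *\<^sub>R k"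

text \<open>The equation of motion with the velocity as a separate curve, for an arbitrary electric field
  \<open>e\<close> along time; the phase of a quasiperiodic field is hidden in \<open>e\<close>.\<close>

definition sphere_motion ::
    "real \<Rightarrow> real^3 \<Rightarrow> (real \<Rightarrow> real^3) \<Rightarrow> (real \<Rightarrow> real^3) \<Rightarrow> (real \<Rightarrow> real^3) \<Rightarrow> bool" where
  "sphere_motion a k e x v \<longleftrightarrow> (\<forall>t. norm (x t) = 1 \<and> (x has_vector_derivative v t) (at t) \<and>
     (\<exists>w. (v has_vector_derivative w) (at t) \<and>
          tan_proj (x t) w = tan_proj (x t) (ambient_force a k (e t) (x t))))"

lemma norm_from_center:
  assumes "norm x = 1" "norm k = 1"
  shows "norm (x + a *\<^sub>R k) = sqrt (1 + a\<^sup>2 + 2 * a * (x \<bullet> k))"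
proof -
  have "(x + a *\<^sub>R k) \<bullet> (x + a *\<^sub>R k) = 1 + a\<^sup>2 + 2 * a * (x \<bullet> k)"
    using assms by (simp add: norm_eq_1 inner_add_left inner_add_right inner_commute power2_eq_square)
  then show ?thesis by (simp add: norm_eq_sqrt_inner)
qed

lemma force_eq_tan_proj:
  assumes "norm x = 1" "norm k = 1"
  shows "force a k E \<phi> x = tan_proj x (ambient_force a k (E \<phi>) x)"
proof -
  have "x \<bullet> x = 1" using assms by (simp add: norm_eq_1)
  then show ?thesis
    unfolding force_def tan_proj_def ambient_force_def coulomb_def norm_from_center[OF assms]
    by (simp add: algebra_simps inner_add_left inner_diff_left divide_inverse)
qed

lemma has_real_derivative_inner:
  assumes "(f has_vector_derivative f') (at t)" "(g has_vector_derivative g') (at t)"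
  shows "((\<lambda>t. f t \<bullet> g t) has_real_derivative f' \<bullet> g t + f t \<bullet> g') (at t)"
  using bounded_bilinear.has_vector_derivative[OF bounded_bilinear_inner assms]
  by (simp add: has_real_derivative_iff_has_vector_derivative add.commute)

lemma has_real_derivative_inner_const:
  assumes "(f has_vector_derivative f') (at t)"
  shows "((\<lambda>t. f t \<bullet> c) has_real_derivative f' \<bullet> c) (at t)"
  using has_real_derivative_inner[OF assms has_vector_derivative_const[of c]] by simp

lemma unit_curve_orthogonal_velocity:
  assumes "\<And>t. norm (x t) = 1" "\<And>t. (x has_vector_derivative v t) (at t)"
  shows "x t \<bullet> v t = 0"
proof -
  have "((\<lambda>t. x t \<bullet> x t) has_real_derivative v t \<bullet> x t + x t \<bullet> v t) (at t)"
    by (intro has_real_derivative_inner assms)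
  moreover have "(\<lambda>t. x t \<bullet> x t) = (\<lambda>t. 1)" using assms(1) by (simp add: norm_eq_1 fun_eq_iff)
  ultimately have "v t \<bullet> x t + x t \<bullet> v t = 0"
    using DERIV_unique[OF _ DERIV_const] by metis
  then show ?thesis by (simp add: inner_commute)
qed

text \<open>The normal part of the acceleration is determined by the constraint, through the second
  derivative of \<open>x \<bullet> x = 1\<close>.\<close>

lemma sphere_motion_acceleration:
  assumes "sphere_motion a k e x v"
  shows "(v has_vector_derivative ambient_force a k (e t) (x t)
     - (ambient_force a k (e t) (x t) \<bullet> x t + v t \<bullet> v t) *\<^sub>R x t) (at t)"
proof -
  have x: "\<And>t. norm (x t) = 1" "\<And>t. (x has_vector_derivative v t) (at t)"
    using assms by (auto simp: sphere_motion_def)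
  obtain w where w: "(v has_vector_derivative w) (at t)"
    "tan_proj (x t) w = tan_proj (x t) (ambient_force a k (e t) (x t))"
    using assms unfolding sphere_motion_def by blast
  have "((\<lambda>t. x t \<bullet> v t) has_real_derivative v t \<bullet> v t + x t \<bullet> w) (at t)"
    by (intro has_real_derivative_inner x w)
  moreover have "(\<lambda>t. x t \<bullet> v t) = (\<lambda>t. 0)" using unit_curve_orthogonal_velocity[OF x] by auto
  ultimately have "v t \<bullet> v t + x t \<bullet> w = 0" using DERIV_unique[OF _ DERIV_const] by metis
  then have "w \<bullet> x t = - (v t \<bullet> v t)" by (simp add: inner_commute)
  then have "w = ambient_force a k (e t) (x t) - (ambient_force a k (e t) (x t) \<bullet> x t + v t \<bullet> v t) *\<^sub>R x t"
    using w(2) by (simp add: tan_proj_def algebra_simps)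
  then show ?thesis using w(1) by simp
qed

text \<open>If \<open>q\<close> were positive at some time, monotonicity would keep \<open>r' \<ge> q\<close> bounded below from then on
  and \<open>r\<close> would be unbounded; a negative value leads to the same contradiction in the past.\<close>

lemma bounded_derivative_sign:
  fixes r q :: "real \<Rightarrow> real"
  assumes r: "\<And>t. (r has_real_derivative q t / H t) (at t)" and H: "\<And>t. 0 < H t" "\<And>t. H t \<le> 1"
    and q: "\<And>s t. s \<le> t \<Longrightarrow> q s \<le> q t" and bnd: "\<And>t. \<bar>r t\<bar> \<le> B"
  shows "q t = 0"
proof -
  have *: False
    if r: "\<And>t. (r has_real_derivative q t / H t) (at t)" and H: "\<And>t. 0 < H t" "\<And>t. H t \<le> 1"
      and q: "\<And>s t. s \<le> t \<Longrightarrow> q s \<le> q t" and bnd: "\<And>t. \<bar>r t\<bar> \<le> B" and pos: "0 < q t" for r q H t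
  proof -
    define T where "T = t + (2 * B + 1) / q t"
    have "B \<ge> 0" using bnd[of 0] by linarith
    then have "t \<le> T" using pos by (simp add: T_def)
    have "r t - q t * t \<le> r T - q t * T"
    proof (rule DERIV_nonneg_imp_nondecreasing[OF \<open>t \<le> T\<close>, where f = "\<lambda>s. r s - q t * s"])
      fix s assume "t \<le> s"
      then have "q t \<le> q s" by (rule q)
      then have "q t * H s \<le> q s" using H[of s] pos mult_left_le[of "H s" "q t"] by linarith
      then have "0 \<le> q s / H s - q t" using H(1)[of s] by (simp add: field_simps)
      moreover have "((\<lambda>s. r s - q t * s) has_real_derivative q s / H s - q t) (at s)"
        by (auto intro!: derivative_eq_intros r)
      ultimately show "\<exists>y. ((\<lambda>s. r s - q t * s) has_real_derivative y) (at s) \<and> 0 \<le> y" by blast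
    qed
    moreover have "q t * (T - t) = 2 * B + 1" using pos by (simp add: T_def)
    ultimately have "r T - r t \<ge> 2 * B + 1" unfolding right_diff_distrib by linarith
    then show False using bnd[of T] bnd[of t] by linarith
  qed
  have "\<not> 0 < q t" using *[OF r H q bnd] by blast
  moreover have "\<not> q t < 0"
  proof
    assume neg: "q t < 0"
    have "((\<lambda>s. r (- s)) has_real_derivative - q (- s) / H (- s)) (at s)" for s
    proof -
      have "(uminus has_real_derivative - 1) (at s)" by (auto intro!: derivative_eq_intros)
      from DERIV_chain2[where f = r and g = uminus, OF r this] show ?thesis by simp
    qed
    from *[OF this, of "- t"] H q bnd neg show False by auto
  qed
  ultimately show ?thesis by simp
qed

text \<open>Once below the level and not increasing, \<open>f\<close> can never turn back, so uniform concavity drives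
  it below zero. If it is increasing instead, the same happens in reversed time.\<close>

lemma concave_below_level_imp_above_level:
  fixes f :: "real \<Rightarrow> real"
  assumes f: "\<And>t. (f has_real_derivative f' t) (at t)" and f': "\<And>t. (f' has_real_derivative f'' t) (at t)"
    and pos: "\<And>t. f t > 0" and c: "c > 0" and conc: "\<And>t. f t < l \<Longrightarrow> f'' t \<le> - c"
  shows "f t \<ge> l"
proof -
  have *: False if g: "\<And>t. (g has_real_derivative g' t) (at t)" and g': "\<And>t. (g' has_real_derivative g'' t) (at t)"
    and pos: "\<And>t. g t > 0" and conc: "\<And>t. g t < l \<Longrightarrow> g'' t \<le> - c" and g0: "g t0 < l" "g' t0 \<le> 0"
  for g g' g'' t0
  proof -
    have g'_dec: "g' s \<le> g' t0 - c * (s - t0)" if "t0 \<le> s" and below: "\<And>r. t0 \<le> r \<Longrightarrow> r < s \<Longrightarrow> g r < l" for s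
    proof (cases "t0 = s")
      case False
      then have "t0 < s" using that by simp
      then obtain z where "t0 < z" "z < s" "g' s - g' t0 = (s - t0) * g'' z"
        using MVT2[OF \<open>t0 < s\<close>, of g' g''] g' by blast
      moreover have "g'' z \<le> - c" using conc below \<open>t0 < z\<close> \<open>z < s\<close> by simp
      ultimately have "g' s - g' t0 \<le> (s - t0) * - c"
        using \<open>t0 < s\<close> by (metis diff_ge_0_iff_ge mult_left_mono less_imp_le)
      then show ?thesis by (simp add: algebra_simps)
    qed simp
    have below: "g s < l" if "t0 \<le> s" for s
    proof (rule ccontr)
      assume "\<not> g s < l"
      define S where "S = {t0..s} \<inter> g -` {l..}"
      have cont: "continuous_on {t0..s} g"
        using g DERIV_isCont continuous_at_imp_continuous_on by blast
      have "closed S" unfolding S_def by (rule continuous_closed_preimage[OF cont]) auto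
      moreover have "s \<in> S" using that \<open>\<not> g s < l\<close> by (simp add: S_def)
      moreover have bb: "bdd_below S" by (auto simp: S_def bdd_below_def intro!: exI[of _ t0])
      ultimately have "Inf S \<in> S" by (intro closed_contains_Inf) auto
      define m where "m = Inf S"
      have m: "t0 \<le> m" "m \<le> s" "l \<le> g m" using \<open>Inf S \<in> S\<close> by (auto simp: S_def m_def)
      have before: "g r < l" if "t0 \<le> r" "r < m" for r
      proof (rule ccontr)
        assume "\<not> g r < l"
        then have "r \<in> S" using that m by (simp add: S_def)
        then show False using cInf_lower[OF _ bb, of r] that by (simp add: m_def)
      qed
      have "t0 \<noteq> m" using m g0 by auto
      then have "t0 < m" using m by simp
      then obtain z where z: "t0 < z" "z < m" "g m - g t0 = (m - t0) * g' z"
        using MVT2[OF \<open>t0 < m\<close>, of g g'] g by blast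
      have "g' z \<le> g' t0 - c * (z - t0)" using z before by (intro g'_dec) auto
      also have "\<dots> \<le> 0" using g0 c z mult_nonneg_nonneg[of c "z - t0"] by linarith
      finally have "g m \<le> g t0" using z \<open>t0 < m\<close> by (smt (verit) mult_nonneg_nonpos)
      then show False using m g0 by simp
    qed
    define T where "T = t0 + 1 + l / c"
    have "l > 0" using g0 pos[of t0] by simp
    then have "t0 + 1 < T" using c by (simp add: T_def)
    then obtain z where z: "t0 + 1 < z" "z < T" "g T - g (t0 + 1) = (T - (t0 + 1)) * g' z"
      using MVT2[OF \<open>t0 + 1 < T\<close>, of g g'] g by blast
    have "g' z \<le> g' t0 - c * (z - t0)" using z below by (intro g'_dec) auto
    also have "\<dots> \<le> - c" 
    proof -
      have "c * 1 \<le> c * (z - t0)" using z c by (intro mult_left_mono) auto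
      then show ?thesis using g0 by simp
    qed
    finally have "(l / c) * g' z \<le> (l / c) * - c" using \<open>l > 0\<close> c by (intro mult_left_mono) auto
    then have "g T \<le> g (t0 + 1) - l" using z c by (simp add: T_def)
    then show False using below[of "t0 + 1"] pos[of T] by simp
  qed
  show ?thesis
  proof (rule ccontr)
    assume t: "\<not> f t \<ge> l"
    show False
    proof (cases "f' t \<le> 0")
      case True
      then show False using *[of f f' f'' t] f f' pos conc t by auto
    next
      case False
      have 1: "((\<lambda>s. f (- s)) has_real_derivative - f' (- s)) (at s)" for s
      proof -
        have "(uminus has_real_derivative - 1) (at s)" by (auto intro!: derivative_eq_intros)
        from DERIV_chain2[where f = f and g = uminus, OF f this] show ?thesis by simp
      qed
      have 2: "((\<lambda>s. - f' (- s)) has_real_derivative f'' (- s)) (at s)" for s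
      proof -
        have "(uminus has_real_derivative - 1) (at s)" by (auto intro!: derivative_eq_intros)
        from DERIV_minus[OF DERIV_chain2[where f = f' and g = uminus, OF f' this]] show ?thesis by simp
      qed
      show False
        using *[OF 1 2, of "- t"] pos conc t False by auto
    qed
  qed
qed

lemma coulomb_lower:
  assumes "a > 0" "0 \<le> h" "h \<le> 1"
  shows "a / (1 + a) ^ 3 \<le> coulomb a h"
proof -
  have pos: "0 < 1 + a\<^sup>2 + 2 * a * h" using assms by (simp add: add_pos_nonneg)
  have "sqrt (1 + a\<^sup>2 + 2 * a * h) \<le> 1 + a"
    using assms by (intro real_le_lsqrt) (auto simp: power2_eq_square algebra_simps)
  then have "sqrt (1 + a\<^sup>2 + 2 * a * h) ^ 3 \<le> (1 + a) ^ 3"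
    using pos by (intro power_mono) auto
  then show ?thesis unfolding coulomb_def using assms pos by (intro divide_left_mono) auto
qed

lemma coulomb_upper:
  assumes "a > 0" "0 \<le> h"
  shows "coulomb a h \<le> a"
proof -
  have "1 \<le> sqrt (1 + a\<^sup>2 + 2 * a * h)" using assms by simp
  then have "1 \<le> sqrt (1 + a\<^sup>2 + 2 * a * h) ^ 3" by (rule one_le_power)
  then show ?thesis unfolding coulomb_def using assms divide_left_mono[of 1 _ a] by fastforce
qed

lemma coulomb_antimono:
  assumes "a > 0" "0 \<le> h" "h \<le> h'"
  shows "coulomb a h' \<le> coulomb a h"
proof -
  have "0 < 1 + a\<^sup>2 + 2 * a * h" "0 < 1 + a\<^sup>2 + 2 * a * h'" using assms by (auto simp: add_pos_nonneg)
  then show ?thesis unfolding coulomb_def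
    using assms by (intro divide_left_mono power_mono real_sqrt_le_mono) auto
qed

text \<open>The field is described by its size and by the margin \<open>\<delta>\<close> with which the charge dominates its
  component along \<open>k\<close>; each initial phase of the field on the torus gives rise to one such \<open>e\<close>.\<close>

locale driven_particle =
  fixes a :: real and k :: "real^3" and \<delta> C :: real and e :: "real \<Rightarrow> real^3"
  assumes a_pos: "a > 0" and k_unit: "norm k = 1" and \<delta>_pos: "\<delta> > 0"
    and e_bound: "norm (e t) \<le> C" and e_margin: "e t \<bullet> k + \<delta> \<le> a / (1 + a) ^ 3"
begin

abbreviation G :: "real \<Rightarrow> real^3 \<Rightarrow> real^3" where "G t x \<equiv> ambient_force a k (e t) x"

text \<open>Beyond the distance \<open>R\<close> from the pole in gnomonic coordinates, that is below the height \<open>h\<^sub>0\<close>,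
  the repulsion from the pole exceeds the transversal field: \<open>\<delta> R = C + \<delta> > C\<close>.\<close>

definition R :: real where "R = C / \<delta> + 1"

definition h\<^sub>0 :: real where "h\<^sub>0 = 1 / sqrt (1 + R\<^sup>2)"

lemma C_nonneg: "C \<ge> 0" using e_bound[of 0] norm_ge_zero order_trans by blast

lemma R_pos: "R > 0" using C_nonneg \<delta>_pos by (simp add: R_def add_nonneg_pos)

lemma h\<^sub>0_pos: "h\<^sub>0 > 0" by (simp add: h\<^sub>0_def add_pos_nonneg)

lemma kk: "k \<bullet> k = 1" using k_unit by (simp add: norm_eq_1)

lemma downward_force:
  assumes "norm x = 1" "0 \<le> x \<bullet> k"
  shows "G t x \<bullet> k \<le> - \<delta>"
proof -
  have "x \<bullet> k \<le> 1" using norm_cauchy_schwarz[of x k] assms k_unit by simp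
  then have "a / (1 + a) ^ 3 \<le> coulomb a (x \<bullet> k)" using assms a_pos by (intro coulomb_lower)
  then show ?thesis using e_margin[of t] by (simp add: ambient_force_def inner_diff_left kk)
qed

text \<open>With \<open>s = sqrt (1 - h\<^sup>2)\<close> the distance of \<open>x\<close> from the axis and \<open>g = - G \<bullet> k\<close>, the second
  derivative of the height is at most \<open>- g s\<^sup>2 + C s h\<close>, and \<open>h < h\<^sub>0\<close> means \<open>s > R h\<close>.\<close>

lemma height_concave_when_low:
  assumes x: "norm x = 1" and h: "0 < x \<bullet> k" "x \<bullet> k < h\<^sub>0"
  shows "(G t x - (G t x \<bullet> x + v \<bullet> v) *\<^sub>R x) \<bullet> k \<le> - (\<delta> * R / (1 + R\<^sup>2))"
proof -
  define h s g where "h = x \<bullet> k" and "s = sqrt (1 - h\<^sup>2)" and "g = - (G t x \<bullet> k)"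
  have h: "0 < h" "h < h\<^sub>0" using h by (auto simp: h_def)
  have g: "g \<ge> \<delta>" using downward_force[of x t] x h by (simp add: g_def h_def)
  have "h\<^sup>2 < h\<^sub>0\<^sup>2" using h by (intro power_strict_mono) auto
  also have "h\<^sub>0\<^sup>2 = 1 / (1 + R\<^sup>2)" by (simp add: h\<^sub>0_def power_divide add_nonneg_nonneg)
  finally have h2: "h\<^sup>2 < 1 / (1 + R\<^sup>2)" .
  have R1: "1 + R\<^sup>2 > 0" by (simp add: add_pos_nonneg)
  have s2: "s\<^sup>2 = 1 - h\<^sup>2" "s\<^sup>2 \<ge> R\<^sup>2 / (1 + R\<^sup>2)"
  proof -
    have "1 - 1 / (1 + R\<^sup>2) = R\<^sup>2 / (1 + R\<^sup>2)" using R1 by (simp add: field_simps)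
    then have *: "1 - h\<^sup>2 \<ge> R\<^sup>2 / (1 + R\<^sup>2)" using h2 by linarith
    then have "0 \<le> 1 - h\<^sup>2" using R1 by (smt (verit) divide_nonneg_pos zero_le_power2)
    then show "s\<^sup>2 = 1 - h\<^sup>2" by (simp add: s_def)
    then show "s\<^sup>2 \<ge> R\<^sup>2 / (1 + R\<^sup>2)" using * by simp
  qed
  have s0: "s \<ge> 0"
    using s2 R1 by (simp add: s_def)
  have Rh: "R * h \<le> s"
  proof (rule power2_le_imp_le)
    have "R\<^sup>2 * h\<^sup>2 \<le> R\<^sup>2 * (1 / (1 + R\<^sup>2))" using h2 by (intro mult_left_mono) auto
    then show "(R * h)\<^sup>2 \<le> s\<^sup>2" using s2 by (simp add: power_mult_distrib)
  qed (rule s0)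
  have "norm (x - h *\<^sub>R k) = s"
  proof -
    have "(x - h *\<^sub>R k) \<bullet> (x - h *\<^sub>R k) = 1 - h\<^sup>2"
      using x by (simp add: inner_diff_left inner_diff_right inner_commute kk h_def norm_eq_1 power2_eq_square)
    then show ?thesis by (simp add: s_def norm_eq_sqrt_inner)
  qed
  then have "- (e t \<bullet> (x - h *\<^sub>R k)) \<le> C * s"
    using Cauchy_Schwarz_ineq2[of "e t" "x - h *\<^sub>R k"] mult_right_mono[OF e_bound[of t] s0] by simp
  moreover have "G t x \<bullet> x = - g * h + e t \<bullet> (x - h *\<^sub>R k)"
    by (simp add: g_def h_def ambient_force_def inner_diff_left inner_diff_right kk inner_commute algebra_simps)
  ultimately have Gx: "- (G t x \<bullet> x) \<le> g * h + C * s" by linarith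
  have "(G t x - (G t x \<bullet> x + v \<bullet> v) *\<^sub>R x) \<bullet> k = - g + (- (G t x \<bullet> x)) * h - (v \<bullet> v) * h"
    by (simp add: g_def h_def inner_diff_left algebra_simps)
  also have "\<dots> \<le> - g + (g * h + C * s) * h"
    using mult_right_mono[OF Gx, of h] h by (smt (verit) inner_ge_zero mult_nonneg_nonneg)
  also have "\<dots> = - g * s\<^sup>2 + C * s * h" unfolding s2(1) by (simp add: algebra_simps power2_eq_square)
  also have "\<dots> \<le> - \<delta> * s\<^sup>2 + C * s * (s / R)"
  proof (intro add_mono mult_left_mono)
    show "h \<le> s / R" using Rh R_pos by (simp add: field_simps)
    show "- g * s\<^sup>2 \<le> - \<delta> * s\<^sup>2" using g by (intro mult_right_mono) auto
  qed (use C_nonneg s0 in auto)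
  also have "\<dots> = - (\<delta> / R) * s\<^sup>2"
  proof -
    have "C + \<delta> = \<delta> * R" using \<delta>_pos by (simp add: R_def field_simps)
    then have CR: "C / R = \<delta> - \<delta> / R" using R_pos by (simp add: field_simps)
    have "- \<delta> * s\<^sup>2 + C * s * (s / R) = (- \<delta> + C / R) * s\<^sup>2"
      by (simp add: algebra_simps power2_eq_square)
    then show ?thesis by (simp add: CR)
  qed
  also have "\<dots> \<le> - (\<delta> / R) * (R\<^sup>2 / (1 + R\<^sup>2))"
    using s2 \<delta>_pos R_pos by (intro mult_left_mono_neg) auto
  also have "\<dots> = - (\<delta> * R / (1 + R\<^sup>2))" using R_pos by (simp add: power2_eq_square)
  finally show ?thesis .
qed

text \<open>A motion that comes close to the equator either crosses it or has crossed it before, so a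
  motion in the open hemisphere stays away from the equator.\<close>

lemma motion_stays_high:
  assumes m: "sphere_motion a k e x v" and pos: "\<And>t. 0 < x t \<bullet> k"
  shows "h\<^sub>0 \<le> x t \<bullet> k"
proof (rule concave_below_level_imp_above_level[where f = "\<lambda>t. x t \<bullet> k"])
  show "((\<lambda>t. x t \<bullet> k) has_real_derivative v t \<bullet> k) (at t)" for t
    using m by (intro has_real_derivative_inner_const) (auto simp: sphere_motion_def)
  show "((\<lambda>t. v t \<bullet> k) has_real_derivative (G t (x t) - (G t (x t) \<bullet> x t + v t \<bullet> v t) *\<^sub>R x t) \<bullet> k) (at t)" for t
    by (intro has_real_derivative_inner_const sphere_motion_acceleration[OF m])
  show "0 < \<delta> * R / (1 + R\<^sup>2)" using \<delta>_pos R_pos by (intro divide_pos_pos mult_pos_pos add_pos_nonneg) auto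
  show "(G t (x t) - (G t (x t) \<bullet> x t + v t \<bullet> v t) *\<^sub>R x t) \<bullet> k \<le> - (\<delta> * R / (1 + R\<^sup>2))"
    if "x t \<bullet> k < h\<^sub>0" for t
    using m pos that by (intro height_concave_when_low) (auto simp: sphere_motion_def)
qed (rule pos)

text \<open>The attraction towards \<open>- k\<close> decreases with the height, so the differences of force and
  position of two particles point the same way.\<close>

lemma ambient_force_monotone:
  assumes "0 \<le> x \<bullet> k" "0 \<le> y \<bullet> k"
  shows "0 \<le> (G t x - G t y) \<bullet> (x - y)"
proof -
  have "(G t x - G t y) \<bullet> (x - y) = - ((coulomb a (x \<bullet> k) - coulomb a (y \<bullet> k)) * (x \<bullet> k - y \<bullet> k))"
    by (simp add: ambient_force_def algebra_simps inner_commute)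
  also have "\<dots> \<ge> 0"
    using coulomb_antimono[OF a_pos, of "x \<bullet> k" "y \<bullet> k"] coulomb_antimono[OF a_pos, of "y \<bullet> k" "x \<bullet> k"] assms
    by (cases "x \<bullet> k \<le> y \<bullet> k") (auto intro: mult_nonneg_nonpos mult_nonpos_nonneg)
  finally show ?thesis .
qed

text \<open>The derivative of \<open>(N' H - N H') / H\<close> for \<open>N = 1 - x1 \<bullet> x2\<close> and \<open>H = h1 h2\<close>, after the
  equations of motion are inserted. The terms with \<open>S\<^sub>i = G\<^sub>i \<bullet> x\<^sub>i\<close> and with the squared speeds
  \<open>A\<close>, \<open>B\<close> that multiply \<open>N\<close> cancel, and the rest is arranged as a sum of terms that are
  nonnegative: the first bracket is \<open>\<parallel>d' - (H' / 2 H) d\<parallel>\<^sup>2\<close> for \<open>d = x1 - x2\<close>.\<close>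

lemma quotient_derivative_identity:
  fixes h1 h2 :: real
  assumes "h1 > 0" "h2 > 0" and "c = 1 - N" "N1 = - (p + p')" "H1 = u1 * h2 + h1 * u2"
    and "N2 = - (P12 - (S1 + A) * c + 2 * m + (P21 - (S2 + B) * c))"
    and "H2 = (- g1 - (S1 + A) * h1) * h2 + 2 * u1 * u2 + h1 * (- g2 - (S2 + B) * h2)"
  shows "(N2 * (h1 * h2) - N * H2) / (h1 * h2) - (N1 * (h1 * h2) - N * H1) * H1 / (h1 * h2)\<^sup>2
    = (A + B - 2 * m + H1 / (h1 * h2) * (p + p') + (H1 / (2 * (h1 * h2)))\<^sup>2 * (2 * N))
      + N * ((u1 * h2 - h1 * u2) / (h1 * h2))\<^sup>2 / 2 + N * (g1 / h1 + g2 / h2) + (S1 - P12 + (S2 - P21))"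
  using assms(1,2) unfolding assms(3-) by (simp add: field_simps power2_eq_square)

text \<open>The quotient \<open>r = N / H\<close> with \<open>N = \<parallel>x1 - x2\<parallel>\<^sup>2 / 2\<close> and \<open>H = h1 h2\<close> measures the distance
  of the two motions in gnomonic coordinates. It is bounded since \<open>H \<ge> h\<^sub>0\<^sup>2\<close>, and \<open>q = H r'\<close>
  has derivative at least \<open>2 \<delta> N\<close>. So \<open>q\<close> is constantly zero, and then \<open>N\<close> is.\<close>

lemma motion_unique:
  assumes m1: "sphere_motion a k e x1 v1" and pos1: "\<And>t. 0 < x1 t \<bullet> k"
    and m2: "sphere_motion a k e x2 v2" and pos2: "\<And>t. 0 < x2 t \<bullet> k"
  shows "x1 t = x2 t"
proof -
  have n: "norm (x1 t) = 1" "norm (x2 t) = 1"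
    and v: "(x1 has_vector_derivative v1 t) (at t)" "(x2 has_vector_derivative v2 t) (at t)" for t
    using m1 m2 by (auto simp: sphere_motion_def)
  have xx: "x1 t \<bullet> x1 t = 1" "x2 t \<bullet> x2 t = 1" for t using n by (auto simp: norm_eq_1)
  have xv: "x1 t \<bullet> v1 t = 0" "x2 t \<bullet> v2 t = 0" for t
    using unit_curve_orthogonal_velocity n v by blast+
  define w1 where "w1 = (\<lambda>t. G t (x1 t) - (G t (x1 t) \<bullet> x1 t + v1 t \<bullet> v1 t) *\<^sub>R x1 t)"
  define w2 where "w2 = (\<lambda>t. G t (x2 t) - (G t (x2 t) \<bullet> x2 t + v2 t \<bullet> v2 t) *\<^sub>R x2 t)"
  have w: "(v1 has_vector_derivative w1 t) (at t)" "(v2 has_vector_derivative w2 t) (at t)" for t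
    using sphere_motion_acceleration[OF m1] sphere_motion_acceleration[OF m2] by (auto simp: w1_def w2_def)
  define N where "N = (\<lambda>t. 1 - x1 t \<bullet> x2 t)"
  define N1 where "N1 = (\<lambda>t. - (v1 t \<bullet> x2 t + x1 t \<bullet> v2 t))"
  define N2 where "N2 = (\<lambda>t. - (w1 t \<bullet> x2 t + v1 t \<bullet> v2 t + (v1 t \<bullet> v2 t + x1 t \<bullet> w2 t)))"
  define H where "H = (\<lambda>t. (x1 t \<bullet> k) * (x2 t \<bullet> k))"
  define H1 where "H1 = (\<lambda>t. (v1 t \<bullet> k) * (x2 t \<bullet> k) + (x1 t \<bullet> k) * (v2 t \<bullet> k))"
  define H2 where "H2 = (\<lambda>t. (w1 t \<bullet> k) * (x2 t \<bullet> k) + (v1 t \<bullet> k) * (v2 t \<bullet> k)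
      + ((v1 t \<bullet> k) * (v2 t \<bullet> k) + (x1 t \<bullet> k) * (w2 t \<bullet> k)))"
  define q where "q = (\<lambda>t. (N1 t * H t - N t * H1 t) / H t)"
  define q1 where "q1 = (\<lambda>t. (N2 t * H t - N t * H2 t) / H t - (N1 t * H t - N t * H1 t) * H1 t / (H t)\<^sup>2)"
  have Hpos: "H t > 0" for t using pos1 pos2 by (simp add: H_def)
  have h: "h\<^sub>0 \<le> x1 t \<bullet> k" "h\<^sub>0 \<le> x2 t \<bullet> k" for t
    using motion_stays_high m1 m2 pos1 pos2 by blast+
  have h_le: "x1 t \<bullet> k \<le> 1" "x2 t \<bullet> k \<le> 1" for t
    using norm_cauchy_schwarz[of "x1 t" k] norm_cauchy_schwarz[of "x2 t" k] n k_unit by auto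
  have H_le: "H t \<le> 1" for t
    unfolding H_def using h_le pos1 pos2 by (simp add: mult_le_one less_imp_le)
  have H_ge: "h\<^sub>0\<^sup>2 \<le> H t" for t
    unfolding H_def power2_eq_square using h h\<^sub>0_pos by (intro mult_mono) (auto intro: order_trans[OF less_imp_le])
  have dN: "(N has_real_derivative N1 t) (at t)" for t
    unfolding N_def N1_def
    by (rule DERIV_cong[OF DERIV_diff[OF DERIV_const has_real_derivative_inner[OF v(1) v(2)]]]) simp
  have dN1: "(N1 has_real_derivative N2 t) (at t)" for t
    unfolding N1_def N2_def
    by (intro DERIV_minus DERIV_add has_real_derivative_inner v w)
  have dH: "(H has_real_derivative H1 t) (at t)" for t
    unfolding H_def H1_def
    by (rule DERIV_cong[OF DERIV_mult[OF v(1,2)[THEN has_real_derivative_inner_const]]]) simp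
  have dH1: "(H1 has_real_derivative H2 t) (at t)" for t
    unfolding H1_def H2_def
    by (rule DERIV_cong[OF DERIV_add[OF
        DERIV_mult[OF w(1)[THEN has_real_derivative_inner_const] v(2)[THEN has_real_derivative_inner_const]]
        DERIV_mult[OF v(1)[THEN has_real_derivative_inner_const] w(2)[THEN has_real_derivative_inner_const]]]])
      simp
  have dr: "((\<lambda>t. N t / H t) has_real_derivative q t / H t) (at t)" for t
    using DERIV_divide[OF dN dH, of t] Hpos[of t] by (simp add: q_def)
  have dq: "(q has_real_derivative q1 t) (at t)" for t
  proof -
    have "((\<lambda>t. N1 t * H t - N t * H1 t) has_real_derivative N2 t * H t - N t * H2 t) (at t)"
      by (auto intro!: derivative_eq_intros dN dN1 dH dH1)
    from DERIV_divide[OF this dH[of t]] Hpos[of t]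
    have "(q has_real_derivative ((N2 t * H t - N t * H2 t) * H t - (N1 t * H t - N t * H1 t) * H1 t) / (H t * H t)) (at t)"
      by (simp add: q_def)
    then show ?thesis
      by (rule DERIV_cong) (use Hpos[of t] in \<open>simp add: q1_def diff_divide_distrib power2_eq_square\<close>)
  qed
  have N_dist: "2 * N t = (x1 t - x2 t) \<bullet> (x1 t - x2 t)" for t
    by (simp add: N_def inner_diff_left inner_diff_right xx inner_commute)
  have N_nonneg: "N t \<ge> 0" for t using N_dist[of t] inner_ge_zero[of "x1 t - x2 t"] by linarith
  have q1_lower: "2 * \<delta> * N t \<le> q1 t" for t
  proof -
    define g1 where "g1 = - (G t (x1 t) \<bullet> k)"
    define g2 where "g2 = - (G t (x2 t) \<bullet> k)"
    have g: "\<delta> \<le> g1" "\<delta> \<le> g2"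
      using downward_force n pos1 pos2 unfolding g1_def g2_def
      by (metis (no_types) le_minus_iff less_imp_le)+
    \<comment> \<open>Each of the summands is nonnegative, and the one with \<open>g1\<close> and \<open>g2\<close> is at least \<open>2 \<delta> N t\<close>.\<close>
    have "q1 t = (v1 t \<bullet> v1 t + v2 t \<bullet> v2 t - 2 * (v1 t \<bullet> v2 t)
         + H1 t / H t * (v1 t \<bullet> x2 t + x1 t \<bullet> v2 t) + (H1 t / (2 * H t))\<^sup>2 * (2 * N t))
      + N t * (((v1 t \<bullet> k) * (x2 t \<bullet> k) - (x1 t \<bullet> k) * (v2 t \<bullet> k)) / H t)\<^sup>2 / 2
      + N t * (g1 / (x1 t \<bullet> k) + g2 / (x2 t \<bullet> k))
      + (G t (x1 t) \<bullet> x1 t - G t (x1 t) \<bullet> x2 t + (G t (x2 t) \<bullet> x2 t - G t (x2 t) \<bullet> x1 t))"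
    proof -
      have c: "x1 t \<bullet> x2 t = 1 - N t" by (simp add: N_def)
      have n2: "N2 t = - (G t (x1 t) \<bullet> x2 t - (G t (x1 t) \<bullet> x1 t + v1 t \<bullet> v1 t) * (x1 t \<bullet> x2 t) + 2 * (v1 t \<bullet> v2 t)
          + (G t (x2 t) \<bullet> x1 t - (G t (x2 t) \<bullet> x2 t + v2 t \<bullet> v2 t) * (x1 t \<bullet> x2 t)))"
        by (simp add: N2_def w1_def w2_def inner_diff_left inner_diff_right inner_commute)
      have h2: "H2 t = (- g1 - (G t (x1 t) \<bullet> x1 t + v1 t \<bullet> v1 t) * (x1 t \<bullet> k)) * (x2 t \<bullet> k)
          + 2 * (v1 t \<bullet> k) * (v2 t \<bullet> k)
          + (x1 t \<bullet> k) * (- g2 - (G t (x2 t) \<bullet> x2 t + v2 t \<bullet> v2 t) * (x2 t \<bullet> k))"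
        by (simp add: H2_def w1_def w2_def g1_def g2_def inner_diff_left)
      show ?thesis
        unfolding q1_def H_def
        by (rule quotient_derivative_identity[OF pos1 pos2 c N1_def[THEN fun_cong] H1_def[THEN fun_cong] n2 h2])
    qed
    moreover have "v1 t \<bullet> v1 t + v2 t \<bullet> v2 t - 2 * (v1 t \<bullet> v2 t)
         + H1 t / H t * (v1 t \<bullet> x2 t + x1 t \<bullet> v2 t) + (H1 t / (2 * H t))\<^sup>2 * (2 * N t) \<ge> 0"
    proof -
      define \<mu> where "\<mu> = H1 t / (2 * H t)"
      define y where "y = v1 t - v2 t - \<mu> *\<^sub>R (x1 t - x2 t)"
      have "y \<bullet> y = v1 t \<bullet> v1 t + v2 t \<bullet> v2 t - 2 * (v1 t \<bullet> v2 t)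
         + 2 * \<mu> * (v1 t \<bullet> x2 t + x1 t \<bullet> v2 t) + \<mu>\<^sup>2 * (2 * N t)"
        unfolding N_dist y_def using xv[of t]
        by (simp add: inner_diff_left inner_diff_right inner_commute algebra_simps power2_eq_square)
      moreover have "2 * \<mu> = H1 t / H t" by (simp add: \<mu>_def)
      ultimately show ?thesis using inner_ge_zero[of y] by (simp add: \<mu>_def)
    qed
    moreover have "0 \<le> N t * (((v1 t \<bullet> k) * (x2 t \<bullet> k) - (x1 t \<bullet> k) * (v2 t \<bullet> k)) / H t)\<^sup>2 / 2"
      using N_nonneg by simp
    moreover have "0 \<le> G t (x1 t) \<bullet> x1 t - G t (x1 t) \<bullet> x2 t + (G t (x2 t) \<bullet> x2 t - G t (x2 t) \<bullet> x1 t)"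
      using ambient_force_monotone[of "x1 t" "x2 t" t] pos1[of t] pos2[of t]
      by (simp add: inner_diff_left inner_diff_right less_imp_le)
    moreover have "2 * \<delta> * N t \<le> N t * (g1 / (x1 t \<bullet> k) + g2 / (x2 t \<bullet> k))"
    proof -
      have "\<delta> \<le> g1 / (x1 t \<bullet> k)" "\<delta> \<le> g2 / (x2 t \<bullet> k)"
        using g pos1[of t] pos2[of t] h_le[of t] \<delta>_pos
        by (auto simp: pos_le_divide_eq intro: order_trans[OF mult_left_le])
      then have "N t * (2 * \<delta>) \<le> N t * (g1 / (x1 t \<bullet> k) + g2 / (x2 t \<bullet> k))"
        using N_nonneg by (intro mult_left_mono) auto
      then show ?thesis by (simp add: mult.commute)
    qed
    ultimately show ?thesis by linarith
  qed
  have q0: "q t = 0" for t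
  proof (rule bounded_derivative_sign[where r = "\<lambda>t. N t / H t" and H = H and q = q])
    show "q s \<le> q t" if "s \<le> t" for s t
    proof (rule DERIV_nonneg_imp_nondecreasing[OF that, where f = q])
      fix r
      have "0 \<le> q1 r" using q1_lower[of r] N_nonneg[of r] \<delta>_pos by (smt (verit) mult_nonneg_nonneg)
      then show "\<exists>y. (q has_real_derivative y) (at r) \<and> 0 \<le> y" using dq by blast
    qed
    show "\<bar>N t / H t\<bar> \<le> 2 / h\<^sub>0\<^sup>2" for t
    proof -
      have "N t \<le> 2" unfolding N_def
        using Cauchy_Schwarz_ineq2[of "x1 t" "x2 t"] n by simp
      then have "N t / H t \<le> 2 / h\<^sub>0\<^sup>2"
        using N_nonneg[of t] H_ge[of t] h\<^sub>0_pos by (intro frac_le) auto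
      then show ?thesis using N_nonneg[of t] Hpos[of t] by simp
    qed
  qed (use dr Hpos H_le in auto)
  then have "q = (\<lambda>_. 0)" by auto
  then have "q1 t = 0" using DERIV_unique[OF dq[of t]] DERIV_const by metis
  then have "N t \<le> 0" using q1_lower[of t] \<delta>_pos by (simp add: mult_le_0_iff)
  then have "N t = 0" using N_nonneg[of t] by simp
  then show ?thesis using N_dist[of t] by simp
qed

end

section \<open>Functions on the torus\<close>

lemma torus_periodic_shift:
  assumes "torus_periodic g"
  shows "g (\<phi> + (\<chi> i. 2 * pi * of_int (m i))) = g \<phi>"
proof -
  have one_pos: "g (\<phi> + axis i (2 * pi * real n)) = g \<phi>" for \<phi> i n
  proof (induction n)
    case (Suc n)
    have "\<phi> + axis i (2 * pi * real (Suc n)) = (\<phi> + axis i (2 * pi * real n)) + axis i (2 * pi)"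
      by (auto simp: vec_eq_iff axis_def algebra_simps)
    then show ?case using Suc assms by (simp only: torus_periodic_def)
  qed (simp add: axis_def vec_eq_iff zero_vec_def[symmetric] vec_lambda_eta cong: if_cong)
  have one: "g (\<phi> + axis i (2 * pi * of_int n)) = g \<phi>" for \<phi> i n
  proof (cases "n \<ge> 0")
    case True
    then show ?thesis using one_pos[of \<phi> i "nat n"] by simp
  next
    case False
    have "\<phi> + axis i (2 * pi * of_int n) + axis i (2 * pi * real (nat (- n))) = \<phi>"
      using False by (auto simp: vec_eq_iff axis_def)
    then show ?thesis using one_pos[of "\<phi> + axis i (2 * pi * of_int n)" i "nat (- n)"] by metis
  qed
  have "g (\<phi> + (\<Sum>i\<in>S. axis i (2 * pi * of_int (m i)))) = g \<phi>" if "finite S" for S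
    using that
  proof (induction S)
    case (insert i S)
    have "\<phi> + (\<Sum>i\<in>insert i S. axis i (2 * pi * of_int (m i)))
      = (\<phi> + (\<Sum>i\<in>S. axis i (2 * pi * of_int (m i)))) + axis i (2 * pi * of_int (m i))"
      using insert by (simp add: algebra_simps)
    then show ?case using one insert.IH by metis
  qed simp
  moreover have "(\<Sum>i\<in>UNIV. axis i (2 * pi * of_int (m i))) = (\<chi> i. 2 * pi * of_int (m i))"
    by (simp add: vec_eq_iff axis_def)
  ultimately show ?thesis by (metis finite)
qed

text \<open>Reduction to a compact cube, by which continuity on the torus becomes uniform.\<close>

lemma torus_fundamental_domain:
  fixes \<phi> :: "real^'k"
  assumes "torus_periodic g"
  shows "\<exists>\<psi> \<in> cbox 0 (\<chi> i. 2 * pi). g \<phi> = g \<psi>"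
proof -
  define m where "m = (\<lambda>i. \<lfloor>\<phi> $ i / (2 * pi)\<rfloor>)"
  define \<psi> where "\<psi> = (\<chi> i. \<phi> $ i - 2 * pi * of_int (m i))"
  have "\<phi> = \<psi> + (\<chi> i. 2 * pi * of_int (m i))" by (simp add: \<psi>_def vec_eq_iff)
  then have "g \<phi> = g \<psi>"
    using torus_periodic_shift[OF assms, of \<psi> m] by simp
  moreover have "\<psi> \<in> cbox 0 (\<chi> i. 2 * pi)"
  proof -
    have "0 \<le> \<phi> $ i - 2 * pi * of_int (m i) \<and> \<phi> $ i - 2 * pi * of_int (m i) \<le> 2 * pi" for i
    proof -
      have "of_int (m i) \<le> \<phi> $ i / (2 * pi)" "\<phi> $ i / (2 * pi) \<le> of_int (m i) + 1"
        unfolding m_def by linarith+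
      then show ?thesis by (simp add: field_simps)
    qed
    then show ?thesis by (simp add: mem_box_cart \<psi>_def)
  qed
  ultimately show ?thesis by blast
qed

lemma torus_continuous_bounded:
  fixes g :: "real^'k \<Rightarrow> 'b::real_normed_vector"
  assumes "torus_periodic g" "continuous_on UNIV g"
  obtains B where "\<And>\<phi>. norm (g \<phi>) \<le> B"
proof -
  have "compact (g ` cbox 0 (\<chi> i. 2 * pi))"
    using assms continuous_on_subset by (intro compact_continuous_image) auto
  from compact_imp_bounded[OF this]
  obtain B where "\<And>\<psi>. \<psi> \<in> cbox 0 (\<chi> i. 2 * pi) \<Longrightarrow> norm (g \<psi>) \<le> B"
    by (auto simp: bounded_iff)
  moreover have "\<exists>\<psi> \<in> cbox 0 (\<chi> i. 2 * pi). g \<phi> = g \<psi>" for \<phi>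
    by (rule torus_fundamental_domain[OF assms(1)])
  ultimately have "norm (g \<phi>) \<le> B" for \<phi> by metis
  then show thesis using that by blast
qed

text \<open>The partial derivatives are continuous and inherit the periodicity, hence are bounded.\<close>

lemma torus_smooth_Lipschitz:
  fixes E :: "real^'k \<Rightarrow> 'b::real_normed_vector"
  assumes "torus_periodic E" "smooth E"
  obtains L where "\<And>\<phi> \<psi>. norm (E \<phi> - E \<psi>) \<le> L * norm (\<phi> - \<psi>)"
proof -
  define D where "D = (\<lambda>i \<phi>. frechet_derivative E (at \<phi>) (axis i 1))"
  have "C_diff 1 E" using assms by (simp add: smooth_def)
  then have diff: "E differentiable (at \<phi>)" and cont: "continuous_on UNIV (D i)" for \<phi> i
    by (auto simp: D_def)
  have der: "(E has_derivative frechet_derivative E (at \<phi>)) (at \<phi>)" for \<phi>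
    using diff frechet_derivative_works by blast
  have "frechet_derivative E (at (\<phi> + axis i (2 * pi))) = frechet_derivative E (at \<phi>)" for \<phi> i
  proof -
    have "((\<lambda>\<psi>. E (\<psi> + axis i (2 * pi))) has_derivative
        (\<lambda>v. frechet_derivative E (at (\<phi> + axis i (2 * pi))) v)) (at \<phi>)"
      by (rule has_derivative_compose[OF _ der, of "\<lambda>\<psi>. \<psi> + axis i (2 * pi)" "\<lambda>v. v" \<phi> UNIV])
        (auto intro!: derivative_eq_intros)
    moreover have "(\<lambda>\<psi>. E (\<psi> + axis i (2 * pi))) = E"
      using assms(1) by (simp add: torus_periodic_def)
    ultimately show ?thesis using frechet_derivative_at by (metis (no_types, lifting) eta_contract_eq)
  qed
  then have "torus_periodic (D i)" for i by (simp add: torus_periodic_def D_def)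
  then have "\<exists>B. \<forall>\<phi>. norm (D i \<phi>) \<le> B" for i
    using torus_continuous_bounded[of "D i"] cont by metis
  then obtain B where B: "\<And>i \<phi>. norm (D i \<phi>) \<le> B i" by metis
  have "onorm (frechet_derivative E (at \<phi>)) \<le> (\<Sum>i\<in>UNIV. B i)" for \<phi>
  proof (rule onorm_le)
    fix v :: "real^'k"
    have lin: "linear (frechet_derivative E (at \<phi>))" using der has_derivative_linear by blast
    have "v = (\<Sum>i\<in>UNIV. v $ i *\<^sub>R axis i 1)"
      using basis_expansion[of v] by (simp add: scalar_mult_eq_scaleR)
    then have "frechet_derivative E (at \<phi>) v = (\<Sum>i\<in>UNIV. v $ i *\<^sub>R D i \<phi>)"
      using linear_sum[OF lin, of "\<lambda>i. v $ i *\<^sub>R axis i 1" UNIV] linear_scale[OF lin]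
      by (simp add: D_def)
    also have "norm \<dots> \<le> (\<Sum>i\<in>UNIV. \<bar>v $ i\<bar> * norm (D i \<phi>))"
      by (rule order_trans[OF norm_sum]) simp
    also have "\<dots> \<le> (\<Sum>i\<in>UNIV. norm v * B i)"
      by (intro sum_mono mult_mono B component_le_norm_cart) auto
    finally show "norm (frechet_derivative E (at \<phi>) v) \<le> (\<Sum>i\<in>UNIV. B i) * norm v"
      by (simp add: sum_distrib_left sum_distrib_right mult.commute)
  qed
  then have "norm (E \<phi> - E \<psi>) \<le> (\<Sum>i\<in>UNIV. B i) * norm (\<phi> - \<psi>)" for \<phi> \<psi>
    using differentiable_bound[of UNIV E "\<lambda>\<phi>. frechet_derivative E (at \<phi>)" "\<Sum>i\<in>UNIV. B i" \<phi> \<psi>] der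
    by auto
  then show thesis using that by blast
qed

lemma torus_positive_lower_bound:
  fixes g :: "real^'k \<Rightarrow> real"
  assumes "torus_periodic g" "continuous_on UNIV g" "\<And>\<phi>. g \<phi> > 0"
  obtains \<delta> where "\<delta> > 0" "\<And>\<phi>. \<delta> \<le> g \<phi>"
proof -
  have "(0 :: real^'k) \<in> cbox 0 (\<chi> i. 2 * pi)" by (simp add: mem_box_cart)
  then have "cbox 0 (\<chi> i. 2 * pi) \<noteq> ({} :: (real^'k) set)" by blast
  then obtain \<psi> where "\<And>\<xi>. \<xi> \<in> cbox 0 (\<chi> i. 2 * pi) \<Longrightarrow> g \<psi> \<le> g \<xi>"
    using continuous_attains_inf[OF compact_cbox _ continuous_on_subset[OF assms(2)]] by (metis subset_UNIV)
  moreover have "\<exists>\<psi> \<in> cbox 0 (\<chi> i. 2 * pi). g \<phi> = g \<psi>" for \<phi>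
    by (rule torus_fundamental_domain[OF assms(1)])
  ultimately have "g \<psi> \<le> g \<phi>" for \<phi> by metis
  then show thesis using that assms(3) by blast
qed

section \<open>Bounded Lipschitz functions\<close>

text \<open>Unlike the Lipschitz functions, the bounded ones among them are closed under products, which
  is what the truncated vector field below is built from.\<close>

definition bounded_Lipschitz :: "('a::metric_space \<Rightarrow> 'b::real_normed_vector) \<Rightarrow> bool" where
  "bounded_Lipschitz f \<longleftrightarrow> (\<exists>B. \<forall>x. norm (f x) \<le> B) \<and> (\<exists>L. \<forall>x y. norm (f x - f y) \<le> L * dist x y)"

lemma bounded_LipschitzI:
  assumes "\<And>x. norm (f x) \<le> B" "\<And>x y. norm (f x - f y) \<le> L * dist x y"
  shows "bounded_Lipschitz f"
  using assms unfolding bounded_Lipschitz_def by blast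

lemma bounded_LipschitzE:
  assumes "bounded_Lipschitz f"
  obtains B L where "B \<ge> 0" "L \<ge> 0" "\<And>x. norm (f x) \<le> B" "\<And>x y. norm (f x - f y) \<le> L * dist x y"
proof -
  obtain B L where *: "\<And>x. norm (f x) \<le> B" "\<And>x y. norm (f x - f y) \<le> L * dist x y"
    using assms unfolding bounded_Lipschitz_def by blast
  have "L * dist x y \<le> \<bar>L\<bar> * dist x y" for x y by (intro mult_right_mono) auto
  then have "norm (f x - f y) \<le> \<bar>L\<bar> * dist x y" for x y using *(2) order_trans by blast
  moreover have "norm (f x) \<le> \<bar>B\<bar>" for x using *(1)[of x] by linarith
  ultimately show thesis using that[of "\<bar>B\<bar>" "\<bar>L\<bar>"] by simp
qed

lemma bounded_Lipschitz_const: "bounded_Lipschitz (\<lambda>x. c)"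
  by (rule bounded_LipschitzI[where B = "norm c" and L = 0]) auto

lemma bounded_Lipschitz_add:
  assumes "bounded_Lipschitz f" "bounded_Lipschitz g"
  shows "bounded_Lipschitz (\<lambda>x. f x + g x)"
proof -
  obtain B L where f: "\<And>x. norm (f x) \<le> B" "\<And>x y. norm (f x - f y) \<le> L * dist x y"
    using bounded_LipschitzE[OF assms(1)] by metis
  obtain B' L' where g: "\<And>x. norm (g x) \<le> B'" "\<And>x y. norm (g x - g y) \<le> L' * dist x y"
    using bounded_LipschitzE[OF assms(2)] by metis
  show ?thesis
  proof (rule bounded_LipschitzI)
    fix x y
    show "norm (f x + g x) \<le> B + B'" using f g norm_triangle_mono by blast
    have "f x + g x - (f y + g y) = (f x - f y) + (g x - g y)" by simp
    also have "norm \<dots> \<le> L * dist x y + L' * dist x y" using f g norm_triangle_mono by blast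
    finally show "norm (f x + g x - (f y + g y)) \<le> (L + L') * dist x y" by (simp add: algebra_simps)
  qed
qed

lemma bounded_Lipschitz_bilinear:
  assumes "bounded_bilinear op" "bounded_Lipschitz f" "bounded_Lipschitz g"
  shows "bounded_Lipschitz (\<lambda>x. op (f x) (g x))"
proof -
  interpret bounded_bilinear op by fact
  obtain K where K: "K > 0" "\<And>a b. norm (op a b) \<le> norm a * norm b * K" using pos_bounded by blast
  obtain B L where f: "B \<ge> 0" "L \<ge> 0" "\<And>x. norm (f x) \<le> B" "\<And>x y. norm (f x - f y) \<le> L * dist x y"
    using bounded_LipschitzE[OF assms(2)] by metis
  obtain B' L' where g: "B' \<ge> 0" "L' \<ge> 0" "\<And>x. norm (g x) \<le> B'" "\<And>x y. norm (g x - g y) \<le> L' * dist x y"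
    using bounded_LipschitzE[OF assms(3)] by metis
  show ?thesis
  proof (rule bounded_LipschitzI)
    fix x y
    show "norm (op (f x) (g x)) \<le> B * B' * K"
      using f g K by (intro order_trans[OF K(2)] mult_right_mono mult_mono) auto
    have "op (f x) (g x) - op (f y) (g y) = op (f x - f y) (g x) + op (f y) (g x - g y)"
      by (simp add: diff_left diff_right)
    also have "norm \<dots> \<le> (L * dist x y) * B' * K + B * (L' * dist x y) * K"
      using f g K
      by (intro norm_triangle_mono order_trans[OF K(2)] mult_right_mono mult_mono) auto
    finally show "norm (op (f x) (g x) - op (f y) (g y)) \<le> (L * B' * K + B * L' * K) * dist x y"
      by (simp add: algebra_simps)
  qed
qed

lemmas bounded_Lipschitz_scaleR = bounded_Lipschitz_bilinear[OF bounded_bilinear_scaleR]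
lemmas bounded_Lipschitz_inner = bounded_Lipschitz_bilinear[OF bounded_bilinear_inner]

lemma bounded_Lipschitz_minus: "bounded_Lipschitz f \<Longrightarrow> bounded_Lipschitz (\<lambda>x. - f x)"
  using bounded_Lipschitz_scaleR[OF bounded_Lipschitz_const[of "- 1"]] by simp

lemma bounded_Lipschitz_diff:
  "bounded_Lipschitz f \<Longrightarrow> bounded_Lipschitz g \<Longrightarrow> bounded_Lipschitz (\<lambda>x. f x - g x)"
  using bounded_Lipschitz_add[of f "\<lambda>x. - g x"] bounded_Lipschitz_minus[of g] by simp

lemma bounded_Lipschitz_Pair:
  assumes "bounded_Lipschitz f" "bounded_Lipschitz g"
  shows "bounded_Lipschitz (\<lambda>x. (f x, g x))"
proof -
  obtain B L where f: "\<And>x. norm (f x) \<le> B" "\<And>x y. norm (f x - f y) \<le> L * dist x y"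
    using bounded_LipschitzE[OF assms(1)] by metis
  obtain B' L' where g: "\<And>x. norm (g x) \<le> B'" "\<And>x y. norm (g x - g y) \<le> L' * dist x y"
    using bounded_LipschitzE[OF assms(2)] by metis
  have le: "norm (u, w) \<le> norm u + norm w" for u :: 'b and w :: 'c
    using norm_Pair_le .
  show ?thesis
  proof (rule bounded_LipschitzI)
    fix x y
    show "norm (f x, g x) \<le> B + B'" using le[of "f x" "g x"] f(1)[of x] g(1)[of x] by linarith
    show "norm ((f x, g x) - (f y, g y)) \<le> (L + L') * dist x y"
      using le[of "f x - f y" "g x - g y"] f(2)[of x y] g(2)[of x y] by (simp add: distrib_right)
  qed
qed

lemma bounded_Lipschitz_compose:
  assumes "bounded_Lipschitz f" and f: "\<And>x. f x \<in> S"
    and B: "\<And>y. y \<in> S \<Longrightarrow> norm (g y) \<le> B" and K: "K \<ge> 0" "\<And>y z. y \<in> S \<Longrightarrow> z \<in> S \<Longrightarrow> norm (g y - g z) \<le> K * norm (y - z)"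
  shows "bounded_Lipschitz (\<lambda>x. g (f x))"
proof -
  obtain L where L: "\<And>x y. norm (f x - f y) \<le> L * dist x y"
    using bounded_LipschitzE[OF assms(1)] by metis
  show ?thesis
  proof (rule bounded_LipschitzI)
    fix x y
    show "norm (g (f x)) \<le> B" using B f by blast
    have "norm (g (f x) - g (f y)) \<le> K * norm (f x - f y)" using K f by blast
    also have "\<dots> \<le> K * (L * dist x y)" using L K by (intro mult_left_mono) auto
    finally show "norm (g (f x) - g (f y)) \<le> (K * L) * dist x y" by simp
  qed
qed

text \<open>The radial retraction onto the ball of radius \<open>r\<close>; it changes the length of \<open>y\<close> but not its
  direction.\<close>

definition clip :: "real \<Rightarrow> 'a::real_normed_vector \<Rightarrow> 'a" where
  "clip r y = (r / max r (norm y)) *\<^sub>R y"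

lemma clip_id: "r > 0 \<Longrightarrow> norm y \<le> r \<Longrightarrow> clip r y = y"
  by (simp add: clip_def max_def)

lemma norm_clip: "r > 0 \<Longrightarrow> norm (clip r y) \<le> r"
  by (simp add: clip_def max_def field_simps)

text \<open>This makes the retraction nonexpansive.\<close>

lemma clip_eq_closest_point:
  fixes y :: "'a::euclidean_space"
  assumes r: "r > 0"
  shows "clip r y = closest_point (cball 0 r) y"
proof (rule closest_point_unique)
  show "clip r y \<in> cball 0 r" using norm_clip[OF r] by simp
  show "\<forall>z\<in>cball 0 r. dist y (clip r y) \<le> dist y z"
  proof
    fix z :: 'a assume z: "z \<in> cball 0 r"
    show "dist y (clip r y) \<le> dist y z"
    proof (cases "norm y \<le> r")
      case True then show ?thesis by (simp add: clip_id[OF r True])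
    next
      case False
      then have "y - clip r y = (1 - r / norm y) *\<^sub>R y"
        by (simp add: clip_def max_def algebra_simps)
      moreover have "0 \<le> 1 - r / norm y" using False r by (simp add: divide_le_eq)
      ultimately have "dist y (clip r y) = (1 - r / norm y) * norm y" by (simp add: dist_norm)
      also have "\<dots> = norm y - r"
        using False r by (cases "y = 0") (auto simp: field_simps)
      also have "\<dots> \<le> dist y z" using z norm_triangle_ineq2[of y z] by (simp add: dist_norm)
      finally show ?thesis .
    qed
  qed
qed auto

lemma bounded_Lipschitz_clip:
  fixes f :: "'b::metric_space \<Rightarrow> 'a::euclidean_space"
  assumes r: "r > 0" and f: "\<And>x y. norm (f x - f y) \<le> dist x y"
  shows "bounded_Lipschitz (\<lambda>x. clip r (f x))"
proof (rule bounded_LipschitzI)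
  fix x y
  show "norm (clip r (f x)) \<le> r" by (rule norm_clip[OF r])
  have "norm (clip r (f x) - clip r (f y)) \<le> norm (f x - f y)"
    unfolding clip_eq_closest_point[OF r] dist_norm[symmetric]
    using r by (intro closest_point_lipschitz) auto
  then show "norm (clip r (f x) - clip r (f y)) \<le> 1 * dist x y" using f[of x y] by simp
qed

lemma Lipschitz_if_derivative_bounded:
  fixes g :: "real \<Rightarrow> real"
  assumes "convex S" "\<And>x. x \<in> S \<Longrightarrow> (g has_real_derivative g' x) (at x)" "\<And>x. x \<in> S \<Longrightarrow> \<bar>g' x\<bar> \<le> B"
    and "x \<in> S" "y \<in> S"
  shows "norm (g x - g y) \<le> B * norm (x - y)"
  using field_differentiable_bound[OF assms(1) _ _ assms(4,5), of g g' B] assms(2,3)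
  by (auto intro: DERIV_subset has_field_derivative_at_within)

lemma inverse_sqrt_Lipschitz:
  fixes s t :: real
  assumes "s \<in> {1..}" "t \<in> {1..}"
  shows "norm (1 / sqrt s - 1 / sqrt t) \<le> 1 * norm (s - t)"
proof (rule Lipschitz_if_derivative_bounded[OF _ _ _ assms, where g' = "\<lambda>s. - (inverse (sqrt s) / 2) / (sqrt s)\<^sup>2"])
  fix x :: real assume x: "x \<in> {1..}"
  show "((\<lambda>s. 1 / sqrt s) has_real_derivative - (inverse (sqrt x) / 2) / (sqrt x)\<^sup>2) (at x)"
    using x by (auto intro!: derivative_eq_intros simp: power2_eq_square field_simps)
  have "1 \<le> sqrt x" using x by simp
  then have "inverse (sqrt x) \<le> 1" by (rule inverse_le_1_iff[THEN iffD2, OF disjI2])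
  then have "inverse (sqrt x) / 2 / x \<le> 1"
    using x by (simp add: divide_le_eq)
  then show "\<bar>- (inverse (sqrt x) / 2) / (sqrt x)\<^sup>2\<bar> \<le> 1" using x by simp
qed auto

lemma coulomb_has_derivative:
  assumes "a > 0" "h \<ge> 0"
  shows "(coulomb a has_real_derivative - 3 * a\<^sup>2 / sqrt (1 + a\<^sup>2 + 2 * a * h) ^ 5) (at h)"
proof -
  have pos: "0 < 1 + a\<^sup>2 + 2 * a * h" using assms by (simp add: add_pos_nonneg)
  define \<rho> where "\<rho> = sqrt (1 + a\<^sup>2 + 2 * a * h)"
  have \<rho>: "\<rho> > 0" using pos by (simp add: \<rho>_def)
  have d: "((\<lambda>h. sqrt (1 + a\<^sup>2 + 2 * a * h)) has_real_derivative a / \<rho>) (at h)"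
    using pos by (auto intro!: derivative_eq_intros simp: \<rho>_def field_simps)
  have "((\<lambda>h. a / sqrt (1 + a\<^sup>2 + 2 * a * h) ^ 3) has_real_derivative
      (0 * \<rho> ^ 3 - a * (real 3 * (a / \<rho> * \<rho> ^ (3 - Suc 0)))) / (\<rho> ^ 3 * \<rho> ^ 3)) (at h)"
    unfolding \<rho>_def
    by (rule DERIV_divide[OF DERIV_const DERIV_power[OF d[unfolded \<rho>_def]]]) (use pos in simp)
  moreover have "(0 * \<rho> ^ 3 - a * (real 3 * (a / \<rho> * \<rho> ^ (3 - Suc 0)))) / (\<rho> ^ 3 * \<rho> ^ 3) = - 3 * a\<^sup>2 / \<rho> ^ 5"
    using \<rho> by (simp add: field_simps power2_eq_square eval_nat_numeral)
  ultimately show ?thesis unfolding coulomb_def[abs_def] \<rho>_def by simp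
qed

lemma coulomb_Lipschitz:
  assumes a: "a > 0" and "h \<in> {0..1}" "h' \<in> {0..1}"
  shows "norm (coulomb a h - coulomb a h') \<le> (3 * a\<^sup>2) * norm (h - h')"
proof (rule Lipschitz_if_derivative_bounded[OF _ _ _ assms(2,3)])
  fix h :: real assume h: "h \<in> {0..1}"
  show "(coulomb a has_real_derivative - 3 * a\<^sup>2 / sqrt (1 + a\<^sup>2 + 2 * a * h) ^ 5) (at h)"
    using a h by (intro coulomb_has_derivative) auto
  have "1 \<le> sqrt (1 + a\<^sup>2 + 2 * a * h)" using a h by simp
  then have "1 \<le> sqrt (1 + a\<^sup>2 + 2 * a * h) ^ 5" by (rule one_le_power)
  then have "3 * a\<^sup>2 / sqrt (1 + a\<^sup>2 + 2 * a * h) ^ 5 \<le> 3 * a\<^sup>2"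
    using divide_left_mono[of 1 "sqrt (1 + a\<^sup>2 + 2 * a * h) ^ 5" "3 * a\<^sup>2"] a h
    by (simp add: add_pos_nonneg)
  moreover have "0 \<le> 3 * a\<^sup>2 / sqrt (1 + a\<^sup>2 + 2 * a * h) ^ 5"
    using a h by simp
  ultimately show "\<bar>- 3 * a\<^sup>2 / sqrt (1 + a\<^sup>2 + 2 * a * h) ^ 5\<bar> \<le> 3 * a\<^sup>2" by simp
qed auto

text \<open>Without a zero, \<open>p \<mapsto> - r f p / \<parallel>f p\<parallel>\<close> would map the ball to its boundary sphere. A Brouwer
  fixed point is then a boundary point at which \<open>f\<close> points inward.\<close>

lemma zero_if_outward_on_sphere:
  fixes f :: "'a::euclidean_space \<Rightarrow> 'a"
  assumes r: "r > 0" and cont: "continuous_on (cball 0 r) f"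
    and out: "\<And>p. norm p = r \<Longrightarrow> 0 < f p \<bullet> p"
  obtains p where "f p = 0"
proof (rule ccontr)
  assume "\<not> thesis"
  then have nz: "f p \<noteq> 0" for p using that by blast
  obtain p where p: "p \<in> cball 0 r" "- (r / norm (f p)) *\<^sub>R f p = p"
  proof (rule brouwer_ball[OF r, of 0 "\<lambda>p. - (r / norm (f p)) *\<^sub>R f p"])
    show "continuous_on (cball 0 r) (\<lambda>p. - (r / norm (f p)) *\<^sub>R f p)"
      using nz by (intro continuous_intros cont) auto
    show "(\<lambda>p. - (r / norm (f p)) *\<^sub>R f p) \<in> cball 0 r \<rightarrow> cball 0 r"
      using r nz by auto
  qed
  have "norm p = r" using r nz[of p] arg_cong[OF p(2), of norm] by simp
  moreover have "f p \<bullet> p = - (r * norm (f p))"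
    using nz[of p] by (subst p(2)[symmetric]) (simp add: dot_square_norm power2_eq_square)
  ultimately show False using out[of p] r by (simp add: mult_less_0_iff not_less)
qed

section \<open>Existence of confined motions\<close>

type_synonym 'k state = "(real^'k) \<times> (real^3) \<times> (real^3)"

locale torus_driven_particle =
  fixes a :: real and k :: "real^3" and \<delta> C :: real and \<omega> :: "real^'k" and E :: "real^'k \<Rightarrow> real^3"
    and L\<^sub>E :: real
  assumes a_pos: "a > 0" and k_unit: "norm k = 1" and \<delta>_pos: "\<delta> > 0"
    and E_bound: "norm (E \<phi>) \<le> C" and E_margin: "E \<phi> \<bullet> k + \<delta> \<le> a / (1 + a) ^ 3"
    and E_Lipschitz: "norm (E \<phi> - E \<psi>) \<le> L\<^sub>E * norm (\<phi> - \<psi>)"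

text \<open>The interpretation fixes the initial phase \<open>0\<close>, but the constants \<open>R\<close> and \<open>h\<^sub>0\<close> do not depend
  on the phase; other phases enter through \<open>driven\<close> below.\<close>

sublocale torus_driven_particle \<subseteq> driven_particle a k \<delta> C "\<lambda>t. E (t *\<^sub>R \<omega>)"
  by unfold_locales (rule a_pos k_unit \<delta>_pos E_bound E_margin)+

context torus_driven_particle
begin

lemma driven: "driven_particle a k \<delta> C (\<lambda>t. E (\<phi> + t *\<^sub>R \<omega>))"
  by unfold_locales (rule a_pos k_unit \<delta>_pos E_bound E_margin)+

text \<open>The height of the point of the sphere with gnomonic coordinate \<open>y\<close>, if \<open>\<parallel>y\<parallel> \<le> R\<close>. All
  functions of \<open>y\<close> are evaluated at the retraction of \<open>y\<close>, so that they are globally Lipschitz.\<close>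

definition height :: "real^3 \<Rightarrow> real" where
  "height y = 1 / sqrt (1 + clip R y \<bullet> clip R y)"

text \<open>The force \<open>h\<^sup>-\<^sup>1 p'\<close> in gnomonic coordinates: transversal part of the field plus repulsion
  from the pole.\<close>

definition push :: "real^'k \<Rightarrow> real^3 \<Rightarrow> real^3" where
  "push \<phi> y = E \<phi> - (E \<phi> \<bullet> k) *\<^sub>R k + (coulomb a (height y) - E \<phi> \<bullet> k) *\<^sub>R clip R y"

text \<open>A bound for \<open>p'\<close>. It does not depend on \<open>p\<close>, since the force is independent of the velocity in
  these coordinates.\<close>

definition M :: real where "M = C + (a + C) * R"

text \<open>A particle with more momentum than this leaves the ball of radius \<open>R\<close> within one unit of time;
  see \<open>confined_momentum\<close>, which also dictates the truncation level \<open>K\<close> for the momentum.\<close>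

definition P_max :: real where "P_max = max (2 * R + M) (3 * M)"

definition K :: real where "K = max P_max (4 * R + 1)"

text \<open>The truncated equations of motion for phase, gnomonic coordinate and momentum. With the phase
  as a state variable the system is autonomous, and continuous dependence on initial values
  covers the dependence on the phase. The vectors \<open>y\<close> and \<open>p\<close> range over all of \<open>\<real>\<^sup>3\<close> and not
  only over the plane orthogonal to \<open>k\<close>; this plane is invariant.\<close>

definition field :: "'k state \<Rightarrow> 'k state" where
  "field z = (\<omega>, (1 + clip R (fst (snd z)) \<bullet> clip R (fst (snd z))) *\<^sub>R clip K (snd (snd z)),
     height (fst (snd z)) *\<^sub>R push (fst z) (fst (snd z)))"

lemma M_nonneg: "M \<ge> 0" using C_nonneg a_pos R_pos by (simp add: M_def)

lemma P_max_pos: "P_max > 0" using R_pos M_nonneg by (simp add: P_max_def)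

lemma K_pos: "K > 0" using R_pos by (simp add: K_def)

lemma stretch_ge_1: "1 \<le> 1 + clip R y \<bullet> clip R y" by simp

lemma height_range: "0 < height y" "height y \<le> 1"
  using stretch_ge_1[of y] by (auto simp: height_def add_pos_nonneg)

lemma transversal_field_bound: "norm (E \<phi> - (E \<phi> \<bullet> k) *\<^sub>R k) \<le> C"
proof -
  have "(E \<phi> - (E \<phi> \<bullet> k) *\<^sub>R k) \<bullet> (E \<phi> - (E \<phi> \<bullet> k) *\<^sub>R k) = E \<phi> \<bullet> E \<phi> - (E \<phi> \<bullet> k)\<^sup>2"
    by (simp add: inner_diff_left inner_diff_right inner_commute kk power2_eq_square)
  also have "\<dots> \<le> E \<phi> \<bullet> E \<phi>" by simp
  finally have "norm (E \<phi> - (E \<phi> \<bullet> k) *\<^sub>R k) \<le> norm (E \<phi>)" by (simp add: norm_le)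
  then show ?thesis using E_bound order_trans by blast
qed

lemma repulsion_ge: "\<delta> \<le> coulomb a (height y) - E \<phi> \<bullet> k"
  using coulomb_lower[OF a_pos, of "height y"] height_range[of y] E_margin[of \<phi>] by simp

lemma push_bound: "norm (height y *\<^sub>R push \<phi> y) \<le> M"
proof -
  have "\<bar>E \<phi> \<bullet> k\<bar> \<le> C" using Cauchy_Schwarz_ineq2[of "E \<phi>" k] k_unit E_bound[of \<phi>] by simp
  then have "coulomb a (height y) - E \<phi> \<bullet> k \<le> a + C"
    using coulomb_upper[OF a_pos, of "height y"] height_range[of y] by linarith
  then have "\<bar>coulomb a (height y) - E \<phi> \<bullet> k\<bar> * norm (clip R y) \<le> (a + C) * R"
    using repulsion_ge[of y \<phi>] \<delta>_pos norm_clip[OF R_pos, of y] R_pos by (intro mult_mono) auto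
  then have "norm (push \<phi> y) \<le> M"
    unfolding push_def M_def
    by (intro norm_triangle_mono transversal_field_bound) simp
  then have "height y * norm (push \<phi> y) \<le> 1 * M"
    using height_range[of y] by (intro mult_mono) auto
  then show ?thesis using height_range[of y] by simp
qed

lemma field_Lipschitz: "\<exists>L>0. \<forall>x y. norm (field x - field y) \<le> L * norm (x - y)"
proof -
  have E: "bounded_Lipschitz (\<lambda>z :: 'k state. E (fst z))"
  proof (rule bounded_LipschitzI[OF E_bound])
    fix z w :: "'k state"
    have "norm (E (fst z) - E (fst w)) \<le> L\<^sub>E * norm (fst z - fst w)" by (rule E_Lipschitz)
    also have "\<dots> \<le> \<bar>L\<^sub>E\<bar> * dist z w"
      using dist_fst_le[of z w] by (intro mult_mono) (auto simp: dist_norm)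
    finally show "norm (E (fst z) - E (fst w)) \<le> \<bar>L\<^sub>E\<bar> * dist z w" .
  qed
  have cy: "bounded_Lipschitz (\<lambda>z :: 'k state. clip R (fst (snd z)))"
    using order_trans[OF dist_fst_le dist_snd_le]
    by (intro bounded_Lipschitz_clip R_pos) (simp flip: dist_norm)
  have cp: "bounded_Lipschitz (\<lambda>z :: 'k state. clip K (snd (snd z)))"
    using order_trans[OF dist_snd_le dist_snd_le]
    by (intro bounded_Lipschitz_clip K_pos) (simp flip: dist_norm)
  have stretch: "bounded_Lipschitz (\<lambda>z :: 'k state. 1 + clip R (fst (snd z)) \<bullet> clip R (fst (snd z)))"
    by (intro bounded_Lipschitz_add bounded_Lipschitz_const bounded_Lipschitz_inner cy)
  have height: "bounded_Lipschitz (\<lambda>z :: 'k state. height (fst (snd z)))"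
    unfolding height_def
  proof (rule bounded_Lipschitz_compose[OF stretch, where S = "{1..}" and K = 1 and B = 1])
    show "norm (1 / sqrt s) \<le> 1" if "s \<in> {1..}" for s :: real
      using that by simp
  qed (use stretch_ge_1 inverse_sqrt_Lipschitz in auto)
  have coul: "bounded_Lipschitz (\<lambda>z :: 'k state. coulomb a (height (fst (snd z))))"
  proof (rule bounded_Lipschitz_compose[OF height, where S = "{0..1}" and K = "3 * a\<^sup>2" and B = a])
    show "norm (coulomb a h) \<le> a" if "h \<in> {0..1}" for h
    proof -
      have "0 \<le> a / (1 + a) ^ 3" using a_pos by (intro divide_nonneg_nonneg) auto
      then have "0 \<le> coulomb a h" using coulomb_lower[OF a_pos, of h] that by simp
      then show ?thesis using coulomb_upper[OF a_pos, of h] that by simp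
    qed
  qed (use height_range coulomb_Lipschitz[OF a_pos] in \<open>auto simp: less_imp_le\<close>)
  have "bounded_Lipschitz field"
    unfolding field_def push_def
    by (intro bounded_Lipschitz_Pair bounded_Lipschitz_scaleR bounded_Lipschitz_add
        bounded_Lipschitz_diff bounded_Lipschitz_inner bounded_Lipschitz_const E cp cy stretch height coul)
  then obtain L where L: "L \<ge> 0" "\<And>x y. norm (field x - field y) \<le> L * dist x y"
    using bounded_LipschitzE by metis
  have "norm (field x - field y) \<le> (L + 1) * norm (x - y)" for x y
    using L(2)[of x y] by (simp add: dist_norm distrib_right add_increasing2)
  then show ?thesis using L(1) by (intro exI[of _ "L + 1"]) auto
qed

definition flow :: "'k state \<Rightarrow> real \<Rightarrow> 'k state" where
  "flow z = (SOME f. f 0 = z \<and> (\<forall>t. (f has_vector_derivative field (f t)) (at t)))"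

lemma flow: "flow z 0 = z" "(flow z has_vector_derivative field (flow z t)) (at t)"
proof -
  obtain L where L: "L > 0" "\<And>x y. norm (field x - field y) \<le> L * norm (x - y)"
    using field_Lipschitz by blast
  have cont: "continuous_on UNIV field"
    using L by (intro lipschitz_on_continuous_on[of L] lipschitz_onI) (auto simp: dist_norm)
  obtain f where "f 0 = z" "\<And>t. (f has_vector_derivative field (f t)) (at t)"
  proof (rule global_solution_of_Lipschitz_equation[where F = "\<lambda>_. field" and L = L and B = "norm (field 0)"])
    show "continuous_on UNIV (\<lambda>t. field (w t))" if "continuous_on UNIV w" for w :: "real \<Rightarrow> _"
      using continuous_on_compose2[OF cont that] by simp
  qed (use L in auto)
  then have "\<exists>f. f 0 = z \<and> (\<forall>t. (f has_vector_derivative field (f t)) (at t))" by blast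
  from someI_ex[OF this] show "flow z 0 = z" "(flow z has_vector_derivative field (flow z t)) (at t)"
    unfolding flow_def by auto
qed

lemma flow_dependence: "\<exists>L. \<forall>z w t. norm (flow z t - flow w t) \<le> exp (L * \<bar>t\<bar>) * norm (z - w)"
proof -
  obtain L where L: "L > 0" "\<And>x y. norm (field x - field y) \<le> L * norm (x - y)"
    using field_Lipschitz by blast
  have "norm (flow z t - flow w t) \<le> exp (L * \<bar>t\<bar>) * norm (flow z 0 - flow w 0)" for z w t
    using L flow by (intro solutions_diverge_at_most_exponentially[where F = "\<lambda>_. field"]) auto
  then show ?thesis unfolding flow(1) by blast
qed

lemma continuous_on_flow: "continuous_on UNIV (\<lambda>z. flow z t)"
proof -
  obtain L where L: "\<And>z w. norm (flow z t - flow w t) \<le> exp (L * \<bar>t\<bar>) * norm (z - w)"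
    using flow_dependence by blast
  then show ?thesis
    by (intro lipschitz_on_continuous_on[of "exp (L * \<bar>t\<bar>)"] lipschitz_onI) (auto simp: dist_norm)
qed

lemma flow_unique:
  assumes "f 0 = z" "\<And>t. (f has_vector_derivative field (f t)) (at t)"
  shows "f t = flow z t"
proof -
  obtain L where L: "L > 0" "\<And>x y. norm (field x - field y) \<le> L * norm (x - y)"
    using field_Lipschitz by blast
  have "norm (f t - flow z t) \<le> exp (L * \<bar>t\<bar>) * norm (f 0 - flow z 0)"
    using L flow assms by (intro solutions_diverge_at_most_exponentially[where F = "\<lambda>_. field"]) auto
  then show ?thesis by (simp add: flow assms)
qed

lemma flow_add: "flow (flow z s) t = flow z (s + t)"
proof -
  have "((\<lambda>t. flow z (s + t)) has_vector_derivative field (flow z (s + t))) (at t)" for t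
  proof -
    have "((\<lambda>r. s + r) has_vector_derivative 1) (at t)" by (auto intro!: derivative_eq_intros)
    from vector_diff_chain_at[OF this flow(2)] show ?thesis by (simp add: o_def)
  qed
  from flow_unique[OF _ this] show ?thesis by simp
qed

definition Y :: "'k state \<Rightarrow> real \<Rightarrow> real^3" where "Y z t = fst (snd (flow z t))"

definition P :: "'k state \<Rightarrow> real \<Rightarrow> real^3" where "P z t = snd (snd (flow z t))"

lemma Y_deriv:
  "(Y z has_vector_derivative (1 + clip R (Y z t) \<bullet> clip R (Y z t)) *\<^sub>R clip K (P z t)) (at t)"
  using bounded_linear.has_vector_derivative[OF bounded_linear_fst
      bounded_linear.has_vector_derivative[OF bounded_linear_snd flow(2)[of z t]]]
  by (simp add: field_def Y_def[abs_def] P_def)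

lemma fst_flow: "fst (flow z t) = fst z + t *\<^sub>R \<omega>"
proof -
  have "((\<lambda>t. fst (flow z t) - t *\<^sub>R \<omega>) has_vector_derivative 0) (at t)" for t
    using bounded_linear.has_vector_derivative[OF bounded_linear_fst flow(2)[of z t]]
    by (auto intro!: derivative_eq_intros simp: field_def)
  then have "\<exists>c. \<forall>t. fst (flow z t) - t *\<^sub>R \<omega> = c"
    using has_vector_derivative_zero_constant[of UNIV "\<lambda>t. fst (flow z t) - t *\<^sub>R \<omega>"] by (metis UNIV_I convex_UNIV)
  then obtain c where c: "\<And>t. fst (flow z t) - t *\<^sub>R \<omega> = c" by blast
  have "c = fst z" using c[of 0] by (simp add: flow)
  then show ?thesis using c[of t] by (simp add: algebra_simps)
qed

lemma P_deriv:
  "(P z has_vector_derivative height (Y z t) *\<^sub>R push (fst z + t *\<^sub>R \<omega>) (Y z t)) (at t)"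
  using bounded_linear.has_vector_derivative[OF bounded_linear_snd
      bounded_linear.has_vector_derivative[OF bounded_linear_snd flow(2)[of z t]]]
  by (simp add: field_def Y_def P_def[abs_def] fst_flow)

lemma continuous_on_Y: "continuous_on UNIV (\<lambda>z. Y z t)"
  unfolding Y_def by (intro continuous_intros continuous_on_flow)

lemma continuous_on_P: "continuous_on UNIV (\<lambda>z. P z t)"
  unfolding P_def by (intro continuous_intros continuous_on_flow)

lemma momentum_Lipschitz: "norm (P z t - P z s) \<le> M * \<bar>t - s\<bar>"
proof -
  have *: "norm (P z t - P z s) \<le> M * (t - s)" if "s < t" for s t
  proof -
    have "norm (P z t - P z s) \<le> M * t - M * s"
    proof (rule differentiable_bound_general[OF that])
      show "continuous_on {s..t} (P z)"
        by (meson P_deriv continuous_at_imp_continuous_on has_vector_derivative_continuous)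
      show "((\<lambda>t. M * t) has_vector_derivative M) (at x)" for x
        unfolding has_real_derivative_iff_has_vector_derivative[symmetric]
        by (auto intro!: derivative_eq_intros)
    qed (auto intro!: continuous_intros P_deriv push_bound)
    then show ?thesis by (simp add: right_diff_distrib)
  qed
  show ?thesis
    using *[of s t] *[of t s] by (cases s t rule: linorder_cases) (auto simp: norm_minus_commute)
qed

text \<open>The positive factor by which the truncated equation for \<open>y\<close> multiplies the momentum; the
  truncation never changes the direction of motion.\<close>

definition rate :: "real^3 \<Rightarrow> real^3 \<Rightarrow> real" where
  "rate y p = (1 + clip R y \<bullet> clip R y) * (K / max K (norm p))"

lemma Y_inner_deriv:
  "((\<lambda>t. Y z t \<bullet> q) has_real_derivative
     rate (Y z t) (P z t) * (P z t \<bullet> q)) (at t)"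
  using has_real_derivative_inner_const[OF Y_deriv[of z t], of q] by (simp add: clip_def[of K] rate_def)

lemma rate_pos: "0 < rate y p"
  unfolding rate_def using K_pos by (intro mult_pos_pos divide_pos_pos add_pos_nonneg) auto

text \<open>The force changes the momentum by at most \<open>M T\<close> during the time \<open>T\<close>. If the initial momentum
  \<open>p\<close> is longer than that, the momentum keeps a positive component along \<open>p\<close>, so the particle
  that starts at the origin ends with \<open>Y \<bullet> p > 0\<close>, and some momentum leads back to the origin.\<close>

lemma shooting:
  assumes T: "T > 0"
  obtains p where "Y (\<phi>, 0, p) T = 0"
proof -
  define r where "r = M * T + 1"
  have r: "r > 0" using M_nonneg T by (simp add: r_def add_nonneg_pos)
  have "continuous_on UNIV (\<lambda>p. Y (\<phi>, 0, p) T)"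
    by (rule continuous_on_compose2[OF continuous_on_Y]) (auto intro!: continuous_intros)
  then have cont: "continuous_on (cball 0 r) (\<lambda>p. Y (\<phi>, 0, p) T)"
    using continuous_on_subset by blast
  have out: "0 < Y (\<phi>, 0, p) T \<bullet> p" if p: "norm p = r" for p
  proof -
    let ?z = "(\<phi>, 0 :: real^3, p)"
    have P0: "P ?z 0 = p" "Y ?z 0 = 0" by (auto simp: P_def Y_def flow)
    have "0 < P ?z t \<bullet> p" if t: "0 \<le> t" "t \<le> T" for t
    proof -
      have "\<bar>(P ?z t - p) \<bullet> p\<bar> \<le> norm (P ?z t - P ?z 0) * norm p"
        unfolding P0 by (rule Cauchy_Schwarz_ineq2)
      also have "\<dots> \<le> M * T * r"
      proof (intro mult_mono)
        have "norm (P ?z t - P ?z 0) \<le> M * \<bar>t - 0\<bar>" by (rule momentum_Lipschitz)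
        also have "\<dots> \<le> M * T" using t M_nonneg by (intro mult_left_mono) auto
        finally show "norm (P ?z t - P ?z 0) \<le> M * T" .
      qed (use p M_nonneg T in auto)
      also have "\<dots> < r * r" using r by (simp add: r_def)
      also have "r * r = p \<bullet> p" using p by (simp add: dot_square_norm power2_eq_square)
      finally show ?thesis by (simp add: inner_diff_left)
    qed
    then have "Y ?z 0 \<bullet> p < Y ?z T \<bullet> p"
    proof (intro DERIV_pos_imp_increasing[OF T, where f = "\<lambda>t. Y ?z t \<bullet> p"] exI conjI)
      fix t assume t: "0 \<le> t" "t \<le> T"
      show "0 < rate (Y ?z t) (P ?z t) * (P ?z t \<bullet> p)"
        using \<open>\<And>t. 0 \<le> t \<Longrightarrow> t \<le> T \<Longrightarrow> 0 < P ?z t \<bullet> p\<close>[OF t]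
        by (rule mult_pos_pos[OF rate_pos])
    qed (rule Y_inner_deriv)
    then show ?thesis by (simp add: P0)
  qed
  show thesis using zero_if_outward_on_sphere[OF r cont out] that by metis
qed

lemma inner_YP_deriv:
  "((\<lambda>t. Y z t \<bullet> P z t) has_real_derivative
     rate (Y z t) (P z t) * (P z t \<bullet> P z t)
     + height (Y z t) * (Y z t \<bullet> push (fst z + t *\<^sub>R \<omega>) (Y z t))) (at t)"
  using has_real_derivative_inner[OF Y_deriv[of z t] P_deriv[of z t]]
  by (simp add: clip_def[of K] rate_def)

text \<open>Beyond the radius \<open>R\<close> the repulsion, at least \<open>\<delta> R\<close>, beats the transversal field, at most \<open>C\<close>.\<close>

lemma push_outward:
  assumes "norm y > R"
  shows "0 < y \<bullet> push \<phi> y"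
proof -
  define g where "g = coulomb a (height y) - E \<phi> \<bullet> k"
  have g: "\<delta> \<le> g" unfolding g_def by (rule repulsion_ge)
  have "\<bar>y \<bullet> (E \<phi> - (E \<phi> \<bullet> k) *\<^sub>R k)\<bar> \<le> norm y * C"
    by (rule order_trans[OF Cauchy_Schwarz_ineq2 mult_left_mono[OF transversal_field_bound]]) simp
  moreover have "y \<bullet> clip R y = R * norm y"
    using assms R_pos by (simp add: clip_def max_def dot_square_norm power2_eq_square)
  moreover have "norm y * C < g * (R * norm y)"
  proof -
    have "C < \<delta> * R" using \<delta>_pos by (simp add: R_def field_simps)
    also have "\<dots> \<le> g * R" using g R_pos by (intro mult_right_mono) auto
    finally have "C * norm y < g * R * norm y" using assms R_pos by (intro mult_strict_right_mono) auto
    then show ?thesis by (simp add: mult_ac)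
  qed
  ultimately show ?thesis
    unfolding push_def g_def[symmetric] by (simp add: inner_add_right)
qed

lemma Y_norm_deriv:
  "((\<lambda>t. Y z t \<bullet> Y z t) has_real_derivative
     2 * (rate (Y z t) (P z t)) * (Y z t \<bullet> P z t)) (at t)"
  using has_real_derivative_inner[OF Y_deriv[of z t] Y_deriv[of z t]]
  by (elim DERIV_cong) (simp add: clip_def[of K] rate_def inner_commute algebra_simps)

text \<open>Where \<open>\<parallel>Y\<parallel>\<close> is maximal \<open>Y \<bullet> P\<close> vanishes. If the maximum exceeded \<open>R\<close>, the function \<open>Y \<bullet> P\<close>
  would increase there, so it would be positive and \<open>\<parallel>Y\<parallel>\<close> increasing immediately afterwards.\<close>

lemma boundary_values_confine_norm:
  assumes T: "T > 0" and 0: "Y z 0 = 0" "Y z T = 0" and t: "0 \<le> t" "t \<le> T"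
  shows "norm (Y z t) \<le> R"
proof (rule ccontr)
  assume far: "\<not> norm (Y z t) \<le> R"
  let ?r = "\<lambda>t. Y z t \<bullet> Y z t"
  let ?s = "\<lambda>t. rate (Y z t) (P z t)"
  have "continuous_on {0..T} ?r"
    using Y_norm_deriv DERIV_isCont continuous_at_imp_continuous_on by blast
  then obtain s where s: "s \<in> {0..T}" "\<And>u. u \<in> {0..T} \<Longrightarrow> ?r u \<le> ?r s"
    using continuous_attains_sup[of "{0..T}" ?r] T by auto
  have "?r t \<le> ?r s" using s t by simp
  then have "norm (Y z t) \<le> norm (Y z s)" by (simp add: norm_le)
  then have farS: "norm (Y z s) > R" using far by simp
  then have "s \<noteq> 0" "s \<noteq> T" using 0 R_pos by auto
  then have s': "0 < s" "s < T" using s by auto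
  have "2 * ?s s * (Y z s \<bullet> P z s) = 0"
  proof (rule DERIV_local_max[OF Y_norm_deriv])
    show "0 < min s (T - s)" using s' by simp
    show "\<forall>u. \<bar>s - u\<bar> < min s (T - s) \<longrightarrow> ?r u \<le> ?r s" using s by (auto simp: abs_if split: if_splits)
  qed
  moreover have "?s s \<noteq> 0" using rate_pos[of "Y z s" "P z s"] by (rule less_imp_neq[symmetric])
  ultimately have "Y z s \<bullet> P z s = 0" by (simp only: mult_eq_0_iff) auto
  have "0 < ?s s * (P z s \<bullet> P z s) + height (Y z s) * (Y z s \<bullet> push (fst z + s *\<^sub>R \<omega>) (Y z s))"
    by (intro add_nonneg_pos mult_pos_pos height_range push_outward[OF farS]
        mult_nonneg_nonneg[OF less_imp_le[OF rate_pos] inner_ge_zero])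
  from DERIV_pos_inc_right[OF inner_YP_deriv this]
  obtain d where d: "d > 0" "\<And>h. 0 < h \<Longrightarrow> h < d \<Longrightarrow> Y z s \<bullet> P z s < Y z (s + h) \<bullet> P z (s + h)"
    by blast
  define u where "u = s + min (d / 2) (T - s)"
  have u: "s < u" "u \<le> T" "u - s < d" using d s' by (auto simp: u_def min_def)
  have "?r s < ?r u"
  proof (rule DERIV_pos_imp_increasing_open[OF u(1)])
    fix v assume "s < v" "v < u"
    then have "0 < Y z v \<bullet> P z v" using d(2)[of "v - s"] u \<open>Y z s \<bullet> P z s = 0\<close> by simp
    then have "0 < 2 * ?s v * (Y z v \<bullet> P z v)"
      by (intro mult_pos_pos[OF mult_pos_pos[OF _ rate_pos]]) auto
    then show "\<exists>y. (?r has_real_derivative y) (at v) \<and> 0 < y" using Y_norm_deriv by blast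
  qed (use Y_norm_deriv DERIV_isCont continuous_at_imp_continuous_on in blast)
  moreover have "?r u \<le> ?r s" using s u s' by auto
  ultimately show False by simp
qed

text \<open>The transversal field has no component along \<open>k\<close>, so \<open>(Y \<bullet> k) (P \<bullet> k)\<close> is nondecreasing. It
  vanishes at both ends, hence throughout, and then so do both terms of its derivative.\<close>

lemma boundary_values_confine_plane:
  assumes T: "T > 0" and 0: "Y z 0 = 0" "Y z T = 0" and t: "0 \<le> t" "t \<le> T"
  shows "Y z t \<bullet> k = 0"
proof (cases "t = 0 \<or> t = T")
  case True then show ?thesis using 0 by auto
next
  case False
  let ?q = "\<lambda>t. (Y z t \<bullet> k) * (P z t \<bullet> k)"
  let ?s = "\<lambda>t. rate (Y z t) (P z t)"
  let ?g = "\<lambda>t. height (Y z t) * (coulomb a (height (Y z t)) - E (fst z + t *\<^sub>R \<omega>) \<bullet> k) * (R / max R (norm (Y z t)))"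
  have q': "(?q has_real_derivative ?s t * (P z t \<bullet> k)\<^sup>2 + ?g t * (Y z t \<bullet> k)\<^sup>2) (at t)" for t
  proof -
    have push_k: "push \<phi> y \<bullet> k = (coulomb a (height y) - E \<phi> \<bullet> k) * (R / max R (norm y)) * (y \<bullet> k)" for \<phi> y
      by (simp add: push_def inner_add_left inner_diff_left kk clip_def)
    show ?thesis
      using DERIV_mult[OF Y_inner_deriv[of z k t] has_real_derivative_inner_const[OF P_deriv[of z t], of k]]
      by (elim DERIV_cong) (simp only: push_k inner_scaleR_left power2_eq_square ac_simps)
  qed
  have g: "0 < ?g t" for t
    using height_range[of "Y z t"] repulsion_ge[of "Y z t" "fst z + t *\<^sub>R \<omega>"] \<delta>_pos R_pos
    by (intro mult_pos_pos divide_pos_pos) auto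
  have nonneg: "0 \<le> ?s t * (P z t \<bullet> k)\<^sup>2 + ?g t * (Y z t \<bullet> k)\<^sup>2" for t
    by (intro add_nonneg_nonneg mult_nonneg_nonneg[OF less_imp_le[OF rate_pos] zero_le_power2]
        mult_nonneg_nonneg[OF less_imp_le[OF g] zero_le_power2])
  have mono: "?q u \<le> ?q v" if "u \<le> v" for u v
    using q' nonneg by (intro DERIV_nonneg_imp_nondecreasing[OF that, where f = ?q]) blast
  have zero: "?q u = 0" if "0 \<le> u" "u \<le> T" for u
    using mono[OF that(1)] mono[OF that(2)] 0 by simp
  have "?s t * (P z t \<bullet> k)\<^sup>2 + ?g t * (Y z t \<bullet> k)\<^sup>2 = 0"
  proof (rule DERIV_local_max[OF q'])
    show "0 < min t (T - t)" using False t by simp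
    show "\<forall>u. \<bar>t - u\<bar> < min t (T - t) \<longrightarrow> ?q u \<le> ?q t"
    proof (intro allI impI)
      fix u assume "\<bar>t - u\<bar> < min t (T - t)"
      then have "0 \<le> u" "u \<le> T" by linarith+
      then show "?q u \<le> ?q t" unfolding zero[OF t] zero[OF \<open>0 \<le> u\<close> \<open>u \<le> T\<close>] by simp
    qed
  qed
  moreover have "0 \<le> ?s t * (P z t \<bullet> k)\<^sup>2"
    by (rule mult_nonneg_nonneg[OF less_imp_le[OF rate_pos] zero_le_power2])
  moreover have "0 \<le> ?g t * (Y z t \<bullet> k)\<^sup>2" 
    by (rule mult_nonneg_nonneg[OF less_imp_le[OF g] zero_le_power2])
  ultimately have "?g t * (Y z t \<bullet> k)\<^sup>2 = 0" by linarith
  then show ?thesis using g[of t] by (simp only: mult_eq_0_iff power_eq_0_iff) auto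
qed

text \<open>A momentum of length \<open>Q > P_max\<close> keeps its direction approximately during one unit of time:
  its component along the initial direction \<open>q\<close> is at least \<open>Q - M\<close>, its length at most
  \<open>Q + M \<le> 2 (Q - M)\<close>. So \<open>Y \<bullet> q\<close> grows at a rate of at least \<open>min (Q - M) (K / 2) > 2 R\<close>, where
  \<open>K / 2\<close> accounts for the truncation, and the particle cannot stay within distance \<open>R\<close>.\<close>

lemma confined_momentum:
  assumes conf: "\<And>u. s \<le> u \<Longrightarrow> u \<le> s + 1 \<Longrightarrow> norm (Y z u) \<le> R"
  shows "norm (P z s) \<le> P_max"
proof (rule ccontr)
  assume "\<not> norm (P z s) \<le> P_max"
  define Q where "Q = norm (P z s)"
  have Q: "Q > 2 * R + M" "Q > 3 * M" "Q > 0"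
    using \<open>\<not> norm (P z s) \<le> P_max\<close> P_max_pos by (auto simp: Q_def P_max_def)
  define q where "q = P z s /\<^sub>R Q"
  have q: "norm q = 1" "P z s \<bullet> q = Q"
    using Q by (auto simp: q_def Q_def dot_square_norm power2_eq_square)
  define m where "m = min (Q - M) (K / 2)"
  have "2 * R < m"
    using Q R_pos by (auto simp: m_def K_def)
  have d: "m \<le> rate (Y z u) (P z u) * (P z u \<bullet> q)"
    if u: "s \<le> u" "u \<le> s + 1" for u
  proof -
    have "norm (P z u - P z s) \<le> M * \<bar>u - s\<bar>" by (rule momentum_Lipschitz)
    also have "\<dots> \<le> M" using u M_nonneg by (simp add: mult_left_le)
    finally have dP: "norm (P z u - P z s) \<le> M" .
    then have "\<bar>(P z u - P z s) \<bullet> q\<bar> \<le> M"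
      using Cauchy_Schwarz_ineq2[of "P z u - P z s" q] q by simp
    then have Pq: "Q - M \<le> P z u \<bullet> q" using q(2) by (simp add: inner_diff_left)
    have nP: "norm (P z u) \<le> Q + M" using dP norm_triangle_ineq2[of "P z u" "P z s"] by (simp add: Q_def)
    have "m \<le> K / max K (norm (P z u)) * (P z u \<bullet> q)"
    proof (cases "norm (P z u) \<le> K")
      case True
      then show ?thesis using K_pos Pq by (simp add: m_def max_def)
    next
      case False
      have "norm (P z u) \<le> 2 * (Q - M)" using nP Q(2) by simp
      also have "\<dots> \<le> 2 * (P z u \<bullet> q)" using Pq by simp
      finally have "K * norm (P z u) \<le> K * (2 * (P z u \<bullet> q))" using K_pos by (intro mult_left_mono) auto
      moreover have "norm (P z u) > 0" using False K_pos by linarith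
      ultimately have "K / 2 \<le> K / norm (P z u) * (P z u \<bullet> q)" by (simp add: field_simps)
      moreover have "m \<le> K / 2" unfolding m_def by (rule min.cobounded2)
      moreover have "max K (norm (P z u)) = norm (P z u)" using False by (simp add: max_def)
      ultimately show ?thesis by (metis order_trans)
    qed
    also have "\<dots> \<le> (1 + clip R (Y z u) \<bullet> clip R (Y z u)) * (K / max K (norm (P z u)) * (P z u \<bullet> q))"
    proof -
      have "0 \<le> K / max K (norm (P z u)) * (P z u \<bullet> q)"
        using \<open>m \<le> K / max K (norm (P z u)) * (P z u \<bullet> q)\<close> \<open>2 * R < m\<close> R_pos by linarith
      then show ?thesis using mult_right_mono[OF stretch_ge_1] by fastforce
    qed
    finally show ?thesis by (simp add: rate_def mult.assoc)
  qed
  have "Y z s \<bullet> q - m * s \<le> Y z (s + 1) \<bullet> q - m * (s + 1)"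
  proof (rule DERIV_nonneg_imp_nondecreasing[of s "s + 1" "\<lambda>u. Y z u \<bullet> q - m * u"])
    fix u assume u: "s \<le> u" "u \<le> s + 1"
    have "((\<lambda>u. Y z u \<bullet> q - m * u) has_real_derivative
        rate (Y z u) (P z u) * (P z u \<bullet> q) - m) (at u)"
      by (rule DERIV_diff[OF Y_inner_deriv]) (auto intro!: derivative_eq_intros)
    then show "\<exists>y. ((\<lambda>u. Y z u \<bullet> q - m * u) has_real_derivative y) (at u) \<and> 0 \<le> y"
      using d[OF u] by (intro exI conjI) auto
  qed simp
  then have "m \<le> Y z (s + 1) \<bullet> q - Y z s \<bullet> q" by (simp add: algebra_simps)
  also have "\<dots> \<le> R + R"
    using norm_cauchy_schwarz[of "Y z (s + 1)" q] norm_cauchy_schwarz[of "- Y z s" q] q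
      conf[of s] conf[of "s + 1"] by simp
  finally show False using \<open>2 * R < m\<close> by simp
qed

definition confined :: "'k state \<Rightarrow> bool" where
  "confined z \<longleftrightarrow> (\<forall>t. norm (Y z t) \<le> R \<and> norm (P z t) \<le> P_max \<and> Y z t \<bullet> k = 0)"

lemma Y_flow: "Y (flow z s) t = Y z (s + t)" by (simp add: Y_def flow_add)

lemma P_flow: "P (flow z s) t = P z (s + t)" by (simp add: P_def flow_add)

lemma confined_flow: "confined z \<Longrightarrow> confined (flow z s)"
  by (simp add: confined_def Y_flow P_flow)

lemma closed_confined: "closed {z. confined z}"
proof -
  have "closed {z. norm (Y z t) \<le> R \<and> norm (P z t) \<le> P_max \<and> Y z t \<bullet> k = 0}" for t
    by (intro closed_Collect_conj closed_Collect_le closed_Collect_eq continuous_intros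
        continuous_on_Y continuous_on_P)
  then have "closed (\<Inter>t. {z. norm (Y z t) \<le> R \<and> norm (P z t) \<le> P_max \<and> Y z t \<bullet> k = 0})"
    by (intro closed_INT ballI)
  moreover have "{z. confined z} = (\<Inter>t. {z. norm (Y z t) \<le> R \<and> norm (P z t) \<le> P_max \<and> Y z t \<bullet> k = 0})"
    by (auto simp: confined_def)
  ultimately show ?thesis by (simp only:)
qed

text \<open>The solution of the boundary value problem on a time interval of length \<open>2 m\<close> around \<open>0\<close>
  satisfies the bounds up to one unit of time before its end, as \<open>confined_momentum\<close> looks one
  unit ahead. The states at time \<open>0\<close> lie in a compact set, and the bounds are closed conditions
  on the state.\<close>

lemma confined_exists: "\<exists>y p. confined (\<phi>, y, p)"
proof -
  have "\<exists>z. fst z = \<phi> \<and> (\<forall>t. \<bar>t\<bar> \<le> real n \<longrightarrow> norm (Y z t) \<le> R \<and> norm (P z t) \<le> P_max \<and> Y z t \<bullet> k = 0)" for n :: nat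
  proof -
    define m where "m = real n + 1"
    have m: "2 * m > 0" by (simp add: m_def)
    obtain p where p: "Y (\<phi> - m *\<^sub>R \<omega>, 0, p) (2 * m) = 0" using shooting[OF m] by blast
    define w where "w = (\<phi> - m *\<^sub>R \<omega>, 0 :: real^3, p)"
    have w: "Y w 0 = 0" "Y w (2 * m) = 0" using p by (auto simp: w_def Y_def flow)
    define z where "z = flow w m"
    have "norm (Y z t) \<le> R \<and> norm (P z t) \<le> P_max \<and> Y z t \<bullet> k = 0" if "\<bar>t\<bar> \<le> real n" for t
    proof (intro conjI)
      have t: "0 \<le> m + t" "m + t + 1 \<le> 2 * m" using that by (auto simp: m_def)
      show "norm (Y z t) \<le> R" unfolding z_def Y_flow
        using t by (intro boundary_values_confine_norm[OF m w]) auto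
      show "Y z t \<bullet> k = 0" unfolding z_def Y_flow
        using t by (intro boundary_values_confine_plane[OF m w]) auto
      show "norm (P z t) \<le> P_max" unfolding z_def P_flow
        using t by (intro confined_momentum boundary_values_confine_norm[OF m w]) auto
    qed
    moreover have "fst z = \<phi>" by (simp add: z_def fst_flow w_def)
    ultimately show ?thesis by blast
  qed
  then obtain z where z: "\<And>n. fst (z n) = \<phi>"
    "\<And>n t. \<bar>t\<bar> \<le> real n \<Longrightarrow> norm (Y (z n) t) \<le> R \<and> norm (P (z n) t) \<le> P_max \<and> Y (z n) t \<bullet> k = 0"
    by metis
  have "z n \<in> {\<phi>} \<times> cball 0 R \<times> cball 0 P_max" for n
    using z(1)[of n] z(2)[of 0 n] by (simp add: mem_Times_iff Y_def P_def flow)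
  moreover have "seq_compact ({\<phi>} \<times> cball (0 :: real^3) R \<times> cball (0 :: real^3) P_max)"
    by (intro compact_imp_seq_compact compact_Times compact_cball) auto
  ultimately obtain l r where l: "l \<in> {\<phi>} \<times> cball 0 R \<times> cball 0 P_max"
    and r: "strict_mono (r :: nat \<Rightarrow> nat)" and lim: "(\<lambda>n. z (r n)) \<longlonglongrightarrow> l"
    using seq_compactE[of _ z] unfolding o_def by metis
  have "norm (Y l t) \<le> R \<and> norm (P l t) \<le> P_max \<and> Y l t \<bullet> k = 0" for t
  proof -
    obtain N where N: "\<bar>t\<bar> \<le> real N" using real_arch_simple by blast
    have ev: "\<forall>\<^sub>F n in sequentially. \<bar>t\<bar> \<le> real (r n)"
      unfolding eventually_sequentially
    proof (intro exI[of _ N] allI impI)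
      fix n assume "N \<le> n"
      then have "N \<le> r n" using seq_suble[OF r, of n] by linarith
      then show "\<bar>t\<bar> \<le> real (r n)" using N by linarith
    qed
    have Yl: "(\<lambda>n. Y (z (r n)) t) \<longlonglongrightarrow> Y l t" and Pl: "(\<lambda>n. P (z (r n)) t) \<longlonglongrightarrow> P l t"
      using continuous_on_tendsto_compose[OF continuous_on_Y lim]
        continuous_on_tendsto_compose[OF continuous_on_P lim] by auto
    have "norm (Y l t) \<le> R"
      by (rule tendsto_upperbound[OF tendsto_norm[OF Yl]]) (use ev z(2) in \<open>auto elim: eventually_mono\<close>)
    moreover have "norm (P l t) \<le> P_max"
      by (rule tendsto_upperbound[OF tendsto_norm[OF Pl]]) (use ev z(2) in \<open>auto elim: eventually_mono\<close>)
    moreover have "Y l t \<bullet> k = 0"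
    proof (rule tendsto_unique)
      show "(\<lambda>n. Y (z (r n)) t \<bullet> k) \<longlonglongrightarrow> Y l t \<bullet> k" by (intro tendsto_intros Yl)
      show "(\<lambda>n. Y (z (r n)) t \<bullet> k) \<longlonglongrightarrow> 0"
        using ev z(2) by (intro tendsto_eventually) (auto elim: eventually_mono)
    qed simp
    ultimately show ?thesis by blast
  qed
  then have "confined l" by (simp add: confined_def)
  moreover have "l = (\<phi>, fst (snd l), snd (snd l))" using l by (auto simp: mem_Times_iff prod_eq_iff)
  ultimately show ?thesis by metis
qed

end

section \<open>The invariant torus of confined motions\<close>

context torus_driven_particle
begin

definition position :: "'k state \<Rightarrow> real \<Rightarrow> real^3" where
  "position z t = height (Y z t) *\<^sub>R (k + Y z t)"

definition sphere_velocity :: "'k state \<Rightarrow> real \<Rightarrow> real^3" where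
  "sphere_velocity z t = - (Y z t \<bullet> P z t) *\<^sub>R position z t + sqrt (1 + Y z t \<bullet> Y z t) *\<^sub>R P z t"

lemma confined_bounds:
  assumes "confined z"
  shows "norm (Y z t) \<le> R" "norm (P z t) \<le> P_max" "Y z t \<bullet> k = 0"
    "clip R (Y z t) = Y z t" "clip K (P z t) = P z t"
proof -
  show *: "norm (Y z t) \<le> R" "norm (P z t) \<le> P_max" "Y z t \<bullet> k = 0"
    using assms by (auto simp: confined_def)
  have "norm (P z t) \<le> K" using * by (simp add: K_def)
  then show "clip R (Y z t) = Y z t" "clip K (P z t) = P z t" using * R_pos K_pos clip_id by blast+
qed

lemma confined_position:
  assumes z: "confined z"
  shows "position z t \<bullet> k = height (Y z t)" "norm (position z t) = 1"
proof -
  have yk: "Y z t \<bullet> k = 0" and cl: "clip R (Y z t) = Y z t" using confined_bounds[OF z] by auto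
  have pos: "0 < 1 + Y z t \<bullet> Y z t" by (simp add: add_pos_nonneg)
  show "position z t \<bullet> k = height (Y z t)" by (simp add: position_def inner_add_left kk yk)
  have "position z t \<bullet> position z t = (height (Y z t))\<^sup>2 * (1 + Y z t \<bullet> Y z t)"
    using yk by (simp add: position_def inner_add_left inner_add_right kk inner_commute power2_eq_square)
  also have "\<dots> = 1" using pos by (simp add: height_def cl power_divide)
  finally show "norm (position z t) = 1" by (simp add: norm_eq_1)
qed

lemma confined_velocity_bound:
  assumes z: "confined z"
  shows "norm (sphere_velocity z t) \<le> R * P_max + (1 + R) * P_max"
proof -
  note b = confined_bounds[OF z, of t]
  have "\<bar>Y z t \<bullet> P z t\<bar> \<le> R * P_max"
    using b R_pos by (intro order_trans[OF Cauchy_Schwarz_ineq2] mult_mono) auto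
  moreover have "sqrt (1 + Y z t \<bullet> Y z t) \<le> 1 + R"
  proof (rule real_le_lsqrt)
    have "Y z t \<bullet> Y z t \<le> R\<^sup>2" using b by (simp add: dot_square_norm power_mono)
    then show "1 + Y z t \<bullet> Y z t \<le> (1 + R)\<^sup>2" using R_pos by (simp add: power2_eq_square algebra_simps)
  qed (use R_pos in auto)
  ultimately show ?thesis
    unfolding sphere_velocity_def using b R_pos confined_position(2)[OF z, of t]
    by (intro norm_triangle_mono) (auto intro!: mult_mono)
qed

text \<open>Along a confined solution the truncations are inactive, and the force \<open>push\<close> differs from the
  ambient force by a multiple of the position, because \<open>k + y = x / h\<close>.\<close>

lemma confined_motion:
  assumes z: "confined z"
  shows "sphere_motion a k (\<lambda>t. E (fst z + t *\<^sub>R \<omega>)) (position z) (sphere_velocity z)"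
  unfolding sphere_motion_def
proof (intro allI conjI)
  fix t
  \<comment> \<open>The reciprocal of the height.\<close>
  define s where "s = (\<lambda>t. sqrt (1 + Y z t \<bullet> Y z t))"
  define m where "m = (\<lambda>t. Y z t \<bullet> P z t)"
  have spos: "s t > 0" for t by (simp add: s_def add_pos_nonneg)
  have s2: "s t * s t = 1 + Y z t \<bullet> Y z t" for t by (simp add: s_def)
  have h: "height (Y z t) = 1 / s t" for t by (simp add: height_def s_def confined_bounds[OF z])
  have Y': "(Y z has_vector_derivative (s t * s t) *\<^sub>R P z t) (at t)" for t
    using Y_deriv[of z t] by (simp add: confined_bounds[OF z] s2)
  have P': "(P z has_vector_derivative (1 / s t) *\<^sub>R push (fst z + t *\<^sub>R \<omega>) (Y z t)) (at t)" for t
    using P_deriv[of z t] by (simp add: h)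
  have s': "(s has_real_derivative s t * m t) (at t)" for t
  proof -
    have "((\<lambda>t. 1 + Y z t \<bullet> Y z t) has_real_derivative 2 * (s t * s t) * m t) (at t)"
      using DERIV_add[OF DERIV_const has_real_derivative_inner[OF Y' Y'], of 1 t]
      by (elim DERIV_cong) (simp add: m_def inner_commute algebra_simps)
    moreover have "0 < 1 + Y z t \<bullet> Y z t" by (simp add: add_pos_nonneg)
    ultimately have "(s has_real_derivative inverse (s t) / 2 * (2 * (s t * s t) * m t)) (at t)"
      unfolding s_def by (intro DERIV_chain2[OF DERIV_real_sqrt])
    then show ?thesis by (rule DERIV_cong) (use spos[of t] in \<open>simp add: field_simps\<close>)
  qed
  have h': "((\<lambda>t. 1 / s t) has_real_derivative - (m t / s t)) (at t)" for t
    using spos[of t] by (auto intro!: derivative_eq_intros s' simp: field_simps)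
  obtain m' where m': "(m has_real_derivative m') (at t)"
    unfolding m_def using has_real_derivative_inner[OF Y' P'] by blast
  have pos_eq: "position z = (\<lambda>t. (1 / s t) *\<^sub>R (k + Y z t))" by (auto simp: position_def h)
  have vel_eq: "sphere_velocity z = (\<lambda>t. - m t *\<^sub>R position z t + s t *\<^sub>R P z t)"
    by (auto simp: sphere_velocity_def s_def m_def)
  show n: "norm (position z t) = 1" by (rule confined_position[OF z])
  have x': "(position z has_vector_derivative sphere_velocity z t) (at t)" for t
  proof -
    have "(position z has_vector_derivative (1 / s t) *\<^sub>R ((s t * s t) *\<^sub>R P z t) + (- (m t / s t)) *\<^sub>R (k + Y z t)) (at t)"
      unfolding pos_eq
      by (rule has_vector_derivative_scaleR[OF h']) (auto intro!: derivative_eq_intros Y')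
    moreover have "(1 / s t) *\<^sub>R ((s t * s t) *\<^sub>R P z t) + (- (m t / s t)) *\<^sub>R (k + Y z t) = sphere_velocity z t"
      unfolding vel_eq pos_eq using spos[of t] by (simp add: algebra_simps)
    ultimately show ?thesis by simp
  qed
  then show "(position z has_vector_derivative sphere_velocity z t) (at t)" .
  let ?e = "E (fst z + t *\<^sub>R \<omega>)" and ?x = "position z t"
  let ?w = "(- m t *\<^sub>R sphere_velocity z t + (- m') *\<^sub>R ?x)
      + (s t *\<^sub>R ((1 / s t) *\<^sub>R push (fst z + t *\<^sub>R \<omega>) (Y z t)) + (s t * m t) *\<^sub>R P z t)"
  have w: "(sphere_velocity z has_vector_derivative ?w) (at t)"
    by (subst vel_eq) (intro has_vector_derivative_add has_vector_derivative_scaleR s' P' x' DERIV_minus m')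
  have push: "push (fst z + t *\<^sub>R \<omega>) (Y z t) = ambient_force a k ?e ?x + ((coulomb a (1 / s t) - ?e \<bullet> k) * s t) *\<^sub>R ?x"
  proof -
    have "k + Y z t = s t *\<^sub>R ?x" unfolding pos_eq using spos[of t] by simp
    then have Y_eq: "Y z t = s t *\<^sub>R ?x - k" by (simp add: algebra_simps)
    have xk: "?x \<bullet> k = 1 / s t" using confined_position(1)[OF z, of t] by (simp add: h)
    show ?thesis
      unfolding push_def confined_bounds(4)[OF z] h ambient_force_def xk
      by (subst Y_eq) (simp add: algebra_simps)
  qed
  have w_eq: "?w = ambient_force a k ?e ?x + (m t * m t - m' + (coulomb a (1 / s t) - ?e \<bullet> k) * s t) *\<^sub>R ?x"
    unfolding push using spos[of t] by (simp add: vel_eq algebra_simps)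
  have "?x \<bullet> ?x = 1" using n by (simp add: norm_eq_1)
  then have "tan_proj ?x (v + r *\<^sub>R ?x) = tan_proj ?x v" for v r
    by (simp add: tan_proj_def inner_add_left algebra_simps)
  with w show "\<exists>w. (sphere_velocity z has_vector_derivative w) (at t) \<and>
      tan_proj ?x w = tan_proj ?x (ambient_force a k ?e ?x)"
    unfolding w_eq by metis
qed

text \<open>The solution on the sphere is unique and determines the gnomonic coordinate for all times,
  whose derivative at time \<open>0\<close> determines the momentum. Only the field along the orbits matters,
  not the phase itself, which gives the periodicity of \<open>torus_section\<close> as well.\<close>

lemma confined_unique:
  assumes z: "confined z" and w: "confined w"
    and E: "\<And>t. E (fst z + t *\<^sub>R \<omega>) = E (fst w + t *\<^sub>R \<omega>)"
  shows "snd z = snd w"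
proof -
  have pos: "position z t = position w t" for t
  proof (rule driven_particle.motion_unique[OF driven[of "fst z"]])
    show "sphere_motion a k (\<lambda>t. E (fst z + t *\<^sub>R \<omega>)) (position z) (sphere_velocity z)"
      by (rule confined_motion[OF z])
    show "sphere_motion a k (\<lambda>t. E (fst z + t *\<^sub>R \<omega>)) (position w) (sphere_velocity w)"
      unfolding E by (rule confined_motion[OF w])
  qed (simp_all add: confined_position z w height_range)
  have "Y v t = (1 / (position v t \<bullet> k)) *\<^sub>R position v t - k" if "confined v" for v t
    using height_range[of "Y v t"] confined_bounds(3)[OF that, of t]
    by (simp add: position_def inner_add_left kk)
  then have Y: "Y z t = Y w t" for t using z w pos by metis
  then have "Y z = Y w" by auto
  then have "(1 + Y z 0 \<bullet> Y z 0) *\<^sub>R P z 0 = (1 + Y z 0 \<bullet> Y z 0) *\<^sub>R P w 0"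
    using vector_derivative_unique_at[OF Y_deriv[of z 0, unfolded confined_bounds(4,5)[OF z]]]
      Y_deriv[of w 0, unfolded confined_bounds(4,5)[OF w]] by metis
  moreover have "0 < 1 + Y z 0 \<bullet> Y z 0" by (simp add: add_pos_nonneg)
  ultimately have "P z 0 = P w 0" by simp
  then show ?thesis using Y[of 0] by (simp add: Y_def P_def flow prod_eq_iff)
qed

text \<open>The graph of this function is an invariant torus, the set of all states with a confined
  solution.\<close>

definition torus_section :: "real^'k \<Rightarrow> (real^3) \<times> (real^3)" where
  "torus_section \<phi> = (SOME s. confined (\<phi>, s))"

lemma confined_torus_section: "confined (\<phi>, torus_section \<phi>)"
  unfolding torus_section_def using confined_exists[of \<phi>] by (metis someI)

lemma torus_section_unique: "confined z \<Longrightarrow> snd z = torus_section (fst z)"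
  using confined_unique[OF _ confined_torus_section, of z "fst z"] by simp

lemma continuous_on_torus_section: "continuous_on UNIV torus_section"
proof (rule continuous_from_closed_graph)
  show "compact (cball (0 :: real^3) R \<times> cball (0 :: real^3) P_max)" by (intro compact_Times compact_cball)
  show "torus_section \<in> UNIV \<rightarrow> cball 0 R \<times> cball 0 P_max"
  proof
    fix \<phi>
    show "torus_section \<phi> \<in> cball 0 R \<times> cball 0 P_max"
      using confined_bounds(1,2)[OF confined_torus_section, of \<phi> 0] by (simp add: mem_Times_iff Y_def P_def flow)
  qed
  have "(\<lambda>\<phi>. (\<phi>, torus_section \<phi>)) ` UNIV = {z. confined z}"
    using confined_torus_section torus_section_unique by (auto simp: image_iff prod_eq_iff) 
  then show "closed ((\<lambda>\<phi>. (\<phi>, torus_section \<phi>)) ` UNIV)" using closed_confined by simp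
qed

lemma torus_periodic_torus_section:
  assumes "torus_periodic E"
  shows "torus_periodic torus_section"
  unfolding torus_periodic_def
proof (intro allI)
  fix \<phi> i
  have "E (\<phi> + axis i (2 * pi) + t *\<^sub>R \<omega>) = E (\<phi> + t *\<^sub>R \<omega>)" for t
    using assms unfolding torus_periodic_def by (metis add.assoc add.commute)
  then show "torus_section (\<phi> + axis i (2 * pi)) = torus_section \<phi>"
    using confined_unique[OF confined_torus_section[of "\<phi> + axis i (2 * pi)"] confined_torus_section[of \<phi>]] by simp
qed

theorem quasiperiodic_motion_exists:
  assumes "torus_periodic E"
  obtains x v B where "sphere_motion a k (\<lambda>t. E (t *\<^sub>R \<omega>)) x v" "quasiperiodic \<omega> x"
    "\<And>t. 0 < x t \<bullet> k" "\<And>t. norm (v t) \<le> B"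
proof
  let ?z = "(0, torus_section 0)"
  define U where "U = (\<lambda>\<phi>. (1 / sqrt (1 + fst (torus_section \<phi>) \<bullet> fst (torus_section \<phi>))) *\<^sub>R (k + fst (torus_section \<phi>)))"
  show "sphere_motion a k (\<lambda>t. E (t *\<^sub>R \<omega>)) (position ?z) (sphere_velocity ?z)"
    using confined_motion[OF confined_torus_section[of 0]] by simp
  show "0 < position ?z t \<bullet> k" for t
    by (simp add: confined_position(1)[OF confined_torus_section] height_range)
  show "norm (sphere_velocity ?z t) \<le> R * P_max + (1 + R) * P_max" for t
    by (rule confined_velocity_bound[OF confined_torus_section])
  have Upos: "U (fst z + t *\<^sub>R \<omega>) = position z t" if z: "confined z" for z t
  proof -
    have "snd (flow z t) = torus_section (fst z + t *\<^sub>R \<omega>)"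
      using torus_section_unique[OF confined_flow[OF z], of t] by (simp add: fst_flow)
    then have "fst (torus_section (fst z + t *\<^sub>R \<omega>)) = Y z t" by (simp add: Y_def)
    then show ?thesis by (simp add: U_def position_def height_def confined_bounds[OF z])
  qed
  show "quasiperiodic \<omega> (position ?z)"
    unfolding quasiperiodic_def
  proof (intro exI[of _ U] conjI allI)
    show "continuous_on UNIV U"
      unfolding U_def
      by (intro continuous_intros continuous_on_torus_section) (auto simp: add_pos_nonneg less_imp_neq[symmetric] intro!: less_imp_neq[symmetric])
    show "torus_periodic U" using torus_periodic_torus_section[OF assms] by (simp add: U_def torus_periodic_def)
    show "range U \<subseteq> sphere 0 1"
    proof safe
      fix \<phi>
      show "U \<phi> \<in> sphere 0 1"
        using Upos[OF confined_torus_section[of \<phi>], of 0] confined_position(2)[OF confined_torus_section[of \<phi>], of 0] by simp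
    qed
    show "position ?z t = U (t *\<^sub>R \<omega>)" for t
      using Upos[OF confined_torus_section[of 0], of t] by simp
  qed
qed

end

section \<open>Hyperbolicity\<close>

text \<open>The projection along \<open>x\<close> disappears when only tangent vectors are inserted; what remains is
  the derivative of the Coulomb force and the contribution of the normal component of the force.
  The first summand is nonnegative for \<open>\<xi> = \<eta>\<close>.\<close>

lemma cov_deriv_force:
  fixes E :: "real^'k \<Rightarrow> real^3"
  assumes x: "norm x = 1" and k: "norm k = 1" and a: "a > 0" and pos: "0 \<le> x \<bullet> k"
    and \<eta>: "\<eta> \<bullet> x = 0" and \<xi>: "\<xi> \<bullet> x = 0"
  shows "cov_deriv (force a k E \<phi>) x \<eta> \<bullet> \<xi> =
    3 * a\<^sup>2 / sqrt (1 + a\<^sup>2 + 2 * a * (x \<bullet> k)) ^ 5 * (\<eta> \<bullet> k) * (\<xi> \<bullet> k)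
    - (ambient_force a k (E \<phi>) x \<bullet> x) * (\<eta> \<bullet> \<xi>)"
proof -
  have xx: "x \<bullet> x = 1" using x by (simp add: norm_eq_1)
  define u where "u = x + a *\<^sub>R k"
  define \<rho> where "\<rho> = sqrt (1 + a\<^sup>2 + 2 * a * (x \<bullet> k))"
  have nu: "norm u = \<rho>" unfolding u_def \<rho>_def by (rule norm_from_center[OF x k])
  have "0 < 1 + a\<^sup>2 + 2 * a * (x \<bullet> k)" using a pos by (simp add: add_pos_nonneg)
  then have \<rho>: "\<rho> > 0" by (simp add: \<rho>_def)
  then have "u \<noteq> 0" using nu by auto
  define c where "c = (\<lambda>y. inverse (norm (y + a *\<^sub>R k) ^ 3))"
  define c' where "c' = (\<lambda>v. - 3 * (u \<bullet> v) / \<rho> ^ 5)"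
  have c': "(c has_derivative c') (at x)"
  proof -
    have "((\<lambda>y. norm (y + a *\<^sub>R k)) has_derivative (\<lambda>v. u \<bullet> v / \<rho>)) (at x)"
    proof -
      have "((\<lambda>y. y + a *\<^sub>R k) has_derivative (\<lambda>v. v)) (at x)" by (auto intro!: derivative_eq_intros)
      from has_derivative_compose[OF this has_derivative_norm[OF \<open>u \<noteq> 0\<close>, unfolded u_def]]
      show ?thesis by (simp add: sgn_div_norm u_def[symmetric] nu divide_inverse mult.commute inner_commute)
    qed
    moreover have "((\<lambda>r. inverse (r ^ 3)) has_derivative (\<lambda>h. (- 3 / \<rho> ^ 4) * h)) (at (norm (x + a *\<^sub>R k)))"
      unfolding has_field_derivative_def[symmetric] u_def[symmetric] nu
      using \<rho> by (auto intro!: derivative_eq_intros simp: field_simps eval_nat_numeral)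
    ultimately have "((\<lambda>y. inverse (norm (y + a *\<^sub>R k) ^ 3)) has_derivative (\<lambda>v. (- 3 / \<rho> ^ 4) * (u \<bullet> v / \<rho>))) (at x)"
      by (rule has_derivative_compose)
    moreover have "(\<lambda>v. (- 3 / \<rho> ^ 4) * (u \<bullet> v / \<rho>)) = c'"
      unfolding c'_def by (simp add: eval_nat_numeral fun_eq_iff)
    ultimately show ?thesis unfolding c_def by (simp only:)
  qed
  define F where "F = (\<lambda>y. c y *\<^sub>R (y + a *\<^sub>R k))"
  define F' where "F' = (\<lambda>v. c x *\<^sub>R v + c' v *\<^sub>R u)"
  have F': "(F has_derivative F') (at x)"
    unfolding F_def F'_def u_def by (intro has_derivative_scaleR c') (auto intro!: derivative_eq_intros)
  have force: "force a k E \<phi> = (\<lambda>y. - F y + E \<phi> + ((F y - E \<phi>) \<bullet> y) *\<^sub>R y)"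
    by (simp add: force_def F_def c_def fun_eq_iff)
  define D where "D = (\<lambda>v. - F' v + (((F x - E \<phi>) \<bullet> x) *\<^sub>R v + ((F x - E \<phi>) \<bullet> v + F' v \<bullet> x) *\<^sub>R x))"
  have "(force a k E \<phi> has_derivative D) (at x)"
    unfolding force D_def
    by (auto intro!: derivative_eq_intros F')
  then have "frechet_derivative (force a k E \<phi>) (at x) \<eta> = D \<eta>"
    using frechet_derivative_at by metis
  then have "cov_deriv (force a k E \<phi>) x \<eta> \<bullet> \<xi> = D \<eta> \<bullet> \<xi>"
    using \<xi> by (simp add: cov_deriv_def tan_proj_def inner_diff_left inner_commute[of x \<xi>])
  also have "\<dots> = - (F' \<eta> \<bullet> \<xi>) + ((F x - E \<phi>) \<bullet> x) * (\<eta> \<bullet> \<xi>)"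
    using \<xi> by (simp add: D_def inner_add_left inner_diff_left inner_commute[of x \<xi>] algebra_simps)
  also have "F' \<eta> \<bullet> \<xi> = (\<eta> \<bullet> \<xi>) / \<rho> ^ 3 - 3 * a\<^sup>2 / \<rho> ^ 5 * (\<eta> \<bullet> k) * (\<xi> \<bullet> k)"
    using \<xi> \<eta> by (simp add: F'_def c_def c'_def u_def[symmetric] nu inner_add_left)
      (simp add: u_def inner_add_left inner_add_right inner_diff_right inner_diff_left inner_commute
        divide_inverse power2_eq_square algebra_simps)
  also have "(F x - E \<phi>) \<bullet> x = 1 / \<rho> ^ 3 - ambient_force a k (E \<phi>) x \<bullet> x"
  proof -
    have "F x \<bullet> x = (1 + a * (x \<bullet> k)) / \<rho> ^ 3"
      by (simp add: F_def c_def u_def[symmetric] nu) (simp add: u_def inner_add_left inner_add_right xx inner_commute divide_inverse)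
    then show ?thesis
      by (simp add: ambient_force_def coulomb_def \<rho>_def[symmetric] inner_diff_left inner_commute[of k x] add_divide_distrib)
  qed
  finally show ?thesis unfolding \<rho>_def[symmetric] by (simp add: algebra_simps)
qed

lemma vector_4:
  "(vector [x, y, z, w] :: 'a::zero^4) $ 1 = x"
  "(vector [x, y, z, w] :: 'a::zero^4) $ 2 = y"
  "(vector [x, y, z, w] :: 'a::zero^4) $ 3 = z"
  "(vector [x, y, z, w] :: 'a::zero^4) $ 4 = w"
  by (simp_all add: vector_def)

text \<open>Parallel transport of \<open>e\<close> along \<open>x\<close> is the linear equation \<open>e' = - (e \<bullet> v) x\<close>, which preserves
  the inner products of its solutions with each other and their orthogonality to \<open>x\<close>. The
  vectors tangent at time \<open>0\<close> are the images of two coordinate axes under an orthogonal map that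
  takes the third one to \<open>x 0\<close>.\<close>

lemma parallel_frame_exists:
  assumes n: "\<And>t. norm (x t) = 1" and x': "\<And>t. (x has_vector_derivative v t) (at t)"
    and v: "continuous_on UNIV v" "\<And>t. norm (v t) \<le> B"
  obtains e where "parallel_orthonormal_frame x e" "\<And>i. continuous_on UNIV (e i)"
proof -
  have xx: "x t \<bullet> x t = 1" and xv: "x t \<bullet> v t = 0" for t
    using n unit_curve_orthogonal_velocity[OF n x'] by (auto simp: norm_eq_1)
  have xcont: "continuous_on UNIV x"
    by (meson x' continuous_at_imp_continuous_on has_vector_derivative_continuous)
  have B: "B \<ge> 0" using v(2)[of 0] norm_ge_zero order_trans by blast
  have transport: "\<exists>e. e 0 = e0 \<and> (\<forall>t. (e has_vector_derivative - (e t \<bullet> v t) *\<^sub>R x t) (at t))" for e0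
  proof (rule global_solution_of_Lipschitz_equation[where F = "\<lambda>t e. - (e \<bullet> v t) *\<^sub>R x t" and L = "B + 1" and B = 0 and ?z0.0 = e0])
    show "continuous_on UNIV (\<lambda>t. - (z t \<bullet> v t) *\<^sub>R x t)" if "continuous_on UNIV z" for z
      by (intro continuous_intros that v xcont)
    show "norm (- (y \<bullet> v t) *\<^sub>R x t - - (z \<bullet> v t) *\<^sub>R x t) \<le> (B + 1) * norm (y - z)" for t y z
    proof -
      have "- (y \<bullet> v t) *\<^sub>R x t - - (z \<bullet> v t) *\<^sub>R x t = - ((y - z) \<bullet> v t) *\<^sub>R x t"
        by (simp add: inner_diff_left algebra_simps)
      also have "norm \<dots> \<le> norm (y - z) * norm (v t)"
        using Cauchy_Schwarz_ineq2[of "y - z" "v t"] n by simp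
      also have "\<dots> \<le> norm (y - z) * (B + 1)" using v(2)[of t] by (intro mult_left_mono) auto
      finally show ?thesis by (simp add: mult.commute)
    qed
  qed (use B in auto)
  obtain T :: "real^3 \<Rightarrow> real^3" where T: "orthogonal_transformation T" "T (axis 3 1) = x 0"
    using orthogonal_transformation_exists_1[of "axis 3 1 :: real^3" "x 0"] n by auto
  define e0 :: "2 \<Rightarrow> real^3" where "e0 = (\<lambda>i. if i = 1 then T (axis 1 1) else T (axis 2 1))"
  have e0x: "e0 i \<bullet> x 0 = 0" for i
    using T by (simp add: e0_def T(2)[symmetric] orthogonal_transformation_def inner_axis_axis)
  have e0e0: "e0 i \<bullet> e0 j = (if i = j then 1 else 0)" for i j
    using T exhaust_2[of i] exhaust_2[of j]
    by (auto simp: e0_def orthogonal_transformation_def inner_axis_axis)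
  obtain e where e0: "\<And>i. e i 0 = e0 i" and e': "\<And>i t. (e i has_vector_derivative - (e i t \<bullet> v t) *\<^sub>R x t) (at t)"
  proof -
    have "\<forall>i. \<exists>e. e 0 = e0 i \<and> (\<forall>t. (e has_vector_derivative - (e t \<bullet> v t) *\<^sub>R x t) (at t))"
      using transport by blast
    from choice[OF this] that show thesis by blast
  qed
  have ex: "e i t \<bullet> x t = 0" for i t
  proof -
    have "((\<lambda>t. e i t \<bullet> x t) has_real_derivative 0) (at t)" for t
      using has_real_derivative_inner[OF e'[of i t] x'[of t]] by (simp add: xx)
    then have "e i t \<bullet> x t = e i 0 \<bullet> x 0"
      using DERIV_isconst_all[of "\<lambda>t. e i t \<bullet> x t" t 0] by simp
    then show ?thesis by (simp add: e0 e0x)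
  qed
  have ee: "e i t \<bullet> e j t = (if i = j then 1 else 0)" for i j t
  proof -
    have "((\<lambda>t. e i t \<bullet> e j t) has_real_derivative 0) (at t)" for t
      using has_real_derivative_inner[OF e'[of i t] e'[of j t]] ex[of j t] ex[of i t] by (simp add: inner_commute)
    then have "e i t \<bullet> e j t = e i 0 \<bullet> e j 0"
      using DERIV_isconst_all[of "\<lambda>t. e i t \<bullet> e j t" t 0] by simp
    then show ?thesis by (simp add: e0 e0e0)
  qed
  have "has_cov_deriv_along x (e i) 0 t" for i t
    unfolding has_cov_deriv_along_def
    using e'[of i t] by (intro exI[of _ "- (e i t \<bullet> v t) *\<^sub>R x t"]) (simp add: tan_proj_def xx)
  then have "parallel_orthonormal_frame x e"
    unfolding parallel_orthonormal_frame_def using ex ee by blast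
  moreover have "continuous_on UNIV (e i)" for i
    by (meson e' continuous_at_imp_continuous_on has_vector_derivative_continuous)
  ultimately show thesis using that by blast
qed

lemma norm_le_sum_entries:
  fixes A :: "real^'n^'m"
  shows "norm A \<le> (\<Sum>i\<in>UNIV. \<Sum>j\<in>UNIV. \<bar>A $ i $ j\<bar>)"
proof -
  have "norm A \<le> (\<Sum>i\<in>UNIV. norm (A $ i))" by (simp add: norm_vec_def L2_set_le_sum)
  also have "\<dots> \<le> (\<Sum>i\<in>UNIV. \<Sum>j\<in>UNIV. \<bar>A $ i $ j\<bar>)" by (intro sum_mono norm_le_l1_cart)
  finally show ?thesis .
qed

context torus_driven_particle
begin

text \<open>The form is \<open>V = p \<bullet> q - c \<parallel>p\<parallel>\<^sup>2\<close> for \<open>z = (p, q)\<close> and \<open>c = h' / h\<close>. Since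
  \<open>c' = - g / h - S - c\<^sup>2\<close> and the matrix \<open>b\<close> is at least \<open>- S\<close>, the terms with \<open>S\<close>, which have
  no sign, cancel in the derivative of \<open>V\<close>. It is at least \<open>\<parallel>q - c p\<parallel>\<^sup>2 + \<delta> \<parallel>p\<parallel>\<^sup>2\<close>, a positive
  definite form with constants that are uniform in time.\<close>

lemma motion_hyperbolic:
  assumes m: "sphere_motion a k (\<lambda>t. E (t *\<^sub>R \<omega>)) x v" and pos: "\<And>t. 0 < x t \<bullet> k"
    and vB: "\<And>t. norm (v t) \<le> B"
  shows "hyperbolic (force a k E) \<omega> x"
proof -
  have n: "norm (x t) = 1" and x': "(x has_vector_derivative v t) (at t)" for t
    using m by (auto simp: sphere_motion_def)
  have vel: "velocity x = v" using x' by (auto simp: velocity_def vector_derivative_at)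
  have xv: "x t \<bullet> v t = 0" for t by (rule unit_curve_orthogonal_velocity[OF n x'])
  have xcont: "continuous_on UNIV x"
    by (meson x' continuous_at_imp_continuous_on has_vector_derivative_continuous)
  have vcont: "continuous_on UNIV v"
    by (meson sphere_motion_acceleration[OF m] continuous_at_imp_continuous_on has_vector_derivative_continuous)
  obtain f where frame: "parallel_orthonormal_frame x f" and fcont: "\<And>i. continuous_on UNIV (f i)"
    using parallel_frame_exists[OF n x' vcont vB] by blast
  have fx: "f i t \<bullet> x t = 0" and ff: "f i t \<bullet> f j t = (if i = j then 1 else 0)" for i j t
    using frame by (auto simp: parallel_orthonormal_frame_def)
  have fn: "norm (f i t) = 1" for i t using ff[of i t i] by (simp add: norm_eq_1)
  define h where "h = (\<lambda>t. x t \<bullet> k)"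
  have h: "h\<^sub>0 \<le> h t" "0 < h t" "h t \<le> 1" for t
    using motion_stays_high[OF m pos, of t] pos[of t] norm_cauchy_schwarz[of "x t" k] n k_unit
    by (auto simp: h_def)
  define \<beta> where "\<beta> = (\<lambda>t. 3 * a\<^sup>2 / sqrt (1 + a\<^sup>2 + 2 * a * h t) ^ 5)"
  define S where "S = (\<lambda>t. G t (x t) \<bullet> x t + v t \<bullet> v t)"
  define b where "b = (\<lambda>i j t. variational_rhs (force a k E) \<omega> x t (f j t) \<bullet> f i t)"
  have b: "b i j t = \<beta> t * (f j t \<bullet> k) * (f i t \<bullet> k) - S t * (f j t \<bullet> f i t) + (f j t \<bullet> v t) * (f i t \<bullet> v t)" for i j t
  proof -
    have "curvature (x t) (f j t) (v t) (v t) = (v t \<bullet> v t) *\<^sub>R f j t - (f j t \<bullet> v t) *\<^sub>R v t"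
      using fx[of j t] xv[of t] n[of t] by (intro curvature_eq) (auto simp: inner_commute)
    moreover have "cov_deriv (force a k E (t *\<^sub>R \<omega>)) (x t) (f j t) \<bullet> f i t
        = \<beta> t * (f j t \<bullet> k) * (f i t \<bullet> k) - (G t (x t) \<bullet> x t) * (f j t \<bullet> f i t)"
      unfolding \<beta>_def h_def using n k_unit a_pos pos[of t] fx by (intro cov_deriv_force) auto
    ultimately show ?thesis
      unfolding b_def variational_rhs_def vel S_def
      by (simp only: inner_diff_left inner_scaleR_left) (simp add: algebra_simps inner_commute)
  qed
  define A where "A = variational_matrix (force a k E) \<omega> x f"
  have A: "A t = vector [vector [0, 0, 1, 0], vector [0, 0, 0, 1],
      vector [b 1 1 t, b 1 2 t, 0, 0], vector [b 2 1 t, b 2 2 t, 0, 0]]" for t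
    by (simp add: A_def variational_matrix_def b_def)
  have Econt: "continuous_on UNIV (\<lambda>t. E (t *\<^sub>R \<omega>))"
  proof -
    have "continuous_on UNIV E"
    proof (rule lipschitz_on_continuous_on[of "\<bar>L\<^sub>E\<bar>"], rule lipschitz_onI)
      fix \<phi> \<psi> :: "real^'k"
      have "L\<^sub>E * norm (\<phi> - \<psi>) \<le> \<bar>L\<^sub>E\<bar> * norm (\<phi> - \<psi>)" by (intro mult_right_mono) auto
      then show "dist (E \<phi>) (E \<psi>) \<le> \<bar>L\<^sub>E\<bar> * dist \<phi> \<psi>"
        using E_Lipschitz[of \<phi> \<psi>] by (simp add: dist_norm)
    qed simp
    then show ?thesis by (rule continuous_on_compose2) (auto intro!: continuous_intros)
  qed
  have \<rho>pos: "0 < 1 + a\<^sup>2 + 2 * a * (x t \<bullet> k)" for t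
    using a_pos pos[of t] by (simp add: add_pos_nonneg)
  have bcont: "continuous_on UNIV (b i j)" for i j
  proof -
    have nz: "1 + a\<^sup>2 + 2 * a * (x t \<bullet> k) \<noteq> 0" for t using \<rho>pos[of t] by simp
    have "continuous_on UNIV (\<lambda>t. coulomb a (x t \<bullet> k))"
      unfolding coulomb_def using nz by (intro continuous_intros xcont) auto
    then have "continuous_on UNIV S"
      unfolding S_def ambient_force_def by (intro continuous_intros xcont vcont Econt)
    moreover have "continuous_on UNIV \<beta>"
      unfolding \<beta>_def h_def using nz by (intro continuous_intros xcont) auto
    ultimately show ?thesis
      unfolding b[abs_def] by (intro continuous_intros fcont vcont)
  qed
  have B: "B \<ge> 0" using vB[of 0] norm_ge_zero order_trans by blast
  define b_max where "b_max = 3 * a\<^sup>2 + (C + a + B * B) + B * B"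
  have bbnd: "\<bar>b i j t\<bar> \<le> b_max" for i j t
  proof -
    have fk: "\<bar>f i t \<bullet> k\<bar> \<le> 1" for i using Cauchy_Schwarz_ineq2[of "f i t" k] fn k_unit by simp
    have fv: "\<bar>f i t \<bullet> v t\<bar> \<le> B" for i using Cauchy_Schwarz_ineq2[of "f i t" "v t"] fn vB[of t] by simp
    have "1 \<le> sqrt (1 + a\<^sup>2 + 2 * a * h t)" using a_pos h[of t] by simp
    then have "1 \<le> sqrt (1 + a\<^sup>2 + 2 * a * h t) ^ 5" by (rule one_le_power)
    moreover have "0 \<le> 3 * a\<^sup>2 / W \<and> 3 * a\<^sup>2 / W \<le> 3 * a\<^sup>2" if "1 \<le> W" for W :: real
      using that divide_left_mono[of 1 W "3 * a\<^sup>2"] by simp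
    ultimately have \<beta>: "0 \<le> \<beta> t" "\<beta> t \<le> 3 * a\<^sup>2"
      unfolding \<beta>_def by blast+
    have "\<bar>\<beta> t * (f j t \<bullet> k) * (f i t \<bullet> k)\<bar> \<le> 3 * a\<^sup>2 * 1 * 1"
      unfolding abs_mult using \<beta> fk by (intro mult_mono) auto
    moreover have "\<bar>S t * (f j t \<bullet> f i t)\<bar> \<le> C + a + B * B"
    proof -
      have "0 \<le> coulomb a (x t \<bullet> k)"
        using coulomb_lower[OF a_pos, of "h t"] h[of t] a_pos
        by (smt (verit) divide_nonneg_nonneg h_def zero_le_power)
      then have "norm (G t (x t)) \<le> C + a"
        unfolding ambient_force_def
        using coulomb_upper[OF a_pos, of "x t \<bullet> k"] pos[of t] E_bound[of "t *\<^sub>R \<omega>"] k_unit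
        by (intro order_trans[OF norm_triangle_ineq4] add_mono) auto
      then have "\<bar>G t (x t) \<bullet> x t\<bar> \<le> C + a" using Cauchy_Schwarz_ineq2[of "G t (x t)" "x t"] n by simp
      moreover have "\<bar>v t \<bullet> v t\<bar> \<le> B * B"
        using vB[of t] B by (intro order_trans[OF Cauchy_Schwarz_ineq2] mult_mono) auto
      ultimately have "\<bar>S t\<bar> \<le> C + a + B * B" unfolding S_def by linarith
      then show ?thesis using C_nonneg a_pos B by (auto simp: ff intro!: add_nonneg_nonneg)
    qed
    moreover have "\<bar>(f j t \<bullet> v t) * (f i t \<bullet> v t)\<bar> \<le> B * B"
      unfolding abs_mult using fv B by (intro mult_mono) auto
    ultimately show ?thesis unfolding b b_max_def by linarith
  qed
  have Acont: "continuous_on UNIV A"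
  proof -
    have "\<forall>i j. continuous_on UNIV (\<lambda>t. A t $ i $ j)"
      unfolding A by (simp add: forall_4 vector_4 bcont)
    then have "continuous_on UNIV (\<lambda>t. \<chi> i j. A t $ i $ j)"
      by (intro continuous_on_vec_lambda) blast
    then show ?thesis by simp
  qed
  have Abnd: "norm (A t) \<le> 2 + 4 * b_max" for t
    using norm_le_sum_entries[of "A t"] bbnd[of 1 1 t] bbnd[of 1 2 t] bbnd[of 2 1 t] bbnd[of 2 2 t]
    unfolding A by (simp add: sum_4 vector_4)
  define c where "c = (\<lambda>t. (v t \<bullet> k) / h t)"
  define c_max where "c_max = B / h\<^sub>0"
  have cbnd: "\<bar>c t\<bar> \<le> c_max" for t
  proof -
    have "\<bar>v t \<bullet> k\<bar> \<le> B" using Cauchy_Schwarz_ineq2[of "v t" k] vB[of t] k_unit by simp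
    then have "\<bar>v t \<bullet> k\<bar> / h t \<le> B / h\<^sub>0" using h[of t] h\<^sub>0_pos B by (intro frac_le) auto
    then show ?thesis using h(2)[of t] by (simp add: c_def c_max_def)
  qed
  define g where "g = (\<lambda>t. - (G t (x t) \<bullet> k))"
  have g: "\<delta> \<le> g t" for t
    using downward_force[of "x t" t] n pos[of t] by (simp add: g_def)
  have c': "(c has_real_derivative - (g t / h t) - S t - (c t)\<^sup>2) (at t)" for t
  proof -
    have dh: "(h has_real_derivative v t \<bullet> k) (at t)"
      unfolding h_def by (rule has_real_derivative_inner_const[OF x'])
    have dv: "((\<lambda>t. v t \<bullet> k) has_real_derivative - g t - S t * h t) (at t)"
      using has_real_derivative_inner_const[OF sphere_motion_acceleration[OF m, of t], of k]
      by (simp add: g_def S_def h_def inner_diff_left)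
    have "(c has_real_derivative ((- g t - S t * h t) * h t - (v t \<bullet> k) * (v t \<bullet> k)) / (h t * h t)) (at t)"
      unfolding c_def by (rule DERIV_divide[OF dv dh]) (use h(2)[of t] in simp)
    then show ?thesis
      by (rule DERIV_cong) (use h(2)[of t] in \<open>simp add: c_def field_simps power2_eq_square\<close>)
  qed
  define V where "V = (\<lambda>t (z :: real^4) (w :: real^4).
      (z $ 1 * w $ 3 + z $ 2 * w $ 4 + w $ 1 * z $ 3 + w $ 2 * z $ 4) / 2
      - c t * (z $ 1 * w $ 1 + z $ 2 * w $ 2))"
  \<comment> \<open>The rate results from \<open>\<parallel>q\<parallel>\<^sup>2 \<le> 2 \<parallel>q - c p\<parallel>\<^sup>2 + 2 c\<^sup>2 \<parallel>p\<parallel>\<^sup>2\<close> with \<open>c\<close> bounded by \<open>c_max\<close>.\<close>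
  define c\<^sub>0 where "c\<^sub>0 = 1 / (2 + (1 + 2 * c_max\<^sup>2) / \<delta>)"
  have c\<^sub>0: "c\<^sub>0 > 0" unfolding c\<^sub>0_def using \<delta>_pos by (intro divide_pos_pos add_pos_nonneg) auto
  have cm: "0 \<le> c_max" using cbnd[of 0] by linarith
  have "exp_dichotomy A"
  proof (rule exp_dichotomy_if_quadratic_form_grows[OF Acont Abnd, of V "2 + 2 * c_max" c\<^sub>0])
    show "bilinear (V t)" for t
      unfolding bilinear_def V_def by (auto intro!: linearI simp: algebra_simps add_divide_distrib)
    show "V t z w = V t w z" for t z w by (simp add: V_def mult.commute add.commute add.left_commute)
    show "\<bar>V t z w\<bar> \<le> (2 + 2 * c_max) * norm z * norm w" for t z w
    proof -
      have p: "\<bar>z $ i * w $ j\<bar> \<le> norm z * norm w" for i j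
        unfolding abs_mult by (intro mult_mono component_le_norm_cart) auto
      have "\<bar>z $ 1 * w $ 1 + z $ 2 * w $ 2\<bar> \<le> 2 * (norm z * norm w)"
        using p[of 1 1] p[of 2 2] by linarith
      then have "\<bar>c t * (z $ 1 * w $ 1 + z $ 2 * w $ 2)\<bar> \<le> c_max * (2 * (norm z * norm w))"
        unfolding abs_mult[of "c t"] using cbnd cm by (intro mult_mono) auto
      moreover have "\<bar>z $ 1 * w $ 3 + z $ 2 * w $ 4 + w $ 1 * z $ 3 + w $ 2 * z $ 4\<bar> \<le> 4 * (norm z * norm w)"
        using p[of 1 3] p[of 2 4] p[of 3 1] p[of 4 2] by (simp add: mult.commute)
      moreover have "(2 + 2 * c_max) * norm z * norm w = 4 * (norm z * norm w) / 2 + c_max * (2 * (norm z * norm w))"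
        by (simp add: algebra_simps)
      moreover have "\<bar>X / 2 - Y\<bar> \<le> 4 * p / 2 + q" if "\<bar>X\<bar> \<le> 4 * p" "\<bar>Y\<bar> \<le> q" for X Y p q :: real
        using that by linarith
      ultimately show ?thesis unfolding V_def by (simp only:)
    qed
    show "\<exists>D\<ge>c\<^sub>0 * (norm (z t))\<^sup>2. ((\<lambda>t. V t (z t) (z t)) has_real_derivative D) (at t)"
      if z': "\<And>t. (z has_vector_derivative A t *v z t) (at t)" for z t
    proof -
      have comp: "((\<lambda>t. z t $ i) has_real_derivative (A t *v z t) $ i) (at t)" for i t
        using bounded_linear.has_vector_derivative[OF bounded_linear_vec_nth z']
        by (simp add: has_real_derivative_iff_has_vector_derivative)
      have Az: "(A t *v z t) $ 1 = z t $ 3" "(A t *v z t) $ 2 = z t $ 4"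
        "(A t *v z t) $ 3 = b 1 1 t * z t $ 1 + b 1 2 t * z t $ 2"
        "(A t *v z t) $ 4 = b 2 1 t * z t $ 1 + b 2 2 t * z t $ 2"
        unfolding A matrix_vector_mult_def by (simp_all add: sum_4 vector_4)
      define p1 p2 q1 q2 where "p1 = z t $ 1" and "p2 = z t $ 2" and "q1 = z t $ 3" and "q2 = z t $ 4"
      note d = comp[of 1 t, unfolded Az, folded p1_def p2_def q1_def q2_def]
        comp[of 2 t, unfolded Az, folded p1_def p2_def q1_def q2_def]
        comp[of 3 t, unfolded Az, folded p1_def p2_def q1_def q2_def]
        comp[of 4 t, unfolded Az, folded p1_def p2_def q1_def q2_def]
      define \<gamma> where "\<gamma> = c t"
      define N where "N = p1\<^sup>2 + p2\<^sup>2"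
      define bpp where "bpp = b 1 1 t * p1 * p1 + (b 1 2 t + b 2 1 t) * p1 * p2 + b 2 2 t * p2 * p2"
      define D where "D = q1\<^sup>2 + q2\<^sup>2 + bpp - (- (g t / h t) - S t - \<gamma>\<^sup>2) * N - 2 * \<gamma> * (p1 * q1 + p2 * q2)"
      have "((\<lambda>t. z t $ 1 * z t $ 3 + z t $ 2 * z t $ 4 - c t * ((z t $ 1)\<^sup>2 + (z t $ 2)\<^sup>2)) has_real_derivative D) (at t)"
        unfolding D_def bpp_def N_def
        by (rule derivative_eq_intros d c' refl | simp add: p1_def p2_def q1_def q2_def \<gamma>_def)+
          (simp add: power2_eq_square algebra_simps)
      moreover have "(\<lambda>t. V t (z t) (z t)) = (\<lambda>t. z t $ 1 * z t $ 3 + z t $ 2 * z t $ 4 - c t * ((z t $ 1)\<^sup>2 + (z t $ 2)\<^sup>2))"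
        by (auto simp: V_def power2_eq_square algebra_simps)
      moreover have "c\<^sub>0 * (norm (z t))\<^sup>2 \<le> D"
      proof -
        have "bpp = \<beta> t * (p1 * (f 1 t \<bullet> k) + p2 * (f 2 t \<bullet> k))\<^sup>2 - S t * N + (p1 * (f 1 t \<bullet> v t) + p2 * (f 2 t \<bullet> v t))\<^sup>2"
          unfolding bpp_def b N_def by (simp add: ff power2_eq_square algebra_simps)
        moreover have "0 \<le> \<beta> t" unfolding \<beta>_def h_def using \<rho>pos[of t] by simp
        ultimately have "bpp \<ge> - S t * N" by (simp add: add_nonneg_nonneg)
        moreover have "\<delta> \<le> g t / h t"
          using g[of t] h[of t] \<delta>_pos by (simp add: pos_le_divide_eq) (smt (verit) mult_left_le)
        then have "\<delta> * N \<le> g t / h t * N" by (intro mult_right_mono) (auto simp: N_def)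
        ultimately have "D \<ge> q1\<^sup>2 + q2\<^sup>2 + \<delta> * N + \<gamma>\<^sup>2 * N - 2 * \<gamma> * (p1 * q1 + p2 * q2)"
          unfolding D_def by (simp add: algebra_simps)
        moreover define W where "W = (q1 - \<gamma> * p1)\<^sup>2 + (q2 - \<gamma> * p2)\<^sup>2"
        ultimately have D: "D \<ge> W + \<delta> * N"
          unfolding W_def N_def by (simp add: power2_eq_square algebra_simps)
        have W: "W \<ge> 0" and N: "N \<ge> 0" by (auto simp: W_def N_def)
        have "\<gamma>\<^sup>2 \<le> c_max\<^sup>2" using cbnd[of t] cm by (simp add: \<gamma>_def abs_le_square_iff[symmetric])
        then have \<gamma>N: "\<gamma>\<^sup>2 * N \<le> c_max\<^sup>2 * N" using N by (intro mult_right_mono)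
        have sq: "q\<^sup>2 \<le> 2 * (q - r)\<^sup>2 + 2 * r\<^sup>2" for q r :: real
          using zero_le_power2[of "q - 2 * r"] by (simp add: power2_eq_square algebra_simps)
        have "(norm (z t))\<^sup>2 = N + (q1\<^sup>2 + q2\<^sup>2)"
          unfolding power2_norm_eq_inner by (simp add: inner_vec_def sum_4 N_def p1_def p2_def q1_def q2_def power2_eq_square)
        also have "\<dots> \<le> 2 * W + (1 + 2 * c_max\<^sup>2) * N"
          using sq[of q1 "\<gamma> * p1"] sq[of q2 "\<gamma> * p2"] \<gamma>N
          unfolding W_def N_def by (simp add: power_mult_distrib algebra_simps)
        also have "\<dots> \<le> (2 + (1 + 2 * c_max\<^sup>2) / \<delta>) * (W + \<delta> * N)"
        proof -
          have "0 \<le> (1 + 2 * c_max\<^sup>2) / \<delta> * W" using W \<delta>_pos by (intro mult_nonneg_nonneg) auto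
          moreover have "(1 + 2 * c_max\<^sup>2) / \<delta> * (\<delta> * N) = (1 + 2 * c_max\<^sup>2) * N" using \<delta>_pos by simp
          moreover have "0 \<le> \<delta> * N" using \<delta>_pos N by simp
          ultimately show ?thesis unfolding distrib_left distrib_right by linarith
        qed
        also have "\<dots> \<le> (2 + (1 + 2 * c_max\<^sup>2) / \<delta>) * D"
          using D \<delta>_pos by (intro mult_left_mono) auto
        finally have "c\<^sub>0 * (norm (z t))\<^sup>2 \<le> c\<^sub>0 * ((2 + (1 + 2 * c_max\<^sup>2) / \<delta>) * D)"
          using c\<^sub>0 by (intro mult_left_mono) auto
        also have "\<dots> = D"
        proof -
          have "2 + (1 + 2 * c_max\<^sup>2) / \<delta> \<noteq> 0" using c\<^sub>0 unfolding c\<^sub>0_def by auto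
          then show ?thesis by (simp add: c\<^sub>0_def)
        qed
        finally show ?thesis .
      qed
      ultimately show ?thesis by auto
    qed
    \<comment> \<open>Both test the position part \<open>p\<close> of a vector, and they write it into different components.\<close>
    let ?Q = "vector [vector [1, 0, 0, 0], vector [0, 1, 0, 0], 0, 0] :: real^4^4"
    let ?Q' = "vector [0, 0, vector [1, 0, 0, 0], vector [0, 1, 0, 0]] :: real^4^4"
    show "?Q *v y = 0 \<and> ?Q' *v w = 0" if "?Q *v y + ?Q' *v w = 0" for y w
      using that by (simp add: vec_eq_iff forall_4 matrix_vector_mult_def sum_4 vector_4)
    show "V t y y \<le> 0" if "?Q *v y = 0" for t y
      using that by (simp add: vec_eq_iff forall_4 matrix_vector_mult_def sum_4 vector_4 V_def)
    show "0 \<le> V t y y" if "?Q' *v y = 0" for t y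
      using that by (simp add: vec_eq_iff forall_4 matrix_vector_mult_def sum_4 vector_4 V_def)
  qed (use c\<^sub>0 cm in auto)
  then show ?thesis
    unfolding hyperbolic_def A_def using frame by blast
qed

end

section \<open>The quasiperiodic solution\<close>

lemma is_solution_iff_sphere_motion:
  assumes "norm k = 1"
  shows "is_solution (force a k E) \<omega> x \<longleftrightarrow> sphere_motion a k (\<lambda>t. E (t *\<^sub>R \<omega>)) x (velocity x)"
proof -
  have "x differentiable (at t) \<longleftrightarrow> (x has_vector_derivative velocity x t) (at t)" for t
    unfolding velocity_def by (auto simp: vector_derivative_works differentiableI_vector)
  moreover have "force a k E (t *\<^sub>R \<omega>) (x t) = tan_proj (x t) w \<longleftrightarrow>
      tan_proj (x t) w = tan_proj (x t) (ambient_force a k (E (t *\<^sub>R \<omega>)) (x t))" if "norm (x t) = 1" for t w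
    using force_eq_tan_proj[OF that assms] by metis
  ultimately show ?thesis
    unfolding is_solution_def sphere_motion_def has_cov_deriv_along_def by (simp cong: conj_cong)
qed

theorem theorem7:
  fixes avec k :: "real^3" and a :: real
    and \<omega> :: "real^'k" and E :: "real^'k \<Rightarrow> real^3"
  assumes "avec \<noteq> 0"
    and "a = norm avec"
    and "k = - (avec /\<^sub>R a)"
    and "rationally_independent \<omega>"
    and "torus_periodic E" and "smooth E"
    and "\<forall>\<phi>. a / (1 + a) ^ 3 - E \<phi> \<bullet> k > 0"
    and "\<exists>\<phi>\<^sub>0. \<forall>c. E \<phi>\<^sub>0 \<noteq> c *\<^sub>R k"
  shows "(\<exists>!x. is_solution (force a k E) \<omega> x \<and> quasiperiodic \<omega> x \<and> range x \<subseteq> hemisphere k) \<and>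
         (\<forall>x. is_solution (force a k E) \<omega> x \<and> quasiperiodic \<omega> x \<and> range x \<subseteq> hemisphere k
            \<longrightarrow> hyperbolic (force a k E) \<omega> x)"
proof -
  have a: "a > 0" using assms(1,2) by simp
  have k: "norm k = 1" using assms(1,2,3) by simp
  have Econt: "continuous_on UNIV E"
    using assms(6) unfolding smooth_def by (metis C_diff.simps(1))
  obtain C where C: "\<And>\<phi>. norm (E \<phi>) \<le> C" using torus_continuous_bounded[OF assms(5) Econt] by blast
  obtain L where L: "\<And>\<phi> \<psi>. norm (E \<phi> - E \<psi>) \<le> L * norm (\<phi> - \<psi>)"
    using torus_smooth_Lipschitz[OF assms(5,6)] by blast
  have "torus_periodic (\<lambda>\<phi>. a / (1 + a) ^ 3 - E \<phi> \<bullet> k)"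
    using assms(5) by (simp add: torus_periodic_def)
  moreover have "continuous_on UNIV (\<lambda>\<phi>. a / (1 + a) ^ 3 - E \<phi> \<bullet> k)"
    by (intro continuous_intros Econt)
  ultimately obtain \<delta> where \<delta>: "\<delta> > 0" "\<And>\<phi>. \<delta> \<le> a / (1 + a) ^ 3 - E \<phi> \<bullet> k"
    using torus_positive_lower_bound assms(7) by blast
  interpret torus_driven_particle a k \<delta> C \<omega> E L
    by unfold_locales (use a k C L \<delta> in \<open>auto simp: algebra_simps\<close>)
  obtain x v B where x: "sphere_motion a k (\<lambda>t. E (t *\<^sub>R \<omega>)) x v" "quasiperiodic \<omega> x"
    "\<And>t. 0 < x t \<bullet> k" "\<And>t. norm (v t) \<le> B"
    using quasiperiodic_motion_exists[OF assms(5)] by blast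
  have v: "velocity x = v"
    using x(1) by (auto simp: sphere_motion_def velocity_def vector_derivative_at)
  have sol: "is_solution (force a k E) \<omega> x \<and> quasiperiodic \<omega> x \<and> range x \<subseteq> hemisphere k"
  proof (intro conjI x)
    show "is_solution (force a k E) \<omega> x"
      unfolding is_solution_iff_sphere_motion[OF k] v by (rule x)
    have "norm (x t) = 1" for t using x(1) by (simp add: sphere_motion_def)
    then have "x t \<bullet> k \<le> 1" for t using norm_cauchy_schwarz[of "x t" k] k by simp
    then show "range x \<subseteq> hemisphere k"
      using x(3) \<open>\<And>t. norm (x t) = 1\<close> by (auto simp: hemisphere_def)
  qed
  have unique: "y = x"
    if y: "is_solution (force a k E) \<omega> y \<and> quasiperiodic \<omega> y \<and> range y \<subseteq> hemisphere k" for y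
  proof
    fix t
    have "0 < y t \<bullet> k" for t using y by (auto simp: hemisphere_def)
    moreover have "sphere_motion a k (\<lambda>t. E (t *\<^sub>R \<omega>)) y (velocity y)"
      using y is_solution_iff_sphere_motion[OF k] by blast
    ultimately show "y t = x t" using motion_unique[OF _ _ x(1,3)] by blast
  qed
  have hyp: "hyperbolic (force a k E) \<omega> x" by (rule motion_hyperbolic[OF x(1,3,4)])
  show ?thesis
  proof (intro conjI allI impI)
    show "\<exists>!x. is_solution (force a k E) \<omega> x \<and> quasiperiodic \<omega> x \<and> range x \<subseteq> hemisphere k"
      using sol unique by (intro ex1I[of _ x])
    fix y assume "is_solution (force a k E) \<omega> y \<and> quasiperiodic \<omega> y \<and> range y \<subseteq> hemisphere k"
    from unique[OF this] hyp show "hyperbolic (force a k E) \<omega> y" by (simp only:)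
  qed
qed

end
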